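(* There is a randomized highly parallel algorithm which, given any differentiable $L$-Lipschitz convex $f:\mathbb{R}^d\to\mathbb{R}$ minimized at some $x^*$ with $\|x^*\|\le R$, and $\epsilon,\nu>0$, computes with probability at least $1-\nu$ a point $x\in\mathbb{R}^d$ with $f(x)-f(x^* )\le\epsilon$, using depth $\tilde O\big(d^{1/3}(LR/\epsilon)^{2/3}\big)$ and work $\tilde O\big(d^{4/3}(LR/\epsilon)^{8/3}\big)$, where $\tilde O(\cdot)$ hides factors polylogarithmic in $d,\epsilon,L,R,\nu^{-1}$.
   Context: A highly parallel algorithm interacts with a gradient oracle for $f$ in rounds: in each round it submits a finite set of query points (chosen based on all previous answers and its internal randomness) and receives $\nabla f(x)$ for each query $x$. The depth is the number of rounds; the work is the total number of queries. *)

theory Defs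
  imports "HOL-Probability.Probability"
begin

text \<open>Points of R^d are encoded as functions nat => real vanishing outside {..<d};
  this lets the dimension d be quantified inside the statement, so that the constants
  hidden in the O-tilde do not depend on d.\<close>

type_synonym vec = "nat \<Rightarrow> real"
type_synonym seed = "nat \<Rightarrow> real"
type_synonym history = "(vec \<times> vec) list list"

definition Rd :: "nat \<Rightarrow> vec set" where
  "Rd d = {x. \<forall>i\<ge>d. x i = 0}"

definition trunc_d :: "nat \<Rightarrow> vec \<Rightarrow> vec" where
  "trunc_d d x = (\<lambda>i. if i < d then x i else 0)"

definition inner_d :: "nat \<Rightarrow> vec \<Rightarrow> vec \<Rightarrow> real" where
  "inner_d d x y = (\<Sum>i<d. x i * y i)"

definition norm_d :: "nat \<Rightarrow> vec \<Rightarrow> real" where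
  "norm_d d x = sqrt (inner_d d x x)"

definition has_gradient_d :: "nat \<Rightarrow> (vec \<Rightarrow> real) \<Rightarrow> vec \<Rightarrow> vec \<Rightarrow> bool" where
  "has_gradient_d d f g x \<longleftrightarrow> g \<in> Rd d \<and>
     (\<forall>e>0. \<exists>\<delta>>0. \<forall>h\<in>Rd d. norm_d d h < \<delta> \<longrightarrow>
        \<bar>f (\<lambda>i. x i + h i) - f x - inner_d d g h\<bar> \<le> e * norm_d d h)"

definition differentiable_d :: "nat \<Rightarrow> (vec \<Rightarrow> real) \<Rightarrow> bool" where
  "differentiable_d d f \<longleftrightarrow> (\<forall>x\<in>Rd d. \<exists>g. has_gradient_d d f g x)"

definition lipschitz_d :: "nat \<Rightarrow> real \<Rightarrow> (vec \<Rightarrow> real) \<Rightarrow> bool" where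
  "lipschitz_d d L f \<longleftrightarrow>
     (\<forall>x\<in>Rd d. \<forall>y\<in>Rd d. \<bar>f x - f y\<bar> \<le> L * norm_d d (\<lambda>i. x i - y i))"

definition convex_d :: "nat \<Rightarrow> (vec \<Rightarrow> real) \<Rightarrow> bool" where
  "convex_d d f \<longleftrightarrow> (\<forall>x\<in>Rd d. \<forall>y\<in>Rd d. \<forall>t::real. 0 \<le> t \<and> t \<le> 1 \<longrightarrow>
     f (\<lambda>i. (1 - t) * x i + t * y i) \<le> (1 - t) * f x + t * f y)"

text \<open>Interaction with the gradient oracle: in round k the algorithm submits the finite
  list of queries Q seed h, where h is the history of all previous rounds (queries paired
  with the returned gradients), and receives the gradient at each query.  Queries are read
  as points of R^d (coordinates beyond d are ignored).\<close>
fun transcript :: "(seed \<Rightarrow> history \<Rightarrow> vec list) \<Rightarrow> (vec \<Rightarrow> vec) \<Rightarrow> nat \<Rightarrow> seed \<Rightarrow> nat \<Rightarrow> history" where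
  "transcript Q grad d \<omega> 0 = []"
| "transcript Q grad d \<omega> (Suc k) =
     (let h = transcript Q grad d \<omega> k
      in h @ [map (\<lambda>q. (q, grad (trunc_d d q))) (Q \<omega> h)])"

definition work :: "(seed \<Rightarrow> history \<Rightarrow> vec list) \<Rightarrow> (vec \<Rightarrow> vec) \<Rightarrow> nat \<Rightarrow> seed \<Rightarrow> nat \<Rightarrow> nat" where
  "work Q grad d \<omega> D = (\<Sum>k<D. length (Q \<omega> (transcript Q grad d \<omega> k)))"

definition polylog :: "nat \<Rightarrow> nat \<Rightarrow> real \<Rightarrow> real \<Rightarrow> real \<Rightarrow> real \<Rightarrow> real" where
  "polylog k d L R \<epsilon> \<nu> =
     (1 + ln (2 + real d + L + R + 1 / L + 1 / R + \<epsilon> + 1 / \<epsilon> + 1 / \<nu>)) ^ k"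

end

theory Submission
  imports Defs
begin

text \<open>
  Let \<open>F\<close> be the convolution of \<open>f\<close> with a Gaussian of variance \<open>\<sigma>\<^sup>2\<close> per coordinate, where
  \<open>\<sigma>\<close> is of order \<open>\<epsilon> / (L \<surd>d)\<close>, so that \<open>F\<close> and \<open>f\<close> differ by at most \<open>\<epsilon> / 4\<close>.  Gradients of \<open>f\<close> at
  Gaussian samples around one centre determine, by importance reweighting, the gradient of \<open>F\<close> in
  the whole ball of radius \<open>\<sigma>\<close> around that centre.  One round of queries therefore suffices to
  minimize \<open>F\<close> over a ball of radius \<open>r = \<sigma> / 4\<close>, and Monteiro--Svaiter acceleration needs about
  \<open>(R / r)\<^bsup>2/3\<^esup>\<close> such ball minimizations, which is \<open>d\<^bsup>1/3\<^esup> (L R / \<epsilon>)\<^bsup>2/3\<^esup>\<close> up to constants.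
  The parameter search of the accelerated method is replaced by an adaptive guess, which is
  divided or multiplied by \<open>e\<close> according to the multiplier of the ball problem.

  All centres and candidate points are rounded to a finite lattice.  A union bound over pairs of
  lattice points then makes a single set of samples good for every round, so that adaptivity of the
  queries plays no role in the probabilistic part.  Medians of means give the union bound from second
  moments only: of order \<open>d\<close> groups (up to logarithms) of order \<open>(L R / \<epsilon>)\<^sup>2\<close> samples each.
\<close>

text \<open>The exponent 2/3 balances two kinds of progress. If the multiplier of the ball problem
  is at most the guess \<open>b\<close>, then \<open>A\<close> grows by a factor of at least 1 +
  1/sqrt(bA). If it exceeds \<open>b\<close>, the Lyapunov function drops by at least a constant
  times bA (r/R)^2 in units of R^2. Both rates are of order \<theta> when bA = 1/\<theta>^2 and
  \<theta>^3 = (r/R)^2, hence about 1/\<theta> rounds up to logarithms.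

  The obstacle is that the exact minimizer over a ball is only known to exist, and that the smoothed
  gradient is never observed. The algorithm therefore looks for a lattice point and a multiplier
  that pass an approximate KKT test stated in terms of observed gradients. Rounding the exact KKT
  pair shows that some candidate passes; a candidate that passes is correct because two strict
  majorities of sample groups share a group.

  The good event refers only to lattice pairs and is fixed before any query. Given a good sample,
  the rest of the argument is deterministic.\<close>

section \<open>Euclidean geometry of the encoded space\<close>

lemma inner_d_add_left: "inner_d d (\<lambda>i. x i + y i) z = inner_d d x z + inner_d d y z"
  by (simp add: inner_d_def sum.distrib algebra_simps)

lemma inner_d_diff_left: "inner_d d (\<lambda>i. x i - y i) z = inner_d d x z - inner_d d y z"
  by (simp add: inner_d_def sum_subtractf algebra_simps)

lemma inner_d_scale_left: "inner_d d (\<lambda>i. t * x i) z = t * inner_d d x z"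
  by (simp add: inner_d_def sum_distrib_left algebra_simps)

lemma inner_d_minus_left: "inner_d d (\<lambda>i. - x i) z = - inner_d d x z"
  by (simp add: inner_d_def sum_negf)

lemma inner_d_commute: "inner_d d x y = inner_d d y x"
  by (simp add: inner_d_def mult.commute)

lemma inner_d_add_right: "inner_d d z (\<lambda>i. x i + y i) = inner_d d z x + inner_d d z y"
  by (simp add: inner_d_def sum.distrib algebra_simps)

lemma inner_d_diff_right: "inner_d d z (\<lambda>i. x i - y i) = inner_d d z x - inner_d d z y"
  by (simp add: inner_d_def sum_subtractf algebra_simps)

lemma inner_d_scale_right: "inner_d d z (\<lambda>i. t * x i) = t * inner_d d z x"
  by (simp add: inner_d_def sum_distrib_left algebra_simps)

lemma inner_d_minus_right: "inner_d d z (\<lambda>i. - x i) = - inner_d d z x"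
  by (simp add: inner_d_def sum_negf)

lemmas inner_d_linear = inner_d_add_left inner_d_diff_left inner_d_scale_left inner_d_minus_left
  inner_d_add_right inner_d_diff_right inner_d_scale_right inner_d_minus_right

lemma inner_d_self_nonneg: "0 \<le> inner_d d x x"
  by (simp add: inner_d_def sum_nonneg)

lemma norm_d_sq: "(norm_d d x)\<^sup>2 = inner_d d x x"
  by (simp add: norm_d_def inner_d_self_nonneg)

lemma norm_d_eq_L2_set: "norm_d d x = L2_set x {..<d}"
  by (simp add: norm_d_def L2_set_def inner_d_def power2_eq_square)

lemma norm_d_nonneg [simp]: "0 \<le> norm_d d x"
  by (simp add: norm_d_eq_L2_set)

lemma norm_d_triangle: "norm_d d (\<lambda>i. x i + y i) \<le> norm_d d x + norm_d d y"
  by (simp add: norm_d_eq_L2_set L2_set_triangle_ineq)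

lemma norm_d_scale: "norm_d d (\<lambda>i. t * x i) = \<bar>t\<bar> * norm_d d x"
  by (simp add: norm_d_def inner_d_linear real_sqrt_mult flip: mult.assoc power2_eq_square)

lemma norm_d_minus: "norm_d d (\<lambda>i. - x i) = norm_d d x"
  by (simp add: norm_d_def inner_d_linear)

lemma norm_d_diff_commute: "norm_d d (\<lambda>i. x i - y i) = norm_d d (\<lambda>i. y i - x i)"
  using norm_d_minus[of d "\<lambda>i. x i - y i"] by simp

lemma norm_d_triangle_via: "norm_d d (\<lambda>i. x i - z i) \<le> norm_d d (\<lambda>i. x i - y i) + norm_d d (\<lambda>i. y i - z i)"
  using norm_d_triangle[of d "\<lambda>i. x i - y i" "\<lambda>i. y i - z i"] by simp

lemma norm_d_cong: "(\<And>i. i < d \<Longrightarrow> x i = y i) \<Longrightarrow> norm_d d x = norm_d d y"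
  by (simp add: norm_d_def inner_d_def)

lemma inner_d_cong: "(\<And>i. i < d \<Longrightarrow> x i = x' i) \<Longrightarrow> (\<And>i. i < d \<Longrightarrow> y i = y' i)
   \<Longrightarrow> inner_d d x y = inner_d d x' y'"
  by (simp add: inner_d_def)

lemma norm_d_zero [simp]: "norm_d d (\<lambda>i. 0) = 0"
  by (simp add: norm_d_def inner_d_def)

lemma abs_inner_d_le: "\<bar>inner_d d x y\<bar> \<le> norm_d d x * norm_d d y"
proof -
  have "\<bar>inner_d d x y\<bar> \<le> (\<Sum>i<d. \<bar>x i\<bar> * \<bar>y i\<bar>)"
    unfolding inner_d_def by (rule order_trans[OF sum_abs]) (simp add: abs_mult)
  also have "\<dots> \<le> norm_d d x * norm_d d y"
    unfolding norm_d_eq_L2_set by (rule L2_set_mult_ineq)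
  finally show ?thesis .
qed

lemma inner_d_le: "inner_d d x y \<le> norm_d d x * norm_d d y"
  using abs_inner_d_le[of d x y] by linarith

lemma component_le_norm_d: "i < d \<Longrightarrow> \<bar>x i\<bar> \<le> norm_d d x"
  using member_le_L2_set[of "{..<d}" i "\<lambda>i. \<bar>x i\<bar>"]
  by (simp add: norm_d_eq_L2_set L2_set_def)

lemma norm_d_le_sup:
  assumes "\<And>i. i < d \<Longrightarrow> \<bar>x i\<bar> \<le> b" "0 \<le> b"
  shows "norm_d d x \<le> sqrt (real d) * b"
proof -
  have "inner_d d x x \<le> (\<Sum>i<d. b * b)"
    unfolding inner_d_def
    by (intro sum_mono) (metis abs_le_square_iff assms abs_of_nonneg lessThan_iff power2_eq_square)
  then have "norm_d d x \<le> sqrt (real d * (b * b))"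
    unfolding norm_d_def by (simp add: mult.assoc)
  with assms(2) show ?thesis by (simp add: real_sqrt_mult)
qed

lemma norm_d_eq_0D: "norm_d d x = 0 \<Longrightarrow> i < d \<Longrightarrow> x i = 0"
  using component_le_norm_d[of i d x] by simp

lemma Rd_trunc [simp]: "trunc_d d x \<in> Rd d"
  by (simp add: Rd_def trunc_d_def)

lemma trunc_d_id: "x \<in> Rd d \<Longrightarrow> trunc_d d x = x"
  by (auto simp: Rd_def trunc_d_def fun_eq_iff)

lemma Rd_zero [simp]: "(\<lambda>i. 0) \<in> Rd d"
  by (simp add: Rd_def)

lemma Rd_add: "x \<in> Rd d \<Longrightarrow> y \<in> Rd d \<Longrightarrow> (\<lambda>i. x i + y i) \<in> Rd d"
  and Rd_diff: "x \<in> Rd d \<Longrightarrow> y \<in> Rd d \<Longrightarrow> (\<lambda>i. x i - y i) \<in> Rd d"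
  and Rd_scale: "x \<in> Rd d \<Longrightarrow> (\<lambda>i. t * x i) \<in> Rd d"
  by (auto simp: Rd_def)

section \<open>Convex Lipschitz functions and their gradients\<close>

text \<open>After truncation only finitely many coordinates matter, so coordinatewise convergence
  controls \<open>norm_d\<close>. Continuity for the product topology later supplies both Borel
  measurability and, with compactness, the minimizers over balls.\<close>

lemma lipschitz_d_imp_continuous:
  assumes "lipschitz_d d L f"
  shows "continuous_on UNIV (\<lambda>z. f (trunc_d d z))"
proof -
  have "((\<lambda>z. f (trunc_d d z)) \<longlongrightarrow> f (trunc_d d z0)) (at z0)" for z0 :: vec
  proof (rule LIM_zero_cancel, rule Lim_null_comparison)
    show "eventually (\<lambda>z. norm (f (trunc_d d z) - f (trunc_d d z0)) \<le> L * norm_d d (\<lambda>i. z i - z0 i)) (at z0)"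
    proof (rule always_eventually, rule allI)
      fix z
      have "norm_d d (\<lambda>i. trunc_d d z i - trunc_d d z0 i) = norm_d d (\<lambda>i. z i - z0 i)"
        by (rule norm_d_cong) (simp add: trunc_d_def)
      moreover have "\<bar>f (trunc_d d z) - f (trunc_d d z0)\<bar> \<le> L * norm_d d (\<lambda>i. trunc_d d z i - trunc_d d z0 i)"
        using assms unfolding lipschitz_d_def by simp
      ultimately show "norm (f (trunc_d d z) - f (trunc_d d z0)) \<le> L * norm_d d (\<lambda>i. z i - z0 i)"
        by simp
    qed
    have c: "continuous_on UNIV (\<lambda>z::vec. L * norm_d d (\<lambda>i. z i - z0 i))"
      unfolding norm_d_def inner_d_def by (intro continuous_intros continuous_on_product_coordinates)
    show "((\<lambda>z. L * norm_d d (\<lambda>i. z i - z0 i)) \<longlongrightarrow> 0) (at z0)"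
      using c[unfolded continuous_on_def, rule_format, of z0] by simp
  qed
  then show ?thesis by (simp add: continuous_on_def)
qed

locale convex_problem =
  fixes d :: nat and L :: real and f :: "vec \<Rightarrow> real" and grad :: "vec \<Rightarrow> vec"
  assumes L_pos: "0 < L"
    and lip: "lipschitz_d d L f"
    and conv: "convex_d d f"
    and gradient: "\<And>x. x \<in> Rd d \<Longrightarrow> has_gradient_d d f (grad x) x"
begin

lemma f_lipschitz:
  "x \<in> Rd d \<Longrightarrow> y \<in> Rd d \<Longrightarrow> \<bar>f x - f y\<bar> \<le> L * norm_d d (\<lambda>i. x i - y i)"
  using lip by (simp add: lipschitz_d_def)

lemma grad_Rd: "x \<in> Rd d \<Longrightarrow> grad x \<in> Rd d"
  using gradient by (simp add: has_gradient_d_def)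

lemma directional_derivative:
  assumes x: "x \<in> Rd d" and h: "h \<in> Rd d"
  shows "((\<lambda>t. (f (\<lambda>i. x i + t * h i) - f x) / t) \<longlongrightarrow> inner_d d (grad x) h) (at_right 0)"
proof (rule tendstoI)
  fix e :: real assume e: "0 < e"
  \<comment> \<open>The added 1 keeps the denominator positive for \<open>h = 0\<close>; the factor
    2 makes the final bound strict.\<close>
  define e' where "e' = e / (2 * (1 + norm_d d h))"
  have nh: "0 < 1 + norm_d d h" using norm_d_nonneg[of d h] by linarith
  have e': "0 < e'" using e nh by (simp add: e'_def)
  obtain \<delta> where \<delta>: "\<delta> > 0" and *: "\<And>h. h \<in> Rd d \<Longrightarrow> norm_d d h < \<delta> \<Longrightarrow>
      \<bar>f (\<lambda>i. x i + h i) - f x - inner_d d (grad x) h\<bar> \<le> e' * norm_d d h"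
    using gradient[OF x] e' unfolding has_gradient_d_def by blast
  show "eventually (\<lambda>t. dist ((f (\<lambda>i. x i + t * h i) - f x) / t) (inner_d d (grad x) h) < e) (at_right 0)"
    unfolding eventually_at_right_field
  proof (intro exI conjI allI impI)
    show "0 < \<delta> / (1 + norm_d d h)" using \<delta> nh by simp
    fix t :: real assume t: "0 < t" "t < \<delta> / (1 + norm_d d h)"
    have "t * norm_d d h \<le> t * (1 + norm_d d h)" using t by simp
    also have "\<dots> < \<delta>" using t nh by (simp add: field_simps)
    finally have "norm_d d (\<lambda>i. t * h i) < \<delta>" using t by (simp add: norm_d_scale)
    from *[OF Rd_scale[OF h] this]
    have "\<bar>f (\<lambda>i. x i + t * h i) - f x - t * inner_d d (grad x) h\<bar> \<le> e' * (t * norm_d d h)"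
      using t by (simp add: inner_d_linear norm_d_scale)
    then have "\<bar>f (\<lambda>i. x i + t * h i) - f x - t * inner_d d (grad x) h\<bar> / t \<le> e' * norm_d d h"
      using t by (simp add: field_simps)
    also have "\<bar>f (\<lambda>i. x i + t * h i) - f x - t * inner_d d (grad x) h\<bar> / t
        = \<bar>(f (\<lambda>i. x i + t * h i) - f x) / t - inner_d d (grad x) h\<bar>"
      using t by (simp add: abs_if field_simps)
    also have "e' * norm_d d h \<le> e' * (1 + norm_d d h)" using e' by simp
    also have "\<dots> = e / 2" using nh by (simp add: e'_def field_simps)
    also have "\<dots> < e" using e by simp
    finally show "dist ((f (\<lambda>i. x i + t * h i) - f x) / t) (inner_d d (grad x) h) < e"
      by (simp add: dist_real_def)
  qed
qed

lemma first_order: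
  assumes x: "x \<in> Rd d" and y: "y \<in> Rd d"
  shows "f x + inner_d d (grad x) (\<lambda>i. y i - x i) \<le> f y"
proof -
  have "inner_d d (grad x) (\<lambda>i. y i - x i) \<le> f y - f x"
  proof (rule tendsto_upperbound[OF directional_derivative[OF x Rd_diff[OF y x]]])
    show "eventually (\<lambda>t. (f (\<lambda>i. x i + t * (y i - x i)) - f x) / t \<le> f y - f x) (at_right 0)"
      unfolding eventually_at_right_field
    proof (intro exI[of _ 1] conjI allI impI)
      fix t :: real assume t: "0 < t" "t < 1"
      have "f (\<lambda>i. x i + t * (y i - x i)) = f (\<lambda>i. (1 - t) * x i + t * y i)"
        by (rule arg_cong[of _ _ f]) (simp add: fun_eq_iff algebra_simps)
      also have "\<dots> \<le> (1 - t) * f x + t * f y"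
        using conv x y t by (simp add: convex_d_def)
      finally show "(f (\<lambda>i. x i + t * (y i - x i)) - f x) / t \<le> f y - f x"
        using t by (simp add: field_simps)
    qed simp
  qed simp
  then show ?thesis by simp
qed

lemma grad_bound:
  assumes x: "x \<in> Rd d"
  shows "norm_d d (grad x) \<le> L"
proof -
  let ?g = "grad x"
  have "inner_d d ?g ?g \<le> L * norm_d d ?g"
  proof (rule tendsto_upperbound[OF directional_derivative[OF x grad_Rd[OF x]]])
    show "eventually (\<lambda>t. (f (\<lambda>i. x i + t * ?g i) - f x) / t \<le> L * norm_d d ?g) (at_right 0)"
      unfolding eventually_at_right_field
    proof (intro exI[of _ 1] conjI allI impI)
      fix t :: real assume t: "0 < t" "t < 1"
      have "\<bar>f (\<lambda>i. x i + t * ?g i) - f x\<bar> \<le> L * norm_d d (\<lambda>i. (x i + t * ?g i) - x i)"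
        by (intro f_lipschitz Rd_add Rd_scale x grad_Rd)
      also have "\<dots> = L * (t * norm_d d ?g)" using t by (simp add: norm_d_scale)
      finally show "(f (\<lambda>i. x i + t * ?g i) - f x) / t \<le> L * norm_d d ?g"
        using t by (simp add: field_simps)
    qed simp
  qed simp
  then have "norm_d d ?g * norm_d d ?g \<le> L * norm_d d ?g"
    by (simp add: norm_d_sq flip: power2_eq_square)
  then show ?thesis
    using L_pos norm_d_nonneg[of d ?g] by (metis less_eq_real_def mult_right_le_imp_le)
qed

lemma borel_measurable_f [measurable]: "(\<lambda>z. f (trunc_d d z)) \<in> borel_measurable borel"
  by (rule borel_measurable_continuous_onI[OF lipschitz_d_imp_continuous[OF lip]])

text \<open>No regularity of \<open>grad\<close> in the base point is assumed. Each component is a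
  pointwise limit of difference quotients of \<open>f\<close> with steps 1/(n+1), hence a limit of
  measurable functions; from \<open>d\<close> on it is constantly 0.\<close>

lemma borel_measurable_grad [measurable]: "(\<lambda>z. grad (trunc_d d z) k) \<in> borel_measurable borel"
proof (cases "k < d")
  case False
  then have "grad (trunc_d d z) k = 0" for z
    using grad_Rd[OF Rd_trunc, of z] by (simp add: Rd_def)
  then show ?thesis by simp
next
  case True
  define e where "e = (\<lambda>i. if i = k then 1 else (0::real))"
  have e: "e \<in> Rd d" using True by (auto simp: e_def Rd_def)
  define t where "t n = inverse (real (Suc n))" for n
  have t: "filterlim t (at_right 0) sequentially"
    unfolding t_def filterlim_at
    using LIMSEQ_inverse_real_of_nat by (auto intro!: always_eventually)
  have ie: "inner_d d g e = g k" for g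
    using True by (simp add: inner_d_def e_def if_distrib cong: if_cong)
  show ?thesis
  proof (rule borel_measurable_LIMSEQ_real)
    show "(\<lambda>n. (f (\<lambda>i. trunc_d d z i + t n * e i) - f (trunc_d d z)) / t n)
        \<longlonglongrightarrow> grad (trunc_d d z) k" for z
      using filterlim_compose[OF directional_derivative[OF Rd_trunc e] t, of z] by (simp add: ie)
    fix n
    have eq: "(\<lambda>i. trunc_d d z i + t n * e i) = trunc_d d (\<lambda>i. z i + t n * e i)" for z
      using e by (auto simp: trunc_d_def fun_eq_iff Rd_def)
    have "(\<lambda>z. (\<lambda>i. z i + t n * e i)) \<in> borel \<rightarrow>\<^sub>M borel"
      by (rule measurable_coordinatewise_then_product) simp
    then have [measurable]: "(\<lambda>z. f (trunc_d d (\<lambda>i. z i + t n * e i))) \<in> borel_measurable borel"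
      by (rule measurable_compose[OF _ borel_measurable_f])
    show "(\<lambda>z. (f (\<lambda>i. trunc_d d z i + t n * e i) - f (trunc_d d z)) / t n) \<in> borel_measurable borel"
      unfolding eq by measurable
  qed
qed

end

section \<open>Gaussian measures\<close>

definition std_normal :: "real measure" where
  "std_normal = density lborel (\<lambda>x. ennreal (std_normal_density x))"

text \<open>The product over \<open>{..<d}\<close> lives on functions that are
  \<open>undefined\<close> from \<open>d\<close> on. Hence shifts below are restricted to
  \<open>{..<d}\<close>, and sample points are truncated before \<open>f\<close> or
  \<open>grad\<close> sees them.\<close>

definition gauss :: "nat \<Rightarrow> vec measure" where
  "gauss d = PiM {..<d} (\<lambda>_. std_normal)"

text \<open>The Cameron-Martin density of the Gaussian centred at \<open>h\<close> with respect to
  the one centred at 0.\<close>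

definition weight :: "nat \<Rightarrow> vec \<Rightarrow> vec \<Rightarrow> real" where
  "weight d h z = exp (inner_d d h z - inner_d d h h / 2)"

lemma prob_space_std_normal: "prob_space std_normal"
  unfolding std_normal_def by (rule prob_space_normal_density) simp

lemma sets_std_normal [measurable_cong]: "sets std_normal = sets borel"
  by (simp add: std_normal_def)

lemma space_std_normal [simp]: "space std_normal = UNIV"
  by (simp add: std_normal_def)

lemma measurable_std_normal [simp]: "measurable std_normal M = measurable borel M"
  by (rule measurable_cong_sets[OF sets_std_normal refl])

lemma product_prob_space_std_normal: "product_prob_space (\<lambda>_::nat. std_normal)"
  by (rule product_prob_spaceI) (rule prob_space_std_normal)

lemma prob_space_gauss: "prob_space (gauss d)"
  unfolding gauss_def by (rule prob_space_PiM) (rule prob_space_std_normal)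

lemma sets_gauss [measurable_cong]: "sets (gauss d) = sets (PiM {..<d} (\<lambda>_. borel))"
  unfolding gauss_def by (rule sets_PiM_cong) (simp_all add: sets_std_normal)

lemma component_measurable_gauss: "i < d \<Longrightarrow> (\<lambda>z. z i) \<in> borel_measurable (gauss d)"
  unfolding measurable_cong_sets[OF sets_gauss refl] by (rule measurable_component_singleton) simp

lemma nn_integral_std_normal_shift:
  assumes [measurable]: "g \<in> borel_measurable borel"
  shows "(\<integral>\<^sup>+z. g (z + h) \<partial>std_normal) = (\<integral>\<^sup>+z. ennreal (exp (h * z - h\<^sup>2 / 2)) * g z \<partial>std_normal)"
proof -
  have "(\<integral>\<^sup>+z. g (z + h) \<partial>std_normal) = (\<integral>\<^sup>+z. ennreal (std_normal_density z) * g (z + h) \<partial>lborel)"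
    unfolding std_normal_def by (subst nn_integral_density) auto
  also have "\<dots> = (\<integral>\<^sup>+z. ennreal (std_normal_density (- h + 1 * z)) * g (- h + 1 * z + h) \<partial>lborel)"
    by (subst nn_integral_real_affine[of _ 1 "-h"]) auto
  also have "\<dots> = (\<integral>\<^sup>+z. ennreal (std_normal_density z) * (ennreal (exp (h * z - h\<^sup>2 / 2)) * g z) \<partial>lborel)"
  proof (rule nn_integral_cong)
    fix z :: real
    have "std_normal_density (- h + 1 * z) = std_normal_density z * exp (h * z - h\<^sup>2 / 2)"
      unfolding std_normal_density_def
      by (simp add: exp_add[symmetric] mult.assoc power2_eq_square algebra_simps add_divide_distrib diff_divide_distrib flip: exp_add)
    then show "ennreal (std_normal_density (- h + 1 * z)) * g (- h + 1 * z + h)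
        = ennreal (std_normal_density z) * (ennreal (exp (h * z - h\<^sup>2 / 2)) * g z)"
      by (simp add: ennreal_mult' mult.assoc)
  qed
  also have "\<dots> = (\<integral>\<^sup>+z. ennreal (exp (h * z - h\<^sup>2 / 2)) * g z \<partial>std_normal)"
    unfolding std_normal_def by (subst nn_integral_density) auto
  finally show ?thesis .
qed

lemma distr_std_normal_shift:
  "distr std_normal borel (\<lambda>z. z + h) = density std_normal (\<lambda>z. ennreal (exp (h * z - h\<^sup>2 / 2)))"
proof (rule measure_eqI)
  show "sets (distr std_normal borel (\<lambda>z. z + h))
      = sets (density std_normal (\<lambda>z. ennreal (exp (h * z - h\<^sup>2 / 2))))"
    by (simp add: sets_std_normal)
  fix A assume "A \<in> sets (distr std_normal borel (\<lambda>z. z + h))"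
  then have [measurable]: "A \<in> sets borel" by simp
  have "emeasure (distr std_normal borel (\<lambda>z. z + h)) A = (\<integral>\<^sup>+z. indicator A (z + h) \<partial>std_normal)"
    by (subst nn_integral_indicator[symmetric], simp)
       (subst nn_integral_distr, auto)
  also have "\<dots> = (\<integral>\<^sup>+z. ennreal (exp (h * z - h\<^sup>2 / 2)) * indicator A z \<partial>std_normal)"
    by (rule nn_integral_std_normal_shift) simp
  also have "\<dots> = emeasure (density std_normal (\<lambda>z. ennreal (exp (h * z - h\<^sup>2 / 2)))) A"
    by (subst emeasure_density) auto
  finally show "emeasure (distr std_normal borel (\<lambda>z. z + h)) A
      = emeasure (density std_normal (\<lambda>z. ennreal (exp (h * z - h\<^sup>2 / 2)))) A" .
qed

lemma weight_measurable [measurable]: "weight d h \<in> borel_measurable (gauss d)"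
  proof -
  note component_measurable_gauss [measurable]
  show ?thesis unfolding weight_def inner_d_def by measurable
qed

lemma weight_pos: "0 < weight d h z"
  by (simp add: weight_def)

lemma shift_measurable [measurable]:
  "(\<lambda>z. \<lambda>i\<in>{..<d}. z i + h i) \<in> gauss d \<rightarrow>\<^sub>M gauss d"
proof -
  have "(\<lambda>z. \<lambda>i\<in>{..<d}. z i + h i) \<in> gauss d \<rightarrow>\<^sub>M PiM {..<d} (\<lambda>_. borel)"
    by (rule measurable_restrict) (simp add: component_measurable_gauss)
  then show ?thesis
    unfolding measurable_cong_sets[OF refl sets_gauss] .
qed

text \<open>Both sides equal the product of the one-dimensional shifted laws: a product measure is
  determined by its values on boxes, and on boxes both sides factor into the one-dimensional
  case.\<close>

lemma distr_gauss_shift: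
  "distr (gauss d) (gauss d) (\<lambda>z. \<lambda>i\<in>{..<d}. z i + h i) = density (gauss d) (\<lambda>z. ennreal (weight d h z))"
proof -
  define N where "N i = density std_normal (\<lambda>z. ennreal (exp (h i * z - (h i)\<^sup>2 / 2)))" for i
  have setsN: "sets (N i) = sets borel" for i by (simp add: N_def sets_std_normal)
  have probN: "prob_space (N i)" for i
    unfolding N_def distr_std_normal_shift[symmetric]
    by (rule prob_space.prob_space_distr[OF prob_space_std_normal]) simp
  interpret N: product_prob_space N
    by (rule product_prob_spaceI) (rule probN)
  interpret S: product_prob_space "\<lambda>_::nat. std_normal"
    by (rule product_prob_space_std_normal)
  have sets_eq: "sets (gauss d) = sets (PiM {..<d} N)"
    unfolding sets_gauss by (rule sets_PiM_cong) (simp_all add: setsN)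
  have sp: "space (gauss d) = PiE {..<d} (\<lambda>_. UNIV)"
    by (simp add: gauss_def space_PiM)
  have "distr (gauss d) (gauss d) (\<lambda>z. \<lambda>i\<in>{..<d}. z i + h i) = PiM {..<d} N"
  proof (rule N.PiM_eqI)
    fix A assume A: "\<And>i. i \<in> {..<d} \<Longrightarrow> A i \<in> sets (N i)"
    then have A'[measurable]: "\<And>i. i \<in> {..<d} \<Longrightarrow> A i \<in> sets borel" by (simp add: setsN)
    have "PiE {..<d} A \<in> sets (gauss d)"
      unfolding sets_eq by (rule sets_PiM_I_finite) (use A in auto)
    then have "emeasure (distr (gauss d) (gauss d) (\<lambda>z. \<lambda>i\<in>{..<d}. z i + h i)) (PiE {..<d} A)
       = emeasure (gauss d) ((\<lambda>z. \<lambda>i\<in>{..<d}. z i + h i) -` PiE {..<d} A \<inter> space (gauss d))"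
      by (rule emeasure_distr[OF shift_measurable])
    also have "(\<lambda>z. \<lambda>i\<in>{..<d}. z i + h i) -` PiE {..<d} A \<inter> space (gauss d)
       = PiE {..<d} (\<lambda>i. (\<lambda>x. x + h i) -` A i)"
      by (auto simp: sp PiE_iff)
    also have "emeasure (gauss d) \<dots> = (\<Prod>i<d. emeasure std_normal ((\<lambda>x. x + h i) -` A i))"
    proof -
      have "(\<lambda>x. x + h i) -` A i \<in> sets borel" if "i \<in> {..<d}" for i
        using measurable_sets[of "\<lambda>x. x + h i" borel borel "A i"] A'[OF that] by simp
      then show ?thesis
        unfolding gauss_def by (intro S.emeasure_PiM) (auto simp: sets_std_normal)
    qed
    also have "\<dots> = (\<Prod>i<d. emeasure (N i) (A i))"
    proof (rule prod.cong)
      fix i assume "i \<in> {..<d}"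
      then show "emeasure std_normal ((\<lambda>x. x + h i) -` A i) = emeasure (N i) (A i)"
        unfolding N_def distr_std_normal_shift[symmetric]
        by (subst emeasure_distr) auto
    qed simp
    finally show "emeasure (distr (gauss d) (gauss d) (\<lambda>z. \<lambda>i\<in>{..<d}. z i + h i)) (PiE {..<d} A)
      = (\<Prod>i<d. emeasure (N i) (A i))" .
  qed (simp_all add: sets_eq)
  moreover have "density (gauss d) (\<lambda>z. ennreal (weight d h z)) = PiM {..<d} N"
  proof (rule N.PiM_eqI)
    fix A assume A: "\<And>i. i \<in> {..<d} \<Longrightarrow> A i \<in> sets (N i)"
    then have A'[measurable]: "\<And>i. i \<in> {..<d} \<Longrightarrow> A i \<in> sets borel" by (simp add: setsN)
    have "PiE {..<d} A \<in> sets (gauss d)"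
      unfolding sets_eq by (rule sets_PiM_I_finite) (use A in auto)
    then have "emeasure (density (gauss d) (\<lambda>z. ennreal (weight d h z))) (PiE {..<d} A)
       = (\<integral>\<^sup>+z. ennreal (weight d h z) * indicator (PiE {..<d} A) z \<partial>gauss d)"
      by (intro emeasure_density) auto
    also have "\<dots> = (\<integral>\<^sup>+z. (\<Prod>i<d. ennreal (exp (h i * z i - (h i)\<^sup>2 / 2)) * indicator (A i) (z i)) \<partial>gauss d)"
    proof (rule nn_integral_cong)
      fix z assume z: "z \<in> space (gauss d)"
      have "weight d h z = (\<Prod>i<d. exp (h i * z i - (h i)\<^sup>2 / 2))"
        unfolding weight_def inner_d_def
        by (simp add: exp_sum[symmetric] sum_subtractf sum_divide_distrib power2_eq_square)
      moreover have "(indicator (PiE {..<d} A) z :: ennreal) = (\<Prod>i<d. indicator (A i) (z i))"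
      proof (cases "z \<in> PiE {..<d} A")
        case True then show ?thesis by (auto simp: PiE_iff)
      next
        case False
        then obtain i where "i < d" "z i \<notin> A i" using z by (auto simp: sp PiE_iff)
        then have "(\<Prod>i<d. indicator (A i) (z i) :: ennreal) = 0"
          by (intro prod_zero) (auto intro!: bexI[of _ i])
        with False show ?thesis by simp
      qed
      ultimately show "ennreal (weight d h z) * indicator (PiE {..<d} A) z
         = (\<Prod>i<d. ennreal (exp (h i * z i - (h i)\<^sup>2 / 2)) * indicator (A i) (z i))"
        by (simp add: prod.distrib prod_ennreal)
    qed
    also have "\<dots> = (\<Prod>i<d. \<integral>\<^sup>+x. ennreal (exp (h i * x - (h i)\<^sup>2 / 2)) * indicator (A i) x \<partial>std_normal)"
      unfolding gauss_def
    proof (rule S.product_nn_integral_prod)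
      fix i assume "i \<in> {..<d}"
      then have [measurable]: "A i \<in> sets borel" by (rule A')
      show "(\<lambda>x. ennreal (exp (h i * x - (h i)\<^sup>2 / 2)) * indicator (A i) x) \<in> borel_measurable std_normal"
        by simp
    qed simp
    also have "\<dots> = (\<Prod>i<d. emeasure (N i) (A i))"
    proof (rule prod.cong)
      fix i assume "i \<in> {..<d}"
      then have [measurable]: "A i \<in> sets borel" by (rule A')
      show "(\<integral>\<^sup>+x. ennreal (exp (h i * x - (h i)\<^sup>2 / 2)) * indicator (A i) x \<partial>std_normal) = emeasure (N i) (A i)"
        unfolding N_def by (subst emeasure_density) auto
    qed simp
    finally show "emeasure (density (gauss d) (\<lambda>z. ennreal (weight d h z))) (PiE {..<d} A)
      = (\<Prod>i<d. emeasure (N i) (A i))" .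
  qed (simp_all add: sets_eq)
  ultimately show ?thesis by simp
qed

lemma integral_gauss_shift:
  fixes g :: "vec \<Rightarrow> real"
  assumes [measurable]: "g \<in> borel_measurable (gauss d)"
  shows "(\<integral>z. g (\<lambda>i\<in>{..<d}. z i + h i) \<partial>gauss d) = (\<integral>z. weight d h z * g z \<partial>gauss d)"
proof -
  have "(\<integral>z. g (\<lambda>i\<in>{..<d}. z i + h i) \<partial>gauss d)
     = (\<integral>z. g z \<partial>distr (gauss d) (gauss d) (\<lambda>z. \<lambda>i\<in>{..<d}. z i + h i))"
    by (rule integral_distr[symmetric]) measurable
  also have "\<dots> = (\<integral>z. weight d h z * g z \<partial>gauss d)"
    unfolding distr_gauss_shift by (subst integral_real_density) (auto simp: weight_pos less_imp_le)
  finally show ?thesis .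
qed

lemma integrable_weight: "integrable (gauss d) (weight d h)"
  and integral_weight: "(\<integral>z. weight d h z \<partial>gauss d) = 1"
proof -
  interpret prob_space "density (gauss d) (\<lambda>z. ennreal (weight d h z))"
    unfolding distr_gauss_shift[symmetric]
    by (rule prob_space.prob_space_distr[OF prob_space_gauss]) measurable
  have "integrable (density (gauss d) (\<lambda>z. ennreal (weight d h z))) (\<lambda>_. 1::real)" by simp
  then show "integrable (gauss d) (weight d h)"
    by (subst (asm) integrable_real_density) (auto simp: weight_pos less_imp_le)
  show "(\<integral>z. weight d h z \<partial>gauss d) = 1"
    using integral_gauss_shift[of "\<lambda>_. 1" d h] prob_space.prob_space[OF prob_space_gauss[of d]] by simp
qed

text \<open>Squaring a weight gives the weight for the doubled shift up to a constant, so the second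
  moment is exp(|h|^2). Importance sampling thus has bounded variance exactly as long as |h| stays
  bounded, which fixes the radius \<sigma> of validity around a centre.\<close>

lemma weight_sq: "(weight d h z)\<^sup>2 = exp (inner_d d h h) * weight d (\<lambda>i. 2 * h i) z"
  by (simp add: weight_def inner_d_linear power2_eq_square flip: exp_add)

lemma integrable_weight_sq: "integrable (gauss d) (\<lambda>z. (weight d h z)\<^sup>2)"
  and integral_weight_sq: "(\<integral>z. (weight d h z)\<^sup>2 \<partial>gauss d) = exp (inner_d d h h)"
  unfolding weight_sq by (simp_all add: integrable_weight integral_weight)

text \<open>The L1 distance between a Gaussian and its shift. The second moment of
  \<open>weight d h z - 1\<close> is exp(t^2) - 1, at most 2 t^2 for t = |h|; the pointwise bound
  |u| \<le> t + u^2/(2t), integrated, plays the role of Cauchy-Schwarz.\<close>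

lemma integral_abs_weight_minus_1:
  assumes "norm_d d h \<le> 1"
  shows "(\<integral>z. \<bar>weight d h z - 1\<bar> \<partial>gauss d) \<le> 2 * norm_d d h"
proof (cases "norm_d d h = 0")
  case True
  then have "weight d h z = 1" for z
    by (simp add: weight_def inner_d_def norm_d_eq_0D)
  then show ?thesis by simp
next
  case False
  interpret prob_space "gauss d" by (rule prob_space_gauss)
  define t where "t = norm_d d h"
  have t: "0 < t" "t \<le> 1" using False assms norm_d_nonneg[of d h] by (auto simp: t_def less_le)
  have sq: "(weight d h z - 1)\<^sup>2 = (weight d h z)\<^sup>2 - 2 * weight d h z + 1" for z
    by (simp add: power2_eq_square algebra_simps)
  have int: "integrable (gauss d) (\<lambda>z. (weight d h z - 1)\<^sup>2)"
    unfolding sq by (intro Bochner_Integration.integrable_add Bochner_Integration.integrable_diff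
      integrable_mult_right integrable_weight integrable_weight_sq) simp
  have "(\<integral>z. (weight d h z - 1)\<^sup>2 \<partial>gauss d) = exp (t\<^sup>2) - 1"
    unfolding sq using integrable_weight integrable_weight_sq
    by (simp add: integral_weight integral_weight_sq prob_space t_def norm_d_sq)
  also have "\<dots> \<le> t\<^sup>2 + (t\<^sup>2)\<^sup>2"
    using exp_bound[of "t\<^sup>2"] t by (simp add: power_le_one)
  also have "\<dots> \<le> 2 * t\<^sup>2"
    using t power_le_one[of t 2] mult_left_mono[of "t\<^sup>2" 1 "t\<^sup>2"] by (simp add: power2_eq_square)
  finally have var: "(\<integral>z. (weight d h z - 1)\<^sup>2 \<partial>gauss d) \<le> 2 * t\<^sup>2" .
  have amgm: "\<bar>u\<bar> \<le> t + u\<^sup>2 / (2 * t)" for u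
  proof -
    have "0 \<le> (\<bar>u\<bar> - t)\<^sup>2" by simp
    then have "\<bar>u\<bar> * (2 * t) \<le> u\<^sup>2 + t\<^sup>2" by (simp add: power2_eq_square algebra_simps)
    then have "\<bar>u\<bar> \<le> (u\<^sup>2 + t\<^sup>2) / (2 * t)" using t by (simp add: field_simps)
    also have "\<dots> \<le> t + u\<^sup>2 / (2 * t)" using t by (simp add: field_simps power2_eq_square)
    finally show ?thesis .
  qed
  have "(\<integral>z. \<bar>weight d h z - 1\<bar> \<partial>gauss d) \<le> (\<integral>z. t + (weight d h z - 1)\<^sup>2 / (2 * t) \<partial>gauss d)"
    by (rule integral_mono) (use int integrable_weight amgm in auto)
  also have "\<dots> = t + (\<integral>z. (weight d h z - 1)\<^sup>2 \<partial>gauss d) / (2 * t)"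
    using int by (simp add: prob_space)
  also have "\<dots> \<le> t + (2 * t\<^sup>2) / (2 * t)"
    using var t by (intro add_left_mono divide_right_mono) auto
  also have "\<dots> = 2 * t" using t by (simp add: power2_eq_square)
  finally show ?thesis by (simp add: t_def)
qed

lemma integrable_std_normal_sq: "integrable std_normal (\<lambda>x. x\<^sup>2)"
  and integral_std_normal_sq: "(\<integral>x. x\<^sup>2 \<partial>std_normal) = 1"
proof -
  show "integrable std_normal (\<lambda>x. x\<^sup>2)"
    unfolding std_normal_def
    by (subst integrable_real_density) (use integrable_std_normal_moment[of 2] in auto)
  show "(\<integral>x. x\<^sup>2 \<partial>std_normal) = 1"
    unfolding std_normal_def
    by (subst integral_real_density) (use integral_std_normal_moment_even[of 1] in \<open>auto simp: fact_numeral\<close>)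
qed

lemma distr_gauss_component: "i < d \<Longrightarrow> distr (gauss d) std_normal (\<lambda>z. z i) = std_normal"
  unfolding gauss_def
  by (rule distr_PiM_component) (auto intro: prob_space_std_normal)

lemma integrable_norm_gauss_sq: "integrable (gauss d) (\<lambda>z. (norm_d d z)\<^sup>2)"
  and integral_norm_gauss_sq: "(\<integral>z. (norm_d d z)\<^sup>2 \<partial>gauss d) = real d"
proof -
  have 1: "integrable (gauss d) (\<lambda>z. (z i)\<^sup>2)" "(\<integral>z. (z i)\<^sup>2 \<partial>gauss d) = 1" if "i < d" for i
  proof -
    have [measurable]: "(\<lambda>z. z i) \<in> gauss d \<rightarrow>\<^sub>M std_normal"
      using that unfolding measurable_cong_sets[OF refl sets_std_normal] by (rule component_measurable_gauss)
    have sqm: "(\<lambda>x. x\<^sup>2) \<in> borel_measurable std_normal" by simp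
    show "integrable (gauss d) (\<lambda>z. (z i)\<^sup>2)"
      using integrable_distr[of "\<lambda>z. z i" "gauss d" std_normal "\<lambda>x. x\<^sup>2"] integrable_std_normal_sq that
      by (simp add: distr_gauss_component)
    show "(\<integral>z. (z i)\<^sup>2 \<partial>gauss d) = 1"
      using integral_distr[of "\<lambda>z. z i" "gauss d" std_normal "\<lambda>x. x\<^sup>2"] that sqm
      by (simp add: distr_gauss_component integral_std_normal_sq)
  qed
  have eq: "(norm_d d z)\<^sup>2 = (\<Sum>i<d. (z i)\<^sup>2)" for z
    unfolding norm_d_sq by (simp add: inner_d_def power2_eq_square)
  show "integrable (gauss d) (\<lambda>z. (norm_d d z)\<^sup>2)"
    unfolding eq using 1 by (intro Bochner_Integration.integrable_sum) simp
  show "(\<integral>z. (norm_d d z)\<^sup>2 \<partial>gauss d) = real d"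
    unfolding eq using 1 by (simp add: Bochner_Integration.integral_sum)
qed

lemma norm_d_measurable [measurable]: "norm_d d \<in> borel_measurable (gauss d)"
  proof -
  note component_measurable_gauss [measurable]
  show ?thesis unfolding norm_d_def inner_d_def by measurable
qed

lemma integrable_norm_gauss: "integrable (gauss d) (norm_d d)"
  and integral_norm_gauss: "(\<integral>z. norm_d d z \<partial>gauss d) \<le> sqrt (real d)"
proof -
  interpret prob_space "gauss d" by (rule prob_space_gauss)
  show int: "integrable (gauss d) (norm_d d)"
    by (rule square_integrable_imp_integrable) (use integrable_norm_gauss_sq in auto)
  have "(\<integral>z. norm_d d z \<partial>gauss d)\<^sup>2 \<le> real d"
    using variance_positive[of "norm_d d"] variance_eq[OF int integrable_norm_gauss_sq]
    by (simp add: integral_norm_gauss_sq)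
  then show "(\<integral>z. norm_d d z \<partial>gauss d) \<le> sqrt (real d)"
    by (rule real_le_rsqrt)
qed

section \<open>Gaussian smoothing\<close>

locale smoothed_problem = convex_problem +
  fixes \<sigma> :: real
  assumes \<sigma>_pos: "0 < \<sigma>"
begin

definition pt :: "vec \<Rightarrow> vec \<Rightarrow> vec" where
  "pt x z = trunc_d d (\<lambda>i. x i + \<sigma> * z i)"

definition F :: "vec \<Rightarrow> real" where
  "F x = (\<integral>z. f (pt x z) \<partial>gauss d)"

text \<open>Plays the part of the gradient of \<open>F\<close>: it is a subgradient by
  \<open>smoothed_first_order\<close> and locally Lipschitz by \<open>G_lipschitz\<close>.\<close>

definition G :: "vec \<Rightarrow> vec" where
  "G x = (\<lambda>k. \<integral>z. grad (pt x z) k \<partial>gauss d)"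

lemma pt_Rd [simp]: "pt x z \<in> Rd d"
  by (simp add: pt_def)

lemma affine_measurable: "(\<lambda>z. trunc_d d (\<lambda>i. x i + \<sigma> * z i)) \<in> gauss d \<rightarrow>\<^sub>M borel"
proof (rule measurable_coordinatewise_then_product)
  fix i
  show "(\<lambda>z. trunc_d d (\<lambda>i. x i + \<sigma> * z i) i) \<in> borel_measurable (gauss d)"
    using component_measurable_gauss[of i d, measurable] by (cases "i < d") (simp_all add: trunc_d_def)
qed

lemma trunc_d_idem [simp]: "trunc_d d (trunc_d d x) = trunc_d d x"
  by (simp add: trunc_d_id)

lemma f_pt_measurable [measurable]: "(\<lambda>z. f (pt x z)) \<in> borel_measurable (gauss d)"
  using measurable_compose[OF affine_measurable borel_measurable_f, of x] by (simp add: pt_def)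

lemma grad_pt_measurable [measurable]: "(\<lambda>z. grad (pt x z) k) \<in> borel_measurable (gauss d)"
  using measurable_compose[OF affine_measurable borel_measurable_grad, of x k] by (simp add: pt_def)

lemma pt_diff: "norm_d d (\<lambda>i. pt x z i - x i) = \<sigma> * norm_d d z"
proof -
  have "norm_d d (\<lambda>i. pt x z i - x i) = norm_d d (\<lambda>i. \<sigma> * z i)"
    by (rule norm_d_cong) (simp add: pt_def trunc_d_def)
  then show ?thesis using \<sigma>_pos by (simp add: norm_d_scale)
qed

lemma pt_diff2: "norm_d d (\<lambda>i. pt x z i - pt y z i) = norm_d d (\<lambda>i. x i - y i)"
  by (rule norm_d_cong) (simp add: pt_def trunc_d_def)

lemma inner_pt_diff: "inner_d d g (\<lambda>i. pt x z i - pt y z i) = inner_d d g (\<lambda>i. x i - y i)"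
  by (rule inner_d_cong) (simp_all add: pt_def trunc_d_def)

lemma integrable_f_pt:
  assumes x: "x \<in> Rd d"
  shows "integrable (gauss d) (\<lambda>z. f (pt x z))"
proof (rule Bochner_Integration.integrable_bound)
  interpret prob_space "gauss d" by (rule prob_space_gauss)
  show "integrable (gauss d) (\<lambda>z. \<bar>f x\<bar> + L * (\<sigma> * norm_d d z))"
    by (intro Bochner_Integration.integrable_add integrable_mult_right integrable_norm_gauss) simp
  have "norm (f (pt x z)) \<le> norm (\<bar>f x\<bar> + L * (\<sigma> * norm_d d z))" for z
    using f_lipschitz[OF pt_Rd x, of x z] unfolding pt_diff by simp
  then show "AE z in gauss d. norm (f (pt x z)) \<le> norm (\<bar>f x\<bar> + L * (\<sigma> * norm_d d z))" by simp
qed simp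

lemma grad_component_bound: "\<bar>grad (pt x z) k\<bar> \<le> L"
proof (cases "k < d")
  case True
  then show ?thesis using component_le_norm_d[OF True, of "grad (pt x z)"] grad_bound[OF pt_Rd, of x z] by linarith
next
  case False
  then show ?thesis using grad_Rd[OF pt_Rd, of x z] L_pos by (simp add: Rd_def)
qed

lemma integrable_grad_pt: "integrable (gauss d) (\<lambda>z. grad (pt x z) k)"
proof -
  interpret prob_space "gauss d" by (rule prob_space_gauss)
  show ?thesis by (rule integrable_const_bound[of _ L]) (auto simp: grad_component_bound)
qed

lemma integrable_weight_grad: "integrable (gauss d) (\<lambda>z. weight d h z * grad (pt x z) k)"
proof (rule Bochner_Integration.integrable_bound)
  show "integrable (gauss d) (\<lambda>z. L * weight d h z)" by (intro integrable_mult_right integrable_weight)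
  have "norm (weight d h z * grad (pt x z) k) \<le> norm (L * weight d h z)" for z
    using mult_left_mono[OF grad_component_bound[of x z k] less_imp_le[OF weight_pos[of d h z]]] L_pos
      weight_pos[of d h z] by (simp add: abs_mult mult.commute)
  then show "AE z in gauss d. norm (weight d h z * grad (pt x z) k) \<le> norm (L * weight d h z)" by simp
qed simp

lemma inner_G: "inner_d d u (G x) = (\<integral>z. inner_d d u (grad (pt x z)) \<partial>gauss d)"
  unfolding inner_d_def G_def
  by (subst Bochner_Integration.integral_sum) (auto intro!: integrable_mult_right integrable_grad_pt)

lemma integrable_inner_grad: "integrable (gauss d) (\<lambda>z. inner_d d u (grad (pt x z)))"
  unfolding inner_d_def by (intro Bochner_Integration.integrable_sum integrable_mult_right integrable_grad_pt)

lemma G_Rd: "G x \<in> Rd d"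
  using grad_Rd[OF pt_Rd] by (simp add: Rd_def G_def)

text \<open>Jensen by duality: the inner product of the mean with itself is an integral of scalar
  products, each bounded by \<open>L\<close> times the norm of the mean.\<close>

lemma G_bound: "norm_d d (G x) \<le> L"
proof -
  interpret prob_space "gauss d" by (rule prob_space_gauss)
  have "inner_d d (G x) (G x) \<le> (\<integral>z. L * norm_d d (G x) \<partial>gauss d)"
    unfolding inner_G[of "G x" x]
  proof (rule integral_mono)
    fix z
    have "inner_d d (G x) (grad (pt x z)) \<le> norm_d d (G x) * norm_d d (grad (pt x z))" by (rule inner_d_le)
    also have "\<dots> \<le> norm_d d (G x) * L" by (intro mult_left_mono grad_bound) simp_all
    finally show "inner_d d (G x) (grad (pt x z)) \<le> L * norm_d d (G x)" by (simp add: mult.commute)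
  qed (simp_all add: integrable_inner_grad)
  then have "norm_d d (G x) * norm_d d (G x) \<le> L * norm_d d (G x)"
    by (simp add: prob_space norm_d_sq flip: power2_eq_square)
  then show ?thesis
    using L_pos norm_d_nonneg[of d "G x"] by (metis less_eq_real_def mult_right_le_imp_le)
qed

lemma smoothed_first_order:
  assumes x: "x \<in> Rd d" and y: "y \<in> Rd d"
  shows "F x + inner_d d (G x) (\<lambda>i. y i - x i) \<le> F y"
proof -
  have "F x + inner_d d (G x) (\<lambda>i. y i - x i)
     = (\<integral>z. f (pt x z) + inner_d d (\<lambda>i. y i - x i) (grad (pt x z)) \<partial>gauss d)"
    using integrable_f_pt[OF x] integrable_inner_grad
    by (simp add: F_def inner_d_commute[of d "G x"] inner_G)
  also have "\<dots> \<le> F y"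
    unfolding F_def
  proof (rule integral_mono)
    fix z
    show "f (pt x z) + inner_d d (\<lambda>i. y i - x i) (grad (pt x z)) \<le> f (pt y z)"
      using first_order[OF pt_Rd pt_Rd, of x z y z]
      by (simp add: inner_pt_diff inner_d_commute[of d "\<lambda>i. y i - x i"])
  qed (use integrable_f_pt[OF x] integrable_f_pt[OF y] integrable_inner_grad in auto)
  finally show ?thesis .
qed

lemma F_close:
  assumes x: "x \<in> Rd d"
  shows "\<bar>F x - f x\<bar> \<le> L * \<sigma> * sqrt (real d)"
proof -
  interpret prob_space "gauss d" by (rule prob_space_gauss)
  have "F x - f x = (\<integral>z. f (pt x z) - f x \<partial>gauss d)"
    using integrable_f_pt[OF x] by (simp add: F_def prob_space)
  then have "\<bar>F x - f x\<bar> \<le> (\<integral>z. \<bar>f (pt x z) - f x\<bar> \<partial>gauss d)"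
    by simp
  also have "\<dots> \<le> (\<integral>z. L * \<sigma> * norm_d d z \<partial>gauss d)"
  proof (rule integral_mono)
    show "\<bar>f (pt x z) - f x\<bar> \<le> L * \<sigma> * norm_d d z" for z
      using f_lipschitz[OF pt_Rd x, of x z] unfolding pt_diff by (simp add: mult.assoc)
  qed (use integrable_f_pt[OF x] integrable_norm_gauss in auto)
  also have "\<dots> \<le> L * \<sigma> * sqrt (real d)"
    using integral_norm_gauss[of d] L_pos \<sigma>_pos by simp
  finally show ?thesis .
qed

lemma F_lipschitz:
  assumes x: "x \<in> Rd d" and y: "y \<in> Rd d"
  shows "\<bar>F x - F y\<bar> \<le> L * norm_d d (\<lambda>i. x i - y i)"
proof -
  interpret prob_space "gauss d" by (rule prob_space_gauss)
  have "F x - F y = (\<integral>z. f (pt x z) - f (pt y z) \<partial>gauss d)"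
    using integrable_f_pt[OF x] integrable_f_pt[OF y] by (simp add: F_def)
  then have "\<bar>F x - F y\<bar> \<le> (\<integral>z. \<bar>f (pt x z) - f (pt y z)\<bar> \<partial>gauss d)" by simp
  also have "\<dots> \<le> (\<integral>z. L * norm_d d (\<lambda>i. x i - y i) \<partial>gauss d)"
  proof (rule integral_mono)
    show "\<bar>f (pt x z) - f (pt y z)\<bar> \<le> L * norm_d d (\<lambda>i. x i - y i)" for z
      using f_lipschitz[OF pt_Rd pt_Rd, of x z y z] unfolding pt_diff2 .
  qed (use integrable_f_pt[OF x] integrable_f_pt[OF y] in auto)
  finally show ?thesis by (simp add: prob_space)
qed

lemma G_shift:
  "G (\<lambda>i. x i + \<sigma> * h i) k = (\<integral>z. weight d h z * grad (pt x z) k \<partial>gauss d)"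
proof -
  have "pt (\<lambda>i. x i + \<sigma> * h i) z = pt x (\<lambda>i\<in>{..<d}. z i + h i)" for z
    by (simp add: pt_def trunc_d_def fun_eq_iff algebra_simps)
  then show ?thesis
    unfolding G_def using integral_gauss_shift[OF grad_pt_measurable[of x k], of h] by simp
qed

text \<open>By reweighting, the difference \<open>D\<close> is the integral of
  \<open>(weight - 1)\<close> times the gradient. Testing against \<open>D\<close> itself leaves
  only the L1 distance of two Gaussians, so the constant does not depend on the dimension.\<close>

lemma G_lipschitz_scaled:
  assumes h: "norm_d d h \<le> 1"
  shows "norm_d d (\<lambda>k. G (\<lambda>i. x i + \<sigma> * h i) k - G x k) \<le> 2 * L * norm_d d h"
proof -
  define D where "D = (\<lambda>k. G (\<lambda>i. x i + \<sigma> * h i) k - G x k)"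
  have Dk: "D k = (\<integral>z. (weight d h z - 1) * grad (pt x z) k \<partial>gauss d)" for k
    unfolding D_def G_shift using integrable_weight_grad integrable_grad_pt
    by (simp add: G_def left_diff_distrib)
  have int: "integrable (gauss d) (\<lambda>z. (weight d h z - 1) * grad (pt x z) k)" for k
    using integrable_weight_grad integrable_grad_pt by (simp add: left_diff_distrib)
  have "inner_d d D D = (\<integral>z. (weight d h z - 1) * inner_d d D (grad (pt x z)) \<partial>gauss d)"
  proof -
    have "(\<integral>z. (weight d h z - 1) * inner_d d D (grad (pt x z)) \<partial>gauss d)
       = (\<integral>z. (\<Sum>k<d. D k * ((weight d h z - 1) * grad (pt x z) k)) \<partial>gauss d)"
      by (simp add: inner_d_def sum_distrib_left mult.left_commute)
    also have "\<dots> = (\<Sum>k<d. D k * D k)"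
      unfolding Dk by (subst Bochner_Integration.integral_sum) (auto intro!: integrable_mult_right int)
    finally show ?thesis by (simp add: inner_d_def)
  qed
  also have "\<dots> \<le> (\<integral>z. (norm_d d D * L) * \<bar>weight d h z - 1\<bar> \<partial>gauss d)"
  proof (rule integral_mono)
    have "integrable (gauss d) (\<lambda>z. \<Sum>k<d. D k * ((weight d h z - 1) * grad (pt x z) k))"
      by (intro Bochner_Integration.integrable_sum integrable_mult_right int)
    then show "integrable (gauss d) (\<lambda>z. (weight d h z - 1) * inner_d d D (grad (pt x z)))"
      by (simp add: inner_d_def sum_distrib_left mult.left_commute)
    interpret prob_space "gauss d" by (rule prob_space_gauss)
    show "integrable (gauss d) (\<lambda>z. (norm_d d D * L) * \<bar>weight d h z - 1\<bar>)"
      using integrable_weight by (intro integrable_mult_right integrable_abs Bochner_Integration.integrable_diff) auto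
    fix z
    have "(weight d h z - 1) * inner_d d D (grad (pt x z)) \<le> \<bar>weight d h z - 1\<bar> * \<bar>inner_d d D (grad (pt x z))\<bar>"
      by (simp flip: abs_mult)
    also have "\<dots> \<le> \<bar>weight d h z - 1\<bar> * (norm_d d D * norm_d d (grad (pt x z)))"
      by (intro mult_left_mono abs_inner_d_le) simp
    also have "\<dots> \<le> \<bar>weight d h z - 1\<bar> * (norm_d d D * L)"
      by (intro mult_left_mono grad_bound) simp_all
    finally show "(weight d h z - 1) * inner_d d D (grad (pt x z)) \<le> (norm_d d D * L) * \<bar>weight d h z - 1\<bar>"
      by (simp add: mult.commute)
  qed
  also have "\<dots> = norm_d d D * L * (\<integral>z. \<bar>weight d h z - 1\<bar> \<partial>gauss d)" by simp
  also have "\<dots> \<le> norm_d d D * L * (2 * norm_d d h)"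
    using integral_abs_weight_minus_1[OF h] L_pos by (intro mult_left_mono) auto
  finally have "norm_d d D * norm_d d D \<le> (2 * L * norm_d d h) * norm_d d D"
    by (simp add: norm_d_sq algebra_simps flip: power2_eq_square)
  then show ?thesis
    unfolding D_def[symmetric]
    using L_pos norm_d_nonneg[of d D] norm_d_nonneg[of d h]
    by (metis less_eq_real_def mult_right_le_imp_le mult_nonneg_nonneg zero_le_numeral)
qed

lemma G_lipschitz:
  assumes "norm_d d (\<lambda>i. y i - x i) \<le> \<sigma>"
  shows "norm_d d (\<lambda>k. G y k - G x k) \<le> 2 * L / \<sigma> * norm_d d (\<lambda>i. y i - x i)"
proof -
  define h where "h = (\<lambda>i. 1 / \<sigma> * (y i - x i))"
  have nh: "norm_d d h = norm_d d (\<lambda>i. y i - x i) / \<sigma>"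
    unfolding h_def norm_d_scale using \<sigma>_pos by simp
  have "(\<lambda>i. x i + \<sigma> * h i) = y" using \<sigma>_pos by (auto simp: h_def)
  then show ?thesis
    using G_lipschitz_scaled[of h x] assms \<sigma>_pos by (simp add: nh)
qed

end

section \<open>Minimization over small balls\<close>

text \<open>A box with the factor {0} in every coordinate from \<open>d\<close> on is compact by
  Tychonoff, and the ball is a closed subset of such a box.\<close>

lemma compact_ball_d: "compact {x \<in> Rd d. norm_d d (\<lambda>i. x i - y i) \<le> r}"
proof -
  let ?S = "\<lambda>i. if i < d then {y i - r..y i + r} else {0::real}"
  have "compactin (product_topology (\<lambda>_::nat. euclidean :: real topology) UNIV) (PiE UNIV ?S)"
    by (subst compactin_PiE) (simp add: compactin_euclidean_iff)
  then have K: "compact (PiE UNIV ?S)"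
    by (simp add: euclidean_product_topology compactin_euclidean_iff)
  have "closed {x \<in> Rd d. norm_d d (\<lambda>i. x i - y i) \<le> r}"
  proof -
    have "{x \<in> Rd d. norm_d d (\<lambda>i. x i - y i) \<le> r}
        = (\<Inter>i\<in>{d..}. {x. x i = 0}) \<inter> {x. norm_d d (\<lambda>i. x i - y i) \<le> r}"
      by (auto simp: Rd_def)
    also have "closed \<dots>"
    proof (intro closed_Int closed_INT ballI closed_Collect_le closed_Collect_eq)
      show "continuous_on UNIV (\<lambda>x::vec. norm_d d (\<lambda>i. x i - y i))"
        unfolding norm_d_def inner_d_def by (intro continuous_intros continuous_on_product_coordinates)
    qed (intro continuous_intros continuous_on_product_coordinates)+
    finally show ?thesis .
  qed
  moreover have "{x \<in> Rd d. norm_d d (\<lambda>i. x i - y i) \<le> r} \<subseteq> PiE UNIV ?S"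
  proof
    fix x assume x: "x \<in> {x \<in> Rd d. norm_d d (\<lambda>i. x i - y i) \<le> r}"
    have "\<bar>x i - y i\<bar> \<le> r" if "i < d" for i
      using component_le_norm_d[OF that, of "\<lambda>i. x i - y i"] x by simp
    then have "x i \<in> ?S i" for i
      using x by (cases "i < d") (auto simp: Rd_def abs_le_iff algebra_simps)
    then show "x \<in> PiE UNIV ?S" by (intro PiE_I) auto
  qed
  ultimately show ?thesis
    using compact_Int_closed[OF K, of "{x \<in> Rd d. norm_d d (\<lambda>i. x i - y i) \<le> r}"]
    by (simp only: inf_absorb2)
qed

context smoothed_problem
begin

lemma F_trunc: "F (trunc_d d x) = F x"
proof -
  have "pt (trunc_d d x) = pt x" by (simp add: pt_def trunc_d_def fun_eq_iff)
  then show ?thesis by (simp add: F_def)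
qed

lemma exists_ball_minimizer:
  assumes y: "y \<in> Rd d" and r: "0 \<le> r"
  obtains x where "x \<in> Rd d" "norm_d d (\<lambda>i. x i - y i) \<le> r"
    "\<And>u. u \<in> Rd d \<Longrightarrow> norm_d d (\<lambda>i. u i - y i) \<le> r \<Longrightarrow> F x \<le> F u"
proof -
  let ?K = "{x \<in> Rd d. norm_d d (\<lambda>i. x i - y i) \<le> r}"
  have "continuous_on UNIV F"
    using lipschitz_d_imp_continuous[of d L F] F_lipschitz by (simp add: F_trunc lipschitz_d_def)
  then have "continuous_on ?K F" by (rule continuous_on_subset) simp
  moreover have "y \<in> ?K" using y r by simp
  ultimately obtain x where "x \<in> ?K" "\<forall>u\<in>?K. F x \<le> F u"
    using continuous_attains_inf[OF compact_ball_d] by blast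
  then show ?thesis by (intro that) auto
qed

text \<open>The subgradient inequality is applied at an intermediate point \<open>ut\<close> of the
  segment, not at \<open>x\<close>: minimality of \<open>x\<close> then makes \<open>G ut\<close>
  nonnegative in the direction of \<open>u\<close>. Local Lipschitz continuity of \<open>G\<close>
  carries this to the limit t \<rightarrow> 0.\<close>

lemma variational_inequality:
  assumes x: "x \<in> Rd d" "norm_d d (\<lambda>i. x i - y i) \<le> r"
    and min: "\<And>u. u \<in> Rd d \<Longrightarrow> norm_d d (\<lambda>i. u i - y i) \<le> r \<Longrightarrow> F x \<le> F u"
    and u: "u \<in> Rd d" "norm_d d (\<lambda>i. u i - y i) \<le> r"
  shows "0 \<le> inner_d d (G x) (\<lambda>i. u i - x i)"
proof -
  let ?w = "\<lambda>i. u i - x i"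
  let ?n = "norm_d d ?w"
  have ev: "eventually (\<lambda>t. 0 \<le> inner_d d (G x) ?w + (2 * L / \<sigma> * ?n * ?n) * t) (at_right 0)"
    unfolding eventually_at_right_field
  proof (intro exI[of _ "min 1 (\<sigma> / (1 + ?n))"] conjI allI impI)
    have n1: "0 < 1 + ?n" using norm_d_nonneg[of d ?w] by linarith
    then show "0 < min 1 (\<sigma> / (1 + ?n))" using \<sigma>_pos by simp
    fix t :: real assume t: "0 < t" "t < min 1 (\<sigma> / (1 + ?n))"
    define ut where "ut = (\<lambda>i. x i + t * (u i - x i))"
    have utR: "ut \<in> Rd d" unfolding ut_def by (intro Rd_add Rd_scale Rd_diff x u)
    have "norm_d d (\<lambda>i. ut i - y i) = norm_d d (\<lambda>i. (1 - t) * (x i - y i) + t * (u i - y i))"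
      by (rule norm_d_cong) (simp add: ut_def algebra_simps)
    also have "\<dots> \<le> (1 - t) * norm_d d (\<lambda>i. x i - y i) + t * norm_d d (\<lambda>i. u i - y i)"
      using norm_d_triangle[of d "\<lambda>i. (1 - t) * (x i - y i)" "\<lambda>i. t * (u i - y i)"] t
      by (simp add: norm_d_scale)
    also have "\<dots> \<le> (1 - t) * r + t * r"
      using t x u by (intro add_mono mult_left_mono) auto
    finally have "norm_d d (\<lambda>i. ut i - y i) \<le> r" by (simp add: algebra_simps)
    then have "F x \<le> F ut" by (rule min[OF utR])
    moreover have "inner_d d (G ut) (\<lambda>i. x i - ut i) = - t * inner_d d (G ut) ?w"
    proof -
      have "inner_d d (G ut) (\<lambda>i. x i - ut i) = inner_d d (G ut) (\<lambda>i. (- t) * (u i - x i))"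
        by (rule inner_d_cong) (simp_all add: ut_def algebra_simps)
      then show ?thesis by (simp only: inner_d_scale_right)
    qed
    ultimately have "0 \<le> t * inner_d d (G ut) ?w"
      using smoothed_first_order[OF utR x(1)] by simp
    then have 1: "0 \<le> inner_d d (G ut) ?w" using t by (simp add: zero_le_mult_iff)
    have utx: "norm_d d (\<lambda>i. ut i - x i) = t * ?n"
      using t by (simp add: ut_def norm_d_scale)
    have "t * ?n \<le> t * (1 + ?n)" using t by simp
    also have "\<dots> \<le> \<sigma>" using t n1 by (simp add: field_simps)
    finally have "norm_d d (\<lambda>k. G ut k - G x k) \<le> 2 * L / \<sigma> * (t * ?n)"
      using G_lipschitz[of ut x] by (simp add: utx)
    moreover have "inner_d d (\<lambda>k. G ut k - G x k) ?w \<le> norm_d d (\<lambda>k. G ut k - G x k) * ?n"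
      by (rule inner_d_le)
    ultimately have "inner_d d (\<lambda>k. G ut k - G x k) ?w \<le> 2 * L / \<sigma> * (t * ?n) * ?n"
      by (meson mult_right_mono norm_d_nonneg order_trans)
    with 1 show "0 \<le> inner_d d (G x) ?w + (2 * L / \<sigma> * ?n * ?n) * t"
      by (simp add: inner_d_diff_left algebra_simps)
  qed
  have "((\<lambda>t. inner_d d (G x) ?w + (2 * L / \<sigma> * ?n * ?n) * t) \<longlongrightarrow> inner_d d (G x) ?w + (2 * L / \<sigma> * ?n * ?n) * 0) (at_right 0)"
    by (intro tendsto_intros)
  from tendsto_lowerbound[OF this ev] show ?thesis by simp
qed

text \<open>The variational inequality at the extreme point of the ball in the direction
  -\<open>G x\<close> forces equality in Cauchy-Schwarz, so \<open>G x\<close> is a nonnegative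
  multiple of \<open>y - x\<close>. The multiplier is |G x| / r, hence at most
  \<open>L / r\<close>.\<close>

lemma exists_ball_KKT:
  assumes y: "y \<in> Rd d" and r: "0 < r"
  obtains x l where "x \<in> Rd d" "norm_d d (\<lambda>i. x i - y i) \<le> r" "0 \<le> l" "l \<le> L / r"
    "\<And>k. G x k = l * (y k - x k)" "l = 0 \<or> norm_d d (\<lambda>i. x i - y i) = r"
proof -
  obtain x where x: "x \<in> Rd d" "norm_d d (\<lambda>i. x i - y i) \<le> r"
    "\<And>u. u \<in> Rd d \<Longrightarrow> norm_d d (\<lambda>i. u i - y i) \<le> r \<Longrightarrow> F x \<le> F u"
    using exists_ball_minimizer[OF y less_imp_le[OF r]] by blast
  define n where "n = norm_d d (G x)"
  have out: "k \<ge> d \<Longrightarrow> G x k = 0 \<and> x k = 0 \<and> y k = 0" for k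
    using G_Rd[of x] x(1) y by (simp add: Rd_def)
  show ?thesis
  proof (cases "n = 0")
    case True
    then have "G x k = 0" for k
      using norm_d_eq_0D[of d "G x" k] out[of k] unfolding n_def by (cases "k < d") auto
    then show ?thesis using that[of x 0] x L_pos r by simp
  next
    case False
    then have n: "0 < n" using norm_d_nonneg[of d "G x"] by (simp add: n_def less_le)
    let ?w = "\<lambda>i. y i - x i"
    \<comment> \<open>The minimizer over the ball of the linear functional given by
      \<open>G x\<close>.\<close>
    define u where "u = (\<lambda>i. y i - (r / n) * G x i)"
    have uR: "u \<in> Rd d" unfolding u_def by (intro Rd_diff Rd_scale y G_Rd)
    have "norm_d d (\<lambda>i. u i - y i) = norm_d d (\<lambda>i. (- (r / n)) * G x i)"
      by (rule norm_d_cong) (simp add: u_def)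
    also have "\<dots> = r" unfolding norm_d_scale using n r by (simp add: n_def)
    finally have "0 \<le> inner_d d (G x) (\<lambda>i. u i - x i)"
      by (intro variational_inequality[OF x uR]) auto
    also have "inner_d d (G x) (\<lambda>i. u i - x i) = inner_d d (G x) ?w - (r / n) * inner_d d (G x) (G x)"
      unfolding u_def
      by (simp only: inner_d_diff_right inner_d_scale_right)
    also have "inner_d d (G x) (G x) = n * n"
      by (simp add: n_def norm_d_sq flip: power2_eq_square)
    finally have ip: "r * n \<le> inner_d d (G x) ?w" using n by simp
    also have "\<dots> \<le> n * norm_d d ?w" unfolding n_def by (rule inner_d_le)
    finally have "r \<le> norm_d d ?w" using n by (simp add: mult.commute)
    then have nr: "norm_d d ?w = r" using x(2) norm_d_diff_commute[of d x y] by simp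
    have nn: "inner_d d ?w ?w = r * r" using norm_d_sq[of d ?w] nr by (simp add: power2_eq_square)
    \<comment> \<open>The equality case of Cauchy-Schwarz: the squared norm of this combination is
      at most 0, so the two vectors are parallel.\<close>
    have "inner_d d (\<lambda>i. r * G x i - n * (y i - x i)) (\<lambda>i. r * G x i - n * (y i - x i))
        = r * (r * inner_d d (G x) (G x)) - 2 * (r * n * inner_d d (G x) ?w) + n * (n * inner_d d ?w ?w)"
      by (simp only: inner_d_diff_left[of d "\<lambda>i. r * G x i" "\<lambda>i. n * (y i - x i)"]
          inner_d_diff_right[of d _ "\<lambda>i. r * G x i" "\<lambda>i. n * (y i - x i)"]
          inner_d_scale_left inner_d_scale_right inner_d_commute[of d ?w "G x"]) (simp add: algebra_simps)
    also have "\<dots> = 2 * (r * n) * (r * n - inner_d d (G x) ?w)"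
      unfolding nn \<open>inner_d d (G x) (G x) = n * n\<close> by (simp add: algebra_simps)
    also have "\<dots> \<le> 0" using ip n r by (simp add: mult_le_0_iff)
    finally have "norm_d d (\<lambda>i. r * G x i - n * (y i - x i)) = 0"
      using inner_d_self_nonneg[of d "\<lambda>i. r * G x i - n * (y i - x i)"] by (simp add: norm_d_def)
    then have "k < d \<Longrightarrow> r * G x k = n * (y k - x k)" for k
      using norm_d_eq_0D[of d "\<lambda>i. r * G x i - n * (y i - x i)" k] by simp
    then have "G x k = (n / r) * (y k - x k)" for k
      using out[of k] r by (cases "k < d") (auto simp: field_simps)
    moreover have "n / r \<le> L / r" using G_bound[of x] r by (simp add: n_def divide_right_mono)
    ultimately show ?thesis
      using that[of x "n / r"] x n r nr norm_d_diff_commute[of d x y] by simp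
  qed
qed

end

section \<open>Rounding to a finite lattice\<close>

definition round_d :: "nat \<Rightarrow> real \<Rightarrow> vec \<Rightarrow> vec" where
  "round_d d \<eta> x = (\<lambda>i. if i < d then \<eta> * of_int \<lfloor>x i / \<eta>\<rfloor> else 0)"

definition lattice :: "nat \<Rightarrow> real \<Rightarrow> nat \<Rightarrow> vec set" where
  "lattice d \<eta> K = {x \<in> Rd d. \<forall>i<d. \<exists>n::int. \<bar>n\<bar> \<le> int K \<and> x i = \<eta> * of_int n}"

lemma norm_round_d_diff:
  assumes "0 < \<eta>"
  shows "norm_d d (\<lambda>i. round_d d \<eta> x i - x i) \<le> sqrt (real d) * \<eta>"
proof (rule norm_d_le_sup)
  fix i assume i: "i < d"
  have "round_d d \<eta> x i - x i = \<eta> * (of_int \<lfloor>x i / \<eta>\<rfloor> - x i / \<eta>)"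
    using i assms by (simp add: round_d_def right_diff_distrib)
  then have "\<bar>round_d d \<eta> x i - x i\<bar> = \<eta> * \<bar>of_int \<lfloor>x i / \<eta>\<rfloor> - x i / \<eta>\<bar>"
    using assms by (simp only: abs_mult abs_of_pos)
  also have "\<dots> \<le> \<eta> * 1" using assms by (intro mult_left_mono) linarith+
  finally show "\<bar>round_d d \<eta> x i - x i\<bar> \<le> \<eta>" by simp
qed (use assms in simp)

lemma round_d_in_lattice:
  assumes "0 < \<eta>" "\<And>i. i < d \<Longrightarrow> \<bar>x i\<bar> \<le> \<eta> * (real K - 1)"
  shows "round_d d \<eta> x \<in> lattice d \<eta> K"
proof -
  have "\<bar>\<lfloor>x i / \<eta>\<rfloor>\<bar> \<le> int K" if "i < d" for i
  proof -
    have "\<bar>x i / \<eta>\<bar> \<le> real K - 1"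
      using assms(2)[OF that] assms(1) by (simp add: abs_divide field_simps)
    then show ?thesis by linarith
  qed
  then show ?thesis by (auto simp: lattice_def round_d_def Rd_def)
qed

text \<open>The logarithm of this count is what the number of sample groups has to beat in the union
  bound; it is the source of the additional factor \<open>d\<close> in the work compared with the
  depth.\<close>

lemma finite_lattice: "finite (lattice d \<eta> K)"
  and card_lattice: "card (lattice d \<eta> K) \<le> (2 * K + 1) ^ d"
proof -
  define \<phi> where "\<phi> n = (\<lambda>i. if i < d then \<eta> * of_int (n i) else (0::real))" for n :: "nat \<Rightarrow> int"
  let ?P = "PiE {..<d} (\<lambda>_. {- int K..int K})"
  have sub: "lattice d \<eta> K \<subseteq> \<phi> ` ?P"
  proof
    fix x assume x: "x \<in> lattice d \<eta> K"
    then obtain n where n: "\<And>i. i < d \<Longrightarrow> \<bar>n i\<bar> \<le> int K \<and> x i = \<eta> * of_int (n i)"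
      unfolding lattice_def by (auto simp: choice_iff')
    have "x = \<phi> (restrict n {..<d})"
    proof
      fix i show "x i = \<phi> (restrict n {..<d}) i"
        using x n[of i] by (cases "i < d") (simp_all add: \<phi>_def lattice_def Rd_def)
    qed
    moreover have "- int K \<le> n i \<and> n i \<le> int K" if "i < d" for i
      using n[OF that] by linarith
    then have "restrict n {..<d} \<in> ?P" by simp
    ultimately show "x \<in> \<phi> ` ?P" by blast
  qed
  have fin: "finite ?P" by (intro finite_PiE) auto
  show "finite (lattice d \<eta> K)" using sub fin by (meson finite_imageI finite_subset)
  have "card (lattice d \<eta> K) \<le> card ?P"
    by (rule surj_card_le[OF fin sub])
  also have "card ?P = (2 * K + 1) ^ d" by (simp add: card_PiE nat_add_distrib nat_mult_distrib)
  finally show "card (lattice d \<eta> K) \<le> (2 * K + 1) ^ d" .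
qed

section \<open>Sampling\<close>

lemma integral_sq_sum_PiM:
  fixes U :: "'a \<Rightarrow> real"
  assumes M: "prob_space M" and U: "integrable M U" "integrable M (\<lambda>x. (U x)\<^sup>2)"
    and U0: "(\<integral>x. U x \<partial>M) = 0"
  shows "integrable (PiM {..<n} (\<lambda>_. M)) (\<lambda>z. (\<Sum>i<n. U (z i))\<^sup>2)"
    and "(\<integral>z. (\<Sum>i<n. U (z i))\<^sup>2 \<partial>PiM {..<n} (\<lambda>_. M)) = real n * (\<integral>x. (U x)\<^sup>2 \<partial>M)"
proof -
  interpret M: prob_space M by fact
  interpret P: product_prob_space "\<lambda>_::nat. M" by (rule product_prob_spaceI) (rule M)
  let ?P = "PiM {..<n} (\<lambda>_. M)"
  \<comment> \<open>Writes \<open>U (z i) * U (z j)\<close> as a product over all coordinates,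
    including the case \<open>i = j\<close>, so that the integral of a product over independent
    factors applies. Off the diagonal a factor has mean 0.\<close>
  define g where "g i j l x = (if l = i then U x else 1) * (if l = j then U x else 1)" for i j l :: nat and x
  have gint: "integrable M (g i j l)" for i j l
    using U by (cases "l = i"; cases "l = j") (simp_all add: g_def[abs_def] flip: power2_eq_square)
  have gprod: "(\<Prod>l<n. g i j l (z l)) = U (z i) * U (z j)" if "i < n" "j < n" for i j z
    using that by (simp add: g_def prod.distrib)
  have int: "integrable ?P (\<lambda>z. U (z i) * U (z j))" if "i < n" "j < n" for i j
    using P.product_integrable_prod[of "{..<n}" "g i j"] gint gprod[OF that] by simp
  have val: "(\<integral>z. U (z i) * U (z j) \<partial>?P) = (if i = j then (\<integral>x. (U x)\<^sup>2 \<partial>M) else 0)"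
    if "i < n" "j < n" for i j
  proof -
    have "(\<integral>z. U (z i) * U (z j) \<partial>?P) = (\<Prod>l<n. \<integral>x. g i j l x \<partial>M)"
      using P.product_integral_prod[of "{..<n}" "g i j"] gint gprod[OF that] by simp
    also have "\<dots> = (if i = j then (\<integral>x. (U x)\<^sup>2 \<partial>M) else 0)"
    proof (cases "i = j")
      case True
      have "(\<integral>x. g i j l x \<partial>M) = (if l = i then (\<integral>x. (U x)\<^sup>2 \<partial>M) else 1)" for l
        using True by (simp add: g_def power2_eq_square M.prob_space)
      then show ?thesis using True that by simp
    next
      case False
      then have "(\<integral>x. g i j i x \<partial>M) = 0" by (simp add: g_def U0)
      then show ?thesis using False that by (simp add: prod_zero_iff) blast
    qed
    finally show ?thesis .
  qed
  have sq: "(\<Sum>i<n. U (z i))\<^sup>2 = (\<Sum>i<n. \<Sum>j<n. U (z i) * U (z j))" for z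
    by (simp add: power2_eq_square sum_product)
  show "integrable ?P (\<lambda>z. (\<Sum>i<n. U (z i))\<^sup>2)"
    unfolding sq by (intro Bochner_Integration.integrable_sum int) auto
  have "(\<integral>z. (\<Sum>i<n. U (z i))\<^sup>2 \<partial>?P) = (\<Sum>i<n. \<Sum>j<n. \<integral>z. U (z i) * U (z j) \<partial>?P)"
    unfolding sq
    by (subst Bochner_Integration.integral_sum, force intro!: Bochner_Integration.integrable_sum int,
        intro sum.cong refl, subst Bochner_Integration.integral_sum) (auto intro!: int)
  also have "\<dots> = (\<Sum>i<n. \<Sum>j<n. if i = j then (\<integral>x. (U x)\<^sup>2 \<partial>M) else 0)"
    by (intro sum.cong refl val) auto
  also have "\<dots> = real n * (\<integral>x. (U x)\<^sup>2 \<partial>M)" by simp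
  finally show "(\<integral>z. (\<Sum>i<n. U (z i))\<^sup>2 \<partial>?P) = real n * (\<integral>x. (U x)\<^sup>2 \<partial>M)" .
qed

text \<open>The coordinate variances are summed before Markov's inequality is applied, so the bound
  involves only the second moment of the norm, with no union over coordinates.\<close>

lemma vector_Chebyshev_PiM:
  fixes Y :: "'a \<Rightarrow> vec"
  assumes M: "prob_space M"
    and Y: "\<And>k. k < d \<Longrightarrow> integrable M (\<lambda>x. Y x k)" "\<And>k. k < d \<Longrightarrow> integrable M (\<lambda>x. (Y x k)\<^sup>2)"
    and V: "(\<integral>x. (norm_d d (Y x))\<^sup>2 \<partial>M) \<le> V"
    and \<mu>: "\<And>k. k < d \<Longrightarrow> \<mu> k = (\<integral>x. Y x k \<partial>M)"
    and n: "0 < n" and \<tau>: "0 < \<tau>"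
  defines "P \<equiv> PiM {..<n} (\<lambda>_. M)"
  defines "B \<equiv> {z \<in> space P. \<tau> < norm_d d (\<lambda>k. (\<Sum>i<n. Y (z i) k) / real n - \<mu> k)}"
  shows "B \<in> sets P" and "measure P B \<le> V / (real n * \<tau>\<^sup>2)"
proof -
  interpret M: prob_space M by fact
  interpret P: prob_space P unfolding P_def by (rule prob_space_PiM) (rule M)
  define S where "S z = (\<Sum>k<d. ((\<Sum>i<n. Y (z i) k) / real n - \<mu> k)\<^sup>2)" for z
  have S: "(norm_d d (\<lambda>k. (\<Sum>i<n. Y (z i) k) / real n - \<mu> k))\<^sup>2 = S z" for z
    unfolding norm_d_sq by (simp add: S_def inner_d_def power2_eq_square)
  have S1: "((\<Sum>i<n. Y (z i) k) / real n - \<mu> k)\<^sup>2 = (\<Sum>i<n. Y (z i) k - \<mu> k)\<^sup>2 / (real n)\<^sup>2" for z k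
    using n by (simp add: sum_subtractf power_divide[symmetric] diff_divide_distrib)
  have Uint: "integrable M (\<lambda>x. Y x k - \<mu> k)" if "k < d" for k
    using Y(1)[OF that] by simp
  have U2int: "integrable M (\<lambda>x. (Y x k - \<mu> k)\<^sup>2)" if "k < d" for k
    using Y[OF that] by (simp add: power2_diff)
  have U0: "(\<integral>x. Y x k - \<mu> k \<partial>M) = 0" if "k < d" for k
    using Y(1)[OF that] \<mu>[OF that] by (simp add: M.prob_space)
  have U2: "(\<integral>x. (Y x k - \<mu> k)\<^sup>2 \<partial>M) \<le> (\<integral>x. (Y x k)\<^sup>2 \<partial>M)" if "k < d" for k
    using M.variance_eq[OF Y(1)[OF that] Y(2)[OF that]] \<mu>[OF that] by simp
  have sq: "integrable P (\<lambda>z. (\<Sum>i<n. Y (z i) k - \<mu> k)\<^sup>2)"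
      "(\<integral>z. (\<Sum>i<n. Y (z i) k - \<mu> k)\<^sup>2 \<partial>P) = real n * (\<integral>x. (Y x k - \<mu> k)\<^sup>2 \<partial>M)" if "k < d" for k
    unfolding P_def using integral_sq_sum_PiM[OF M Uint[OF that] U2int[OF that] U0[OF that]] by auto
  have Sint: "integrable P S"
    unfolding S_def[abs_def] S1
    by (intro Bochner_Integration.integrable_sum integrable_divide sq(1)) auto
  have "(\<integral>z. S z \<partial>P) = (\<Sum>k<d. real n * (\<integral>x. (Y x k - \<mu> k)\<^sup>2 \<partial>M) / (real n)\<^sup>2)"
    unfolding S_def[abs_def] S1
    by (subst Bochner_Integration.integral_sum) (auto intro!: integrable_divide sq(1) simp: sq(2))
  also have "\<dots> = (\<Sum>k<d. (\<integral>x. (Y x k - \<mu> k)\<^sup>2 \<partial>M)) / real n"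
    using n by (simp add: power2_eq_square sum_divide_distrib)
  also have "\<dots> \<le> (\<Sum>k<d. (\<integral>x. (Y x k)\<^sup>2 \<partial>M)) / real n"
    by (intro divide_right_mono sum_mono U2) auto
  also have "(\<Sum>k<d. (\<integral>x. (Y x k)\<^sup>2 \<partial>M)) = (\<integral>x. (norm_d d (Y x))\<^sup>2 \<partial>M)"
  proof -
    have "(norm_d d (Y x))\<^sup>2 = (\<Sum>k<d. (Y x k)\<^sup>2)" for x
      unfolding norm_d_sq by (simp add: inner_d_def power2_eq_square)
    then show ?thesis using Y(2) by (simp add: Bochner_Integration.integral_sum)
  qed
  also have "\<dots> / real n \<le> V / real n" using V by (simp add: divide_right_mono)
  finally have ES: "(\<integral>z. S z \<partial>P) \<le> V / real n" .
  have B: "B = {z \<in> space P. \<tau>\<^sup>2 < S z}"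
    unfolding B_def S[symmetric] using \<tau> by (simp add: power_mono_iff flip: not_le)
  show "B \<in> sets P" unfolding B using Sint by measurable
  have "measure P B \<le> measure P {z \<in> space P. \<tau>\<^sup>2 \<le> S z}"
    unfolding B using Sint by (intro P.finite_measure_mono) auto
  also have "\<dots> \<le> (\<integral>z. S z \<partial>P) / \<tau>\<^sup>2"
  proof -
    have "0 \<le> S z" for z by (simp add: S_def sum_nonneg)
    then show ?thesis using \<tau> Sint by (intro integral_Markov_inequality_measure[where A = "{}"]) auto
  qed
  also have "\<dots> \<le> (V / real n) / \<tau>\<^sup>2" using ES by (rule divide_right_mono) simp
  finally show "measure P B \<le> V / (real n * \<tau>\<^sup>2)" by simp
qed

text \<open>Markov's inequality for the product of the variables that are 16 on the bad event and 1 elsewhere.\<close>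

lemma majority_bad_PiM:
  fixes m :: nat
  assumes M: "prob_space M" and B: "B \<in> sets M" "measure M B \<le> 1 / 16"
  defines "P \<equiv> PiM {..<m} (\<lambda>_::nat. M)"
  defines "E \<equiv> {z \<in> space P. m \<le> 2 * card {j. j < m \<and> z j \<in> B}}"
  shows "E \<in> sets P" and "measure P E \<le> (1 / 2) ^ m"
proof -
  interpret M: prob_space M by fact
  interpret PP: product_prob_space "\<lambda>_::nat. M" by (rule product_prob_spaceI) (rule M)
  interpret P: prob_space P unfolding P_def by (rule prob_space_PiM) (rule M)
  define \<phi> :: "'a \<Rightarrow> real" where "\<phi> x = 1 + 15 * indicator B x" for x
  define \<Phi> where "\<Phi> z = (\<Prod>j<m. \<phi> (z j))" for z :: "nat \<Rightarrow> 'a"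
  have ind: "integrable M (\<lambda>x. 15 * indicator B x :: real)"
    using B by (intro integrable_mult_right integrable_real_indicator) (auto simp: M.emeasure_eq_measure)
  then have \<phi>int: "integrable M \<phi>" unfolding \<phi>_def[abs_def] by simp
  have \<phi>exp: "(\<integral>x. \<phi> x \<partial>M) \<le> 2"
    unfolding \<phi>_def using B ind by (subst Bochner_Integration.integral_add) (simp_all add: M.prob_space)
  have \<phi>exp0: "0 \<le> (\<integral>x. \<phi> x \<partial>M)" by (rule integral_nonneg_AE) (simp add: \<phi>_def)
  have \<Phi>int: "integrable P \<Phi>"
    unfolding \<Phi>_def[abs_def] P_def by (rule PP.product_integrable_prod) (simp_all add: \<phi>int)
  have "(\<integral>z. \<Phi> z \<partial>P) = (\<Prod>j<m. \<integral>x. \<phi> x \<partial>M)"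
    unfolding \<Phi>_def P_def by (rule PP.product_integral_prod) (simp_all add: \<phi>int)
  also have "\<dots> \<le> 2 ^ m" using \<phi>exp \<phi>exp0 by (simp add: power_mono)
  finally have E\<Phi>: "(\<integral>z. \<Phi> z \<partial>P) \<le> 2 ^ m" .
  have \<Phi>eq: "\<Phi> z = 16 ^ card {j. j < m \<and> z j \<in> B}" for z
  proof -
    have "\<Phi> z = (\<Prod>j<m. if z j \<in> B then 16 else 1)"
      unfolding \<Phi>_def by (intro prod.cong) (auto simp: \<phi>_def)
    also have "\<dots> = (\<Prod>j\<in>{j. j < m \<and> z j \<in> B}. 16)"
      by (rule prod.mono_neutral_cong_right) auto
    finally show ?thesis by simp
  qed
  \<comment> \<open>With at least half of the \<open>m\<close> groups bad the product reaches
    16^(m/2) = 4^m, whereas its mean is at most (1 + 15/16)^m \<le> 2^m; this is why 16 and the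
    threshold 1/16 fit together.\<close>
  have iff: "m \<le> 2 * card {j. j < m \<and> z j \<in> B} \<longleftrightarrow> (4::real) ^ m \<le> \<Phi> z" for z
  proof -
    have "(16::real) ^ c = 4 ^ (2 * c)" for c by (simp add: power_mult)
    then show ?thesis unfolding \<Phi>eq by simp
  qed
  have E: "E = {z \<in> space P. 4 ^ m \<le> \<Phi> z}" unfolding E_def iff ..
  show "E \<in> sets P" unfolding E using \<Phi>int by measurable
  have "measure P E \<le> (\<integral>z. \<Phi> z \<partial>P) / 4 ^ m"
  proof -
    have "0 \<le> \<Phi> z" for z by (simp add: \<Phi>eq)
    then show ?thesis
      unfolding E using \<Phi>int by (intro integral_Markov_inequality_measure[where A = "{}"]) auto
  qed
  also have "\<dots> \<le> 2 ^ m / 4 ^ m" using E\<Phi> by (simp add: divide_right_mono)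
  also have "\<dots> = (1 / 2) ^ m" by (simp flip: power_divide)
  finally show "measure P E \<le> (1 / 2) ^ m" .
qed

text \<open>Importance-reweighted mean of the gradients at the points \<open>c + \<sigma> z\<^sub>i\<close>, which estimates the
  gradient of the smoothed function at \<open>x\<close>.\<close>

definition gmean :: "nat \<Rightarrow> real \<Rightarrow> nat \<Rightarrow> (vec \<Rightarrow> vec) \<Rightarrow> (nat \<Rightarrow> vec) \<Rightarrow> vec \<Rightarrow> vec \<Rightarrow> vec" where
  "gmean d \<sigma> n gr zs c x = (\<lambda>k. (\<Sum>i<n. weight d (\<lambda>l. (x l - c l) / \<sigma>) (zs i)
      * gr (\<lambda>l. c l + \<sigma> * zs i l) k) / real n)"

definition samples :: "nat \<Rightarrow> nat \<Rightarrow> nat \<Rightarrow> (nat \<Rightarrow> nat \<Rightarrow> vec) measure" where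
  "samples d n m = PiM {..<m} (\<lambda>_. PiM {..<n} (\<lambda>_. gauss d))"

lemma prob_space_samples: "prob_space (samples d n m)"
  unfolding samples_def by (intro prob_space_PiM prob_space_gauss)

context smoothed_problem
begin

definition qgrad :: "vec \<Rightarrow> vec" where
  "qgrad q = grad (trunc_d d q)"

text \<open>The reweighted gradient has second moment at most L^2 exp(|h|^2) \<le> 3 L^2 because |h|
  \<le> 1. Chebyshev gives 3 L^2 / (n \<tau>^2), and 48 = 3 * 16 brings this down to 1/16.\<close>

lemma gmean_failure:
  assumes c: "c \<in> Rd d" and x: "x \<in> Rd d" and xc: "norm_d d (\<lambda>i. x i - c i) \<le> \<sigma>"
    and \<tau>: "0 < \<tau>" and n: "48 * L\<^sup>2 / \<tau>\<^sup>2 \<le> real n"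
  defines "P \<equiv> PiM {..<n} (\<lambda>_. gauss d)"
  defines "B \<equiv> {zs \<in> space P. \<tau> < norm_d d (\<lambda>k. gmean d \<sigma> n qgrad zs c x k - G x k)}"
  shows "B \<in> sets P" and "measure P B \<le> 1 / 16"
proof -
  have n0: "0 < n"
  proof -
    have "0 < 48 * L\<^sup>2 / \<tau>\<^sup>2" using L_pos \<tau> by simp
    then show ?thesis using n by linarith
  qed
  define h where "h = (\<lambda>l. (x l - c l) / \<sigma>)"
  define Y where "Y z = (\<lambda>k. weight d h z * grad (pt c z) k)" for z
  have nh: "norm_d d h \<le> 1"
  proof -
    have "norm_d d h = norm_d d (\<lambda>i. 1 / \<sigma> * (x i - c i))"
      by (rule norm_d_cong) (simp add: h_def)
    also have "\<dots> \<le> 1" unfolding norm_d_scale using xc \<sigma>_pos by simp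
    finally show ?thesis .
  qed
  have xh: "(\<lambda>i. c i + \<sigma> * h i) = x" using \<sigma>_pos by (auto simp: h_def)
  have Yint: "integrable (gauss d) (\<lambda>z. Y z k)" for k
    unfolding Y_def by (rule integrable_weight_grad)
  have Ysq: "(Y z k)\<^sup>2 \<le> L\<^sup>2 * (weight d h z)\<^sup>2" for z k
  proof -
    have "(grad (pt c z) k)\<^sup>2 \<le> L\<^sup>2"
      using grad_component_bound[of c z k] L_pos by (simp add: abs_le_square_iff[symmetric])
    then have "(weight d h z)\<^sup>2 * (grad (pt c z) k)\<^sup>2 \<le> (weight d h z)\<^sup>2 * L\<^sup>2"
      by (rule mult_left_mono) simp
    then show ?thesis by (simp add: Y_def power_mult_distrib mult.commute)
  qed
  have Y2int: "integrable (gauss d) (\<lambda>z. (Y z k)\<^sup>2)" for k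
  proof (rule Bochner_Integration.integrable_bound)
    show "integrable (gauss d) (\<lambda>z. L\<^sup>2 * (weight d h z)\<^sup>2)"
      by (intro integrable_mult_right integrable_weight_sq)
    show "(\<lambda>z. (Y z k)\<^sup>2) \<in> borel_measurable (gauss d)"
      using Yint by measurable
    show "AE z in gauss d. norm ((Y z k)\<^sup>2) \<le> norm (L\<^sup>2 * (weight d h z)\<^sup>2)"
      using Ysq by simp
  qed
  have nY: "(norm_d d (Y z))\<^sup>2 \<le> L\<^sup>2 * (weight d h z)\<^sup>2" for z
  proof -
    have "norm_d d (Y z) = weight d h z * norm_d d (grad (pt c z))"
      unfolding Y_def norm_d_scale using weight_pos[of d h z] by simp
    also have "\<dots> \<le> weight d h z * L"
      using weight_pos[of d h z] by (intro mult_left_mono grad_bound) auto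
    finally have "(norm_d d (Y z))\<^sup>2 \<le> (weight d h z * L)\<^sup>2" by (intro power_mono) auto
    then show ?thesis by (simp add: power_mult_distrib mult.commute)
  qed
  have nYint: "integrable (gauss d) (\<lambda>z. (norm_d d (Y z))\<^sup>2)"
    unfolding norm_d_sq inner_d_def using Y2int
    by (intro Bochner_Integration.integrable_sum) (simp add: power2_eq_square)
  have "(\<integral>z. (norm_d d (Y z))\<^sup>2 \<partial>gauss d) \<le> (\<integral>z. L\<^sup>2 * (weight d h z)\<^sup>2 \<partial>gauss d)"
    using nY nYint by (intro integral_mono integrable_mult_right integrable_weight_sq) auto
  also have "\<dots> = L\<^sup>2 * exp (inner_d d h h)" by (simp add: integral_weight_sq)
  also have "\<dots> \<le> L\<^sup>2 * 3"
  proof -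
    have "inner_d d h h \<le> 1" using nh norm_d_sq[of d h] by (simp add: power_le_one flip: norm_d_sq)
    then have "exp (inner_d d h h) \<le> exp 1" by simp
    also have "\<dots> \<le> 3" using exp_le by simp
    finally show ?thesis by (intro mult_left_mono) auto
  qed
  finally have V: "(\<integral>z. (norm_d d (Y z))\<^sup>2 \<partial>gauss d) \<le> 3 * L\<^sup>2" by simp
  have Geq: "G x k = (\<integral>z. Y z k \<partial>gauss d)" for k
    using G_shift[of c h k] unfolding xh Y_def .
  have gm: "gmean d \<sigma> n qgrad zs c x k = (\<Sum>i<n. Y (zs i) k) / real n" for zs k
    by (simp add: gmean_def Y_def h_def qgrad_def pt_def)
  note cheb = vector_Chebyshev_PiM[OF prob_space_gauss Yint Y2int V Geq n0 \<tau>]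
  show "B \<in> sets P" unfolding B_def P_def gm by (rule cheb(1))
  have "measure P B \<le> 3 * L\<^sup>2 / (real n * \<tau>\<^sup>2)" unfolding B_def P_def gm by (rule cheb(2))
  also have "\<dots> \<le> 1 / 16" using n n0 \<tau> by (simp add: field_simps)
  finally show "measure P B \<le> 1 / 16" .
qed

text \<open>Depends on \<open>f\<close> but not on the run of the algorithm, since all pairs of
  lattice points are covered. The majority is strict so that it meets any other strict
  majority.\<close>

definition good_samples :: "nat \<Rightarrow> nat \<Rightarrow> real \<Rightarrow> vec set \<Rightarrow> (nat \<Rightarrow> nat \<Rightarrow> vec) set" where
  "good_samples n m \<tau> \<Lambda> = {z \<in> space (samples d n m). \<forall>c\<in>\<Lambda>. \<forall>x\<in>\<Lambda>. norm_d d (\<lambda>i. x i - c i) \<le> \<sigma> \<longrightarrow>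
     m < 2 * card {j. j < m \<and> norm_d d (\<lambda>k. gmean d \<sigma> n qgrad (z j) c x k - G x k) \<le> \<tau>}}"

lemma good_samples_prob:
  assumes \<Lambda>: "finite \<Lambda>" "\<Lambda> \<subseteq> Rd d" and \<tau>: "0 < \<tau>" and n: "48 * L\<^sup>2 / \<tau>\<^sup>2 \<le> real n"
  shows "good_samples n m \<tau> \<Lambda> \<in> sets (samples d n m)"
    and "1 - real ((card \<Lambda>)\<^sup>2) * (1 / 2) ^ m \<le> measure (samples d n m) (good_samples n m \<tau> \<Lambda>)"
proof -
  let ?P = "PiM {..<n} (\<lambda>_. gauss d)"
  interpret S: prob_space "samples d n m" by (rule prob_space_samples)
  have probP: "prob_space ?P" by (intro prob_space_PiM prob_space_gauss)
  define B where "B c x = {zs \<in> space ?P. \<tau> < norm_d d (\<lambda>k. gmean d \<sigma> n qgrad zs c x k - G x k)}" for c x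
  define E where "E = (\<lambda>(c, x). {z \<in> space (samples d n m). m \<le> 2 * card {j. j < m \<and> z j \<in> B c x}})"
  define I where "I = {(c, x). c \<in> \<Lambda> \<and> x \<in> \<Lambda> \<and> norm_d d (\<lambda>i. x i - c i) \<le> \<sigma>}"
  have I: "I \<subseteq> \<Lambda> \<times> \<Lambda>" by (auto simp: I_def)
  then have finI: "finite I" using \<Lambda> by (meson finite_SigmaI finite_subset)
  have Bad: "E p \<in> sets (samples d n m)" "measure (samples d n m) (E p) \<le> (1 / 2) ^ m" if "p \<in> I" for p
  proof -
    obtain c x where p: "p = (c, x)" by (cases p)
    have cx: "c \<in> Rd d" "x \<in> Rd d" "norm_d d (\<lambda>i. x i - c i) \<le> \<sigma>" using that \<Lambda> by (auto simp: p I_def)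
    note g = gmean_failure[OF cx \<tau> n, folded B_def]
    show "E p \<in> sets (samples d n m)" "measure (samples d n m) (E p) \<le> (1 / 2) ^ m"
      unfolding E_def p samples_def prod.case by (rule majority_bad_PiM[OF probP g])+
  qed
  have eq: "good_samples n m \<tau> \<Lambda> = space (samples d n m) - (\<Union>p\<in>I. E p)"
  proof -
    \<comment> \<open>Good and bad groups partition the \<open>m\<close> groups, so a strict
      majority of good ones is the negation of at least half being bad.\<close>
    have maj: "m < 2 * card {j. j < m \<and> norm_d d (\<lambda>k. gmean d \<sigma> n qgrad (z j) c x k - G x k) \<le> \<tau>}
        \<longleftrightarrow> \<not> m \<le> 2 * card {j. j < m \<and> z j \<in> B c x}" if z: "z \<in> space (samples d n m)" for z c x
    proof -
      let ?g = "{j. j < m \<and> norm_d d (\<lambda>k. gmean d \<sigma> n qgrad (z j) c x k - G x k) \<le> \<tau>}"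
      let ?b = "{j. j < m \<and> z j \<in> B c x}"
      have zj: "z j \<in> space ?P" if "j < m" for j
        using z that by (auto simp: samples_def space_PiM PiE_iff)
      have "?g \<union> ?b = {..<m}" using zj by (auto simp: B_def)
      moreover have "card (?g \<union> ?b) = card ?g + card ?b"
        by (rule card_Un_disjoint) (auto simp: B_def)
      ultimately have "card ?g + card ?b = m" by simp
      then show ?thesis by linarith
    qed
    show ?thesis unfolding good_samples_def E_def I_def using maj by blast
  qed
  have U: "(\<Union>p\<in>I. E p) \<in> sets (samples d n m)"
    using finI Bad(1) by (intro sets.finite_UN) auto
  then show "good_samples n m \<tau> \<Lambda> \<in> sets (samples d n m)" unfolding eq by auto
  have "measure (samples d n m) (\<Union>p\<in>I. E p) \<le> (\<Sum>p\<in>I. measure (samples d n m) (E p))"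
    using finI Bad(1) by (intro measure_UNION_le) auto
  also have "\<dots> \<le> (\<Sum>p\<in>I. (1 / 2) ^ m)" by (intro sum_mono Bad(2))
  also have "\<dots> = real (card I) * (1 / 2) ^ m" by simp
  also have "\<dots> \<le> real ((card \<Lambda>)\<^sup>2) * (1 / 2) ^ m"
  proof -
    have "card I \<le> card (\<Lambda> \<times> \<Lambda>)" using I \<Lambda> by (intro card_mono) auto
    then have "real (card I) \<le> real ((card \<Lambda>)\<^sup>2)" by (simp only: card_cartesian_product power2_eq_square of_nat_le_iff)
    then show ?thesis by (intro mult_right_mono) auto
  qed
  finally have "measure (samples d n m) (\<Union>p\<in>I. E p) \<le> real ((card \<Lambda>)\<^sup>2) * (1 / 2) ^ m" .
  moreover have "measure (samples d n m) (good_samples n m \<tau> \<Lambda>) = 1 - measure (samples d n m) (\<Union>p\<in>I. E p)"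
    unfolding eq by (rule S.prob_compl[OF U])
  ultimately show "1 - real ((card \<Lambda>)\<^sup>2) * (1 / 2) ^ m \<le> measure (samples d n m) (good_samples n m \<tau> \<Lambda>)" by linarith
qed

end

section \<open>The accelerated step\<close>

text \<open>An approximate KKT condition for the ball problem around \<open>y\<close> that uses
  oracle answers only. The tolerances \<open>2 * r\<close> and \<open>r / 2\<close> leave room for
  rounding a point at distance \<open>r\<close>, and \<delta>/2 for a rounding error and a sampling
  error of \<delta>/4 each.\<close>

definition selection_ok ::
  "nat \<Rightarrow> real \<Rightarrow> real \<Rightarrow> nat \<Rightarrow> real \<Rightarrow> real \<Rightarrow> nat \<Rightarrow> nat \<Rightarrow> (vec \<Rightarrow> vec) \<Rightarrow> (nat \<Rightarrow> nat \<Rightarrow> vec) \<Rightarrow> vec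
    \<Rightarrow> vec \<times> real \<Rightarrow> bool" where
  "selection_ok d \<sigma> \<eta> K r \<delta> n m gr z y = (\<lambda>(x, l). x \<in> lattice d \<eta> K \<and> 0 \<le> l \<and>
     norm_d d (\<lambda>i. x i - y i) \<le> 2 * r \<and> (l = 0 \<or> r / 2 \<le> norm_d d (\<lambda>i. x i - y i)) \<and>
     m < 2 * card {j. j < m \<and>
       norm_d d (\<lambda>k. gmean d \<sigma> n gr (z j) (round_d d \<eta> y) x k - l * (y k - x k)) \<le> \<delta> / 2})"

lemma lattice_Rd: "x \<in> lattice d \<eta> K \<Longrightarrow> x \<in> Rd d"
  by (simp add: lattice_def)

context smoothed_problem
begin

text \<open>The exact KKT point, rounded to the lattice, passes the test with its exact multiplier.
  Rounding changes \<open>G\<close> by its Lipschitz constant and \<open>l * (y - x)\<close> by at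
  most \<open>L / r\<close> times the rounding error, which \<open>acc\<close> bounds by \<delta>/4
  in total.\<close>

lemma selection_exists:
  assumes z: "z \<in> good_samples n m (\<delta> / 4) (lattice d \<eta> K)"
    and y: "y \<in> Rd d" and yb: "\<And>i. i < d \<Longrightarrow> \<bar>y i\<bar> + r \<le> \<eta> * (real K - 1)"
    and \<eta>: "0 < \<eta>" "sqrt (real d) * \<eta> \<le> r / 2" and r: "0 < r" "4 * r \<le> \<sigma>"
    and acc: "(2 * L / \<sigma> + L / r) * (sqrt (real d) * \<eta>) \<le> \<delta> / 4"
  shows "\<exists>p. selection_ok d \<sigma> \<eta> K r \<delta> n m qgrad z y p"
proof -
  obtain u l where u: "u \<in> Rd d" "norm_d d (\<lambda>i. u i - y i) \<le> r" and l: "0 \<le> l" "l \<le> L / r"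
    and kkt: "\<And>k. G u k = l * (y k - u k)" and move: "l = 0 \<or> norm_d d (\<lambda>i. u i - y i) = r"
    using exists_ball_KKT[OF y r(1)] by blast
  define x where "x = round_d d \<eta> u"
  define c where "c = round_d d \<eta> y"
  define D where "D = sqrt (real d) * \<eta>"
  have ub: "\<bar>u i\<bar> \<le> \<eta> * (real K - 1)" if "i < d" for i
    using component_le_norm_d[OF that, of "\<lambda>i. u i - y i"] u(2) yb[OF that] by linarith
  have x: "x \<in> lattice d \<eta> K" unfolding x_def by (rule round_d_in_lattice[OF \<eta>(1) ub])
  have c: "c \<in> lattice d \<eta> K" unfolding c_def
    by (rule round_d_in_lattice[OF \<eta>(1)]) (use yb r in fastforce)
  have xu: "norm_d d (\<lambda>i. x i - u i) \<le> D" unfolding x_def D_def by (rule norm_round_d_diff[OF \<eta>(1)])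
  have cy: "norm_d d (\<lambda>i. c i - y i) \<le> D" unfolding c_def D_def by (rule norm_round_d_diff[OF \<eta>(1)])
  have Dr: "D \<le> r / 2" using \<eta> by (simp add: D_def)
  have xy: "norm_d d (\<lambda>i. x i - y i) \<le> 3 / 2 * r"
    using norm_d_triangle_via[of d x y u] xu u Dr by simp
  have xy': "l = 0 \<or> r / 2 \<le> norm_d d (\<lambda>i. x i - y i)"
    using norm_d_triangle_via[of d u y x] xu move Dr norm_d_diff_commute[of d x u] by auto
  have xc: "norm_d d (\<lambda>i. x i - c i) \<le> \<sigma>"
    using norm_d_triangle_via[of d x c y] xy cy Dr r norm_d_diff_commute[of d c y] by simp
  have Gx: "norm_d d (\<lambda>k. G x k - l * (y k - x k)) \<le> \<delta> / 4"
  proof -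
    have "norm_d d (\<lambda>k. G x k - l * (y k - x k)) = norm_d d (\<lambda>k. (G x k - G u k) + l * (x k - u k))"
      by (rule norm_d_cong) (simp add: kkt algebra_simps)
    also have "\<dots> \<le> norm_d d (\<lambda>k. G x k - G u k) + norm_d d (\<lambda>k. l * (x k - u k))"
      by (rule norm_d_triangle)
    also have "\<dots> \<le> 2 * L / \<sigma> * D + L / r * D"
    proof (rule add_mono)
      have "norm_d d (\<lambda>k. G x k - G u k) \<le> 2 * L / \<sigma> * norm_d d (\<lambda>i. x i - u i)"
        using xu Dr r by (intro G_lipschitz) linarith
      also have "\<dots> \<le> 2 * L / \<sigma> * D" using xu L_pos \<sigma>_pos by (intro mult_left_mono) auto
      finally show "norm_d d (\<lambda>k. G x k - G u k) \<le> 2 * L / \<sigma> * D" .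
      show "norm_d d (\<lambda>k. l * (x k - u k)) \<le> L / r * D"
        unfolding norm_d_scale using l xu L_pos r by (intro mult_mono) auto
    qed
    also have "\<dots> \<le> \<delta> / 4" using acc by (simp add: D_def algebra_simps)
    finally show ?thesis .
  qed
  have "m < 2 * card {j. j < m \<and> norm_d d (\<lambda>k. gmean d \<sigma> n qgrad (z j) c x k - G x k) \<le> \<delta> / 4}"
    using z c x xc by (simp add: good_samples_def)
  also have "\<dots> \<le> 2 * card {j. j < m \<and> norm_d d (\<lambda>k. gmean d \<sigma> n qgrad (z j) c x k - l * (y k - x k)) \<le> \<delta> / 2}"
  proof (intro mult_left_mono card_mono subsetI CollectI conjI)
    fix j assume j: "j \<in> {j. j < m \<and> norm_d d (\<lambda>k. gmean d \<sigma> n qgrad (z j) c x k - G x k) \<le> \<delta> / 4}"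
    then show "j < m" by simp
    show "norm_d d (\<lambda>k. gmean d \<sigma> n qgrad (z j) c x k - l * (y k - x k)) \<le> \<delta> / 2"
      using norm_d_triangle_via[of d "gmean d \<sigma> n qgrad (z j) c x" "\<lambda>k. l * (y k - x k)" "G x"] j Gx by simp
  qed auto
  finally have "selection_ok d \<sigma> \<eta> K r \<delta> n m qgrad z y (x, l)"
    using x l xy xy' r by (simp add: selection_ok_def c_def)
  then show ?thesis by blast
qed

text \<open>More than half of the groups are accurate for \<open>G x\<close>, and more than half are
  close to \<open>l * (y - x)\<close>; some group is both, and the triangle inequality through its
  mean gives the claim.\<close>

lemma selection_sound:
  assumes z: "z \<in> good_samples n m (\<delta> / 4) (lattice d \<eta> K)"
    and y: "y \<in> Rd d" and yb: "\<And>i. i < d \<Longrightarrow> \<bar>y i\<bar> + r \<le> \<eta> * (real K - 1)"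
    and \<eta>: "0 < \<eta>" "sqrt (real d) * \<eta> \<le> r / 2" and r: "0 < r" "4 * r \<le> \<sigma>" and \<delta>: "0 < \<delta>"
    and sel: "selection_ok d \<sigma> \<eta> K r \<delta> n m qgrad z y (x, l)"
  shows "norm_d d (\<lambda>k. G x k - l * (y k - x k)) \<le> \<delta>"
proof -
  define c where "c = round_d d \<eta> y"
  have c: "c \<in> lattice d \<eta> K" unfolding c_def
    by (rule round_d_in_lattice[OF \<eta>(1)]) (use yb r in fastforce)
  have cy: "norm_d d (\<lambda>i. c i - y i) \<le> sqrt (real d) * \<eta>" unfolding c_def by (rule norm_round_d_diff[OF \<eta>(1)])
  have x: "x \<in> lattice d \<eta> K" and xy: "norm_d d (\<lambda>i. x i - y i) \<le> 2 * r"
    and maj: "m < 2 * card {j. j < m \<and> norm_d d (\<lambda>k. gmean d \<sigma> n qgrad (z j) c x k - l * (y k - x k)) \<le> \<delta> / 2}"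
    (is "m < 2 * card ?B")
    using sel by (simp_all add: selection_ok_def c_def)
  have "norm_d d (\<lambda>i. x i - c i) \<le> \<sigma>"
    using norm_d_triangle_via[of d x c y] xy cy \<eta> r norm_d_diff_commute[of d c y] by simp
  then have maj': "m < 2 * card {j. j < m \<and> norm_d d (\<lambda>k. gmean d \<sigma> n qgrad (z j) c x k - G x k) \<le> \<delta> / 4}"
    (is "m < 2 * card ?A")
    using z c x by (simp add: good_samples_def)
  have "?A \<inter> ?B \<noteq> {}"
  proof
    assume "?A \<inter> ?B = {}"
    then have "card ?A + card ?B = card (?A \<union> ?B)" by (intro card_Un_disjoint[symmetric]) auto
    also have "\<dots> \<le> card {..<m}" by (intro card_mono) auto
    finally show False using maj maj' by simp
  qed
  then obtain j where j: "norm_d d (\<lambda>k. gmean d \<sigma> n qgrad (z j) c x k - G x k) \<le> \<delta> / 4"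
    "norm_d d (\<lambda>k. gmean d \<sigma> n qgrad (z j) c x k - l * (y k - x k)) \<le> \<delta> / 2" by blast
  then show ?thesis
    using norm_d_triangle_via[of d "G x" "\<lambda>k. l * (y k - x k)" "gmean d \<sigma> n qgrad (z j) c x"]
      norm_d_diff_commute[of d "G x" "gmean d \<sigma> n qgrad (z j) c x"] \<delta> by simp
qed

text \<open>One step of Monteiro--Svaiter acceleration with momentum damping \<open>\<gamma>\<close>; the guess \<open>b\<close> for the
  proximal parameter may differ from the multiplier \<open>s\<close> that the ball oracle returns.\<close>

lemma accelerated_step:
  assumes x: "x \<in> Rd d" and v: "v \<in> Rd d" and w: "w \<in> Rd d" and u: "u \<in> Rd d"
    and A: "0 < A" and b: "0 < b" and a: "0 < a" "b * a\<^sup>2 = A + a"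
    and s: "0 \<le> s" and \<gamma>: "0 < \<gamma>" "\<gamma> \<le> 1" "\<gamma> * s \<le> b"
    and y: "y = (\<lambda>i. (A * x i + a * v i) / (A + a))"
    and \<delta>: "norm_d d (\<lambda>k. G w k - s * (y k - w k)) \<le> \<delta>"
    and big: "4 * \<delta> \<le> s * norm_d d (\<lambda>i. w i - y i)"
    and x': "x' = (\<lambda>i. ((1 - \<gamma>) * A * x i + \<gamma> * (A + a) * w i) / (A + \<gamma> * a))"
    and v': "v' = (\<lambda>i. v i - \<gamma> * a * (s * (y i - w i)))"
  shows "(A + \<gamma> * a) * (F x' - F u) + (norm_d d (\<lambda>i. v' i - u i))\<^sup>2 / 2
     \<le> A * (F x - F u) + (norm_d d (\<lambda>i. v i - u i))\<^sup>2 / 2 + \<gamma> * a * \<delta> * norm_d d (\<lambda>i. v i - u i)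
       - \<gamma> * (A + a) * s * (norm_d d (\<lambda>i. w i - y i))\<^sup>2 / 4"
proof -
  define M where "M = norm_d d (\<lambda>i. w i - y i)"
  define N where "N = norm_d d (\<lambda>i. v i - u i)"
  define g where "g = (\<lambda>k. s * (y k - w k))"
  define e where "e = (\<lambda>k. G w k - g k)"
  define q where "q = (\<lambda>i. w i - y i)"
  define p where "p = (\<lambda>i. v i - u i)"
  have A': "0 < A + a" and A'': "0 < A + \<gamma> * a" using A a \<gamma> by (auto intro: add_pos_pos)
  have x'R: "x' \<in> Rd d" using x w by (simp add: x' Rd_def)
  \<comment> \<open>Jensen's inequality for \<open>x'\<close>, obtained from the subgradient
    inequality at \<open>x'\<close>: the weights \<open>(1 - \<gamma>) * A\<close> and
    \<open>\<gamma> * (A + a)\<close> add up to \<open>A + \<gamma> * a\<close>, so the linear terms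
    cancel.\<close>
  have conv: "(A + \<gamma> * a) * F x' \<le> (1 - \<gamma>) * A * F x + \<gamma> * (A + a) * F w"
  proof -
    have "(1 - \<gamma>) * A * (F x' + inner_d d (G x') (\<lambda>i. x i - x' i)) \<le> (1 - \<gamma>) * A * F x"
      using \<gamma> A by (intro mult_left_mono smoothed_first_order x x'R) auto
    moreover have "\<gamma> * (A + a) * (F x' + inner_d d (G x') (\<lambda>i. w i - x' i)) \<le> \<gamma> * (A + a) * F w"
      using \<gamma> A' by (intro mult_left_mono smoothed_first_order w x'R) auto
    moreover have "(1 - \<gamma>) * A * inner_d d (G x') (\<lambda>i. x i - x' i) + \<gamma> * (A + a) * inner_d d (G x') (\<lambda>i. w i - x' i) = 0"
    proof -
      have "(1 - \<gamma>) * A * inner_d d (G x') (\<lambda>i. x i - x' i) + \<gamma> * (A + a) * inner_d d (G x') (\<lambda>i. w i - x' i)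
        = inner_d d (G x') (\<lambda>i. (1 - \<gamma>) * A * (x i - x' i) + \<gamma> * (A + a) * (w i - x' i))"
        by (simp only: inner_d_add_right inner_d_scale_right)
      also have "(\<lambda>i. (1 - \<gamma>) * A * (x i - x' i) + \<gamma> * (A + a) * (w i - x' i)) = (\<lambda>i. 0)"
      proof
        fix i
        have "(A + \<gamma> * a) * x' i = (1 - \<gamma>) * A * x i + \<gamma> * (A + a) * w i" using A'' by (simp add: x')
        then show "(1 - \<gamma>) * A * (x i - x' i) + \<gamma> * (A + a) * (w i - x' i) = 0" by (simp add: algebra_simps)
      qed
      finally show ?thesis by (simp add: inner_d_def)
    qed
    ultimately show ?thesis by (simp add: algebra_simps)
  qed
  have I1: "F w - F u \<le> inner_d d (G w) (\<lambda>i. w i - u i)"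
    using smoothed_first_order[OF w u] by (simp add: inner_d_diff_right)
  have I2: "F w - F x \<le> inner_d d (G w) (\<lambda>i. w i - x i)"
    using smoothed_first_order[OF w x] by (simp add: inner_d_diff_right)
  have comb: "a * inner_d d (G w) (\<lambda>i. w i - u i) + A * inner_d d (G w) (\<lambda>i. w i - x i)
      = (A + a) * inner_d d (G w) q + a * inner_d d (G w) p"
  proof -
    have "a * inner_d d (G w) (\<lambda>i. w i - u i) + A * inner_d d (G w) (\<lambda>i. w i - x i)
      = inner_d d (G w) (\<lambda>i. a * (w i - u i) + A * (w i - x i))"
      by (simp only: inner_d_add_right inner_d_scale_right)
    also have "(\<lambda>i. a * (w i - u i) + A * (w i - x i)) = (\<lambda>i. (A + a) * q i + a * p i)"
    proof
      fix i
      have "(A + a) * y i = A * x i + a * v i" using A' by (simp add: y)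
      then show "a * (w i - u i) + A * (w i - x i) = (A + a) * q i + a * p i"
        by (simp add: q_def p_def algebra_simps)
    qed
    finally show ?thesis by (simp only: inner_d_add_right inner_d_scale_right)
  qed
  have Gq: "inner_d d (G w) q = inner_d d g q + inner_d d e q" and Gp: "inner_d d (G w) p = inner_d d g p + inner_d d e p"
    by (simp_all add: e_def inner_d_diff_left)
  have qq: "inner_d d q q = M\<^sup>2" by (simp add: M_def q_def norm_d_sq)
  have g': "g = (\<lambda>i. (- s) * q i)" by (auto simp: g_def q_def algebra_simps)
  have gq: "inner_d d g q = - s * M\<^sup>2" unfolding g' inner_d_scale_left qq by simp
  have gg: "inner_d d g g = s\<^sup>2 * M\<^sup>2"
    unfolding g' inner_d_scale_left inner_d_scale_right qq by (simp add: power2_eq_square)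
  have eb: "norm_d d e \<le> \<delta>" using \<delta> by (simp add: e_def g_def)
  have eq: "inner_d d e q \<le> \<delta> * M"
    using inner_d_le[of d e q] eb mult_right_mono[OF eb, of M] by (simp add: M_def q_def)
  have ep: "inner_d d e p \<le> \<delta> * N"
    using inner_d_le[of d e p] eb mult_right_mono[OF eb, of N] by (simp add: N_def p_def)
  have vv: "(norm_d d (\<lambda>i. v' i - u i))\<^sup>2 = N\<^sup>2 - 2 * (\<gamma> * a) * inner_d d g p + (\<gamma> * a)\<^sup>2 * (s\<^sup>2 * M\<^sup>2)"
  proof -
    have "(\<lambda>i. v' i - u i) = (\<lambda>i. p i - \<gamma> * a * g i)" by (auto simp: v' p_def g_def)
    then have "(norm_d d (\<lambda>i. v' i - u i))\<^sup>2 = inner_d d (\<lambda>i. p i - \<gamma> * a * g i) (\<lambda>i. p i - \<gamma> * a * g i)"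
      by (simp only: norm_d_sq)
    also have "\<dots> = inner_d d p p - 2 * (\<gamma> * a) * inner_d d g p + (\<gamma> * a)\<^sup>2 * inner_d d g g"
      by (simp only: inner_d_diff_left inner_d_diff_right inner_d_scale_left inner_d_scale_right
          inner_d_commute[of d p g]) (simp add: power2_eq_square algebra_simps)
    finally show ?thesis unfolding gg by (simp add: N_def p_def norm_d_sq)
  qed
  have M0: "0 \<le> M" by (simp add: M_def)
  \<comment> \<open>The damping \<open>\<gamma> * s \<le> b\<close> and
    \<open>b * a\<^sup>2 = A + a\<close> bound the squared mirror step by the gain
    \<gamma>(A+a)sM^2. It enters with factor 1/2, and the oracle error takes 1/4
    (\<open>err\<close>); the last quarter is the dissipation in the conclusion.\<close>
  have quad: "(\<gamma> * a)\<^sup>2 * (s\<^sup>2 * M\<^sup>2) \<le> \<gamma> * (A + a) * s * M\<^sup>2"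
  proof -
    have "(\<gamma> * a)\<^sup>2 * (s\<^sup>2 * M\<^sup>2) = (\<gamma> * s) * (\<gamma> * s * a\<^sup>2 * M\<^sup>2)" by (simp add: power2_eq_square algebra_simps)
    also have "\<dots> \<le> b * (\<gamma> * s * a\<^sup>2 * M\<^sup>2)" using \<gamma> s by (intro mult_right_mono) auto
    also have "\<dots> = \<gamma> * s * (b * a\<^sup>2) * M\<^sup>2" by simp
    also have "\<dots> = \<gamma> * (A + a) * s * M\<^sup>2" unfolding a(2) by simp
    finally show ?thesis .
  qed
  have err: "\<gamma> * (A + a) * (\<delta> * M) \<le> \<gamma> * (A + a) * s * M\<^sup>2 / 4"
  proof -
    have "\<delta> * M \<le> (s * M / 4) * M" using big M0 by (intro mult_right_mono) (auto simp: M_def)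
    then have "\<gamma> * (A + a) * (\<delta> * M) \<le> \<gamma> * (A + a) * ((s * M / 4) * M)"
      using \<gamma> A' by (intro mult_left_mono) auto
    then show ?thesis by (simp add: power2_eq_square algebra_simps)
  qed
  have "(A + \<gamma> * a) * (F x' - F u) - A * (F x - F u) \<le> \<gamma> * (a * (F w - F u) + A * (F w - F x))"
    using conv by (simp add: algebra_simps)
  also have "\<dots> \<le> \<gamma> * (a * inner_d d (G w) (\<lambda>i. w i - u i) + A * inner_d d (G w) (\<lambda>i. w i - x i))"
    using I1 I2 \<gamma> A a by (intro mult_left_mono add_mono) auto
  also have "\<dots> = \<gamma> * (A + a) * (- s * M\<^sup>2) + \<gamma> * a * inner_d d g p
      + \<gamma> * (A + a) * inner_d d e q + \<gamma> * a * inner_d d e p"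
    unfolding comb Gq Gp gq by (simp add: algebra_simps)
  also have "\<dots> \<le> \<gamma> * (A + a) * (- s * M\<^sup>2) + \<gamma> * a * inner_d d g p
      + \<gamma> * (A + a) * (\<delta> * M) + \<gamma> * a * (\<delta> * N)"
    using \<gamma> A' a by (intro add_mono mult_left_mono eq ep order_refl) auto
  finally have main: "(A + \<gamma> * a) * (F x' - F u) - A * (F x - F u)
     \<le> - (\<gamma> * (A + a) * s * M\<^sup>2) + \<gamma> * a * inner_d d g p + \<gamma> * (A + a) * (\<delta> * M) + \<gamma> * a * \<delta> * N"
    by (simp add: mult.assoc)
  have "2 * (\<gamma> * a) * inner_d d g p = 2 * (\<gamma> * a * inner_d d g p)" by simp
  with main quad err show ?thesis
    unfolding vv M_def[symmetric] N_def[symmetric] by (simp only: diff_divide_distrib add_divide_distrib)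
qed

end

lemma norm_d_convex_combination:
  assumes "0 \<le> s" "0 \<le> t" "0 < s + t" "norm_d d (\<lambda>i. p i - u i) \<le> B" "norm_d d (\<lambda>i. q i - u i) \<le> B"
  shows "norm_d d (\<lambda>i. (s * p i + t * q i) / (s + t) - u i) \<le> B"
proof -
  define \<alpha> \<beta> where "\<alpha> = s / (s + t)" and "\<beta> = t / (s + t)"
  have \<alpha>\<beta>: "0 \<le> \<alpha>" "0 \<le> \<beta>" "\<beta> = 1 - \<alpha>" using assms by (auto simp: \<alpha>_def \<beta>_def field_simps)
  have "(s * p i + t * q i) / (s + t) - u i = \<alpha> * p i + \<beta> * q i - u i" for i
    by (simp add: \<alpha>_def \<beta>_def add_divide_distrib)
  then have "norm_d d (\<lambda>i. (s * p i + t * q i) / (s + t) - u i)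
      = norm_d d (\<lambda>i. \<alpha> * (p i - u i) + \<beta> * (q i - u i))"
    by (intro norm_d_cong) (simp add: \<alpha>\<beta>(3) algebra_simps)
  also have "\<dots> \<le> \<alpha> * norm_d d (\<lambda>i. p i - u i) + \<beta> * norm_d d (\<lambda>i. q i - u i)"
    by (rule order_trans[OF norm_d_triangle]) (use \<alpha>\<beta> in \<open>simp add: norm_d_scale\<close>)
  also have "\<dots> \<le> \<alpha> * B + \<beta> * B"
    using assms \<alpha>\<beta> by (intro add_mono mult_left_mono) auto
  also have "\<dots> = B" unfolding \<alpha>\<beta>(3) by (simp add: algebra_simps)
  finally show ?thesis .
qed

text \<open>The potential of the iteration count: \<open>E\<close> is the Lyapunov function in units of \<open>R\<^sup>2\<close>, and the
  absolute value pulls \<open>b A\<close> towards \<open>1/\<theta>\<^sup>2\<close>, where lowering the guess \<open>b\<close> (which enlarges \<open>A\<close>) and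
  raising it (which dissipates \<open>E\<close>) are equally profitable.\<close>

definition potential :: "real \<Rightarrow> real \<Rightarrow> real \<Rightarrow> real \<Rightarrow> real" where
  "potential \<theta> A E b = 14 * ln A - 144 * E - 2 * \<theta> * \<bar>ln b + ln A + 2 * ln \<theta>\<bar>"

text \<open>Write q = ln(b A \<theta>^2) and D for the growth of ln A. If q > 1, lowering
  \<open>b\<close> shrinks the penalty by 2\<theta> up to a drift of 2D. Otherwise b A \<theta>^2
  \<le> e, and \<open>b * a\<^sup>2 = A + a\<close> forces a/A \<ge> \<theta>/2, so D \<ge>
  \<theta>/4. The coefficient 14 leaves 12 D \<ge> 3\<theta> after the drift: 2\<theta> for the
  penalty and \<theta> of progress.\<close>

lemma potential_down:
  assumes \<theta>: "0 < \<theta>" "\<theta> \<le> 1" and A: "0 < A" and b: "0 < b" and a: "0 < a" "b * a\<^sup>2 = A + a"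
    and E: "E' \<le> E"
  shows "potential \<theta> A E b + \<theta> \<le> potential \<theta> (A + a) E' (b / exp 1)"
proof -
  define D where "D = ln (A + a) - ln A"
  define q where "q = ln b + ln A + 2 * ln \<theta>"
  have D0: "0 \<le> D" using A a by (simp add: D_def)
  have lb: "ln (b / exp 1) = ln b - 1" using b by (simp add: ln_div)
  have q': "ln (b / exp 1) + ln (A + a) + 2 * ln \<theta> = q - 1 + D"
    unfolding lb q_def D_def by simp
  define X where "X = 2 * \<theta> * (\<bar>q - 1 + D\<bar> - \<bar>q\<bar>)"
  have eq: "potential \<theta> (A + a) E' (b / exp 1) - potential \<theta> A E b
      = 14 * D + 144 * (E - E') - X"
    unfolding potential_def q' unfolding X_def q_def[symmetric] D_def by (simp add: algebra_simps)
  have abs: "\<bar>q - 1 + D\<bar> \<le> \<bar>q - 1\<bar> + D" using D0 by linarith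
  have tD: "\<theta> * D \<le> D" using \<theta> D0 by (simp add: mult_left_le_one_le)
  show ?thesis
  proof (cases "q \<le> 1")
    case False
    then have "\<bar>q - 1 + D\<bar> - \<bar>q\<bar> \<le> D - 1" using abs by linarith
    then have "X \<le> 2 * \<theta> * (D - 1)" unfolding X_def using \<theta> by (intro mult_left_mono) auto
    also have "\<dots> = 2 * (\<theta> * D) - 2 * \<theta>" by (simp add: algebra_simps)
    also have "\<dots> \<le> 2 * D - 2 * \<theta>" by (intro diff_right_mono mult_left_mono tD) simp
    finally have "X \<le> 2 * D - 2 * \<theta>" .
    then show ?thesis using eq E D0 \<theta> by argo
  next
    case True
    have grow: "\<theta> / 4 \<le> D"
    proof -
      define t where "t = a / A"
      have t0: "0 < t" using A a by (simp add: t_def)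
      have "ln (b * A * \<theta>\<^sup>2) = q" using A b \<theta> by (simp add: q_def ln_mult ln_realpow)
      then have "b * A * \<theta>\<^sup>2 \<le> exp 1" using True A b \<theta> by (metis exp_le_cancel_iff exp_ln mult_pos_pos zero_less_power)
      also have "\<dots> \<le> 4" using exp_le by simp
      finally have "b * A * \<theta>\<^sup>2 \<le> 4" .
      moreover have "1 \<le> b * A * t\<^sup>2"
      proof -
        have "b * A * t\<^sup>2 = b * a\<^sup>2 / A" using A by (simp add: t_def power2_eq_square)
        also have "\<dots> = (A + a) / A" by (simp add: a)
        also have "\<dots> \<ge> 1" using A a by simp
        finally show ?thesis .
      qed
      ultimately have "b * A * \<theta>\<^sup>2 \<le> b * A * (4 * t\<^sup>2)" by linarith
      then have "\<theta>\<^sup>2 \<le> (2 * t)\<^sup>2" using A b by (simp add: power_mult_distrib)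
      then have "\<theta> \<le> 2 * t" by (rule power2_le_imp_le) (use t0 in simp)
      then have t: "\<theta> / 2 \<le> t" by simp
      have "D = ln (1 + t)"
      proof -
        have "D = ln ((A + a) / A)" using A a by (simp add: D_def ln_div)
        also have "(A + a) / A = 1 + t" using A by (simp add: t_def add_divide_distrib)
        finally show ?thesis .
      qed
      also have "ln (1 + t) \<ge> ln (1 + \<theta> / 2)" using t \<theta> by simp
      moreover have "ln (1 + \<theta> / 2) \<ge> \<theta> / 2 - (\<theta> / 2)\<^sup>2"
        using \<theta> by (intro ln_one_plus_pos_lower_bound) auto
      moreover have "(\<theta> / 2)\<^sup>2 \<le> \<theta> / 4"
        using \<theta> mult_left_mono[of \<theta> 1 \<theta>] by (simp add: power2_eq_square)
      ultimately show ?thesis by linarith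
    qed
    have "\<bar>q - 1 + D\<bar> - \<bar>q\<bar> \<le> D + 1" using abs by linarith
    then have "X \<le> 2 * \<theta> * (D + 1)" unfolding X_def using \<theta> by (intro mult_left_mono) auto
    also have "\<dots> = 2 * (\<theta> * D) + 2 * \<theta>" by (simp add: algebra_simps)
    also have "\<dots> \<le> 2 * D + 2 * \<theta>" by (intro add_right_mono mult_left_mono tD) simp
    finally have "X \<le> 2 * D + 2 * \<theta>" .
    then show ?thesis using grow eq E D0 \<theta> by argo
  qed
qed

text \<open>The mirror image of \<open>potential_down\<close>. If q \<le> -1, raising
  \<open>b\<close> shrinks the penalty. Otherwise b A \<theta>^2 \<ge> 1/e \<ge> 1/3, so the drop of
  the energy is at least \<theta>/48; the coefficient 144 turns it into 3\<theta>, which again pays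
  2\<theta> of penalty and \<theta> of progress.\<close>

lemma potential_up:
  assumes \<theta>: "0 < \<theta>" "\<theta> \<le> 1" and A: "0 < A" and b: "0 < b" and A': "A \<le> A'"
    and E: "E' \<le> E - b * A * \<theta> ^ 3 / 16"
  shows "potential \<theta> A E b + \<theta> \<le> potential \<theta> A' E' (b * exp 1)"
proof -
  define D where "D = ln A' - ln A"
  define q where "q = ln b + ln A + 2 * ln \<theta>"
  have D0: "0 \<le> D" using A A' by (simp add: D_def)
  have lb: "ln (b * exp 1) = ln b + 1" using b by (simp add: ln_mult)
  have q': "ln (b * exp 1) + ln A' + 2 * ln \<theta> = q + 1 + D"
    unfolding lb q_def D_def by simp
  define X where "X = 2 * \<theta> * (\<bar>q + 1 + D\<bar> - \<bar>q\<bar>)"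
  have eq: "potential \<theta> A' E' (b * exp 1) - potential \<theta> A E b
      = 14 * D + 144 * (E - E') - X"
    unfolding potential_def q' unfolding X_def q_def[symmetric] D_def by (simp add: algebra_simps)
  have abs: "\<bar>q + 1 + D\<bar> \<le> \<bar>q + 1\<bar> + D" using D0 by linarith
  have tD: "\<theta> * D \<le> D" using \<theta> D0 by (simp add: mult_left_le_one_le)
  have drop: "0 \<le> b * A * \<theta> ^ 3 / 16" using A b \<theta> by simp
  show ?thesis
  proof (cases "q \<le> - 1")
    case True
    then have "\<bar>q + 1 + D\<bar> - \<bar>q\<bar> \<le> D - 1" using abs by linarith
    then have "X \<le> 2 * \<theta> * (D - 1)" unfolding X_def using \<theta> by (intro mult_left_mono) auto
    also have "\<dots> = 2 * (\<theta> * D) - 2 * \<theta>" by (simp add: algebra_simps)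
    also have "\<dots> \<le> 2 * D - 2 * \<theta>" by (intro diff_right_mono mult_left_mono tD) simp
    finally have "X \<le> 2 * D - 2 * \<theta>" .
    then show ?thesis using eq E drop D0 \<theta> by argo
  next
    case False
    have "ln (b * A * \<theta>\<^sup>2) = q" using A b \<theta> by (simp add: q_def ln_mult ln_realpow)
    then have "exp (- 1) \<le> b * A * \<theta>\<^sup>2"
      using False A b \<theta> by (metis exp_le_cancel_iff exp_ln mult_pos_pos zero_less_power linorder_not_le less_imp_le)
    moreover have "1 / 3 \<le> exp (- 1 :: real)" using exp_le by (simp add: exp_minus field_simps)
    ultimately have "1 / 3 \<le> b * A * \<theta>\<^sup>2" by linarith
    then have "\<theta> * (1 / 3) \<le> \<theta> * (b * A * \<theta>\<^sup>2)" using \<theta> by (intro mult_left_mono) auto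
    then have dis: "\<theta> / 48 \<le> b * A * \<theta> ^ 3 / 16" by (simp add: power2_eq_square power3_eq_cube algebra_simps)
    have "\<bar>q + 1 + D\<bar> - \<bar>q\<bar> \<le> D + 1" using abs by linarith
    then have "X \<le> 2 * \<theta> * (D + 1)" unfolding X_def using \<theta> by (intro mult_left_mono) auto
    also have "\<dots> = 2 * (\<theta> * D) + 2 * \<theta>" by (simp add: algebra_simps)
    also have "\<dots> \<le> 2 * D + 2 * \<theta>" by (intro add_right_mono mult_left_mono tD) simp
    finally have "X \<le> 2 * D + 2 * \<theta>" .
    then show ?thesis using dis eq E D0 \<theta> by argo
  qed
qed

section \<open>The algorithm\<close>

lemma map_of_map_pair: "q \<in> set qs \<Longrightarrow> map_of (map (\<lambda>q. (q, g q)) qs) q = Some (g q)"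
  by (induction qs) auto

text \<open>\<open>Active x v A b\<close>: primal iterate, mirror iterate, accumulated weight, and current guess of the
  proximal parameter.\<close>

datatype state = Active vec vec real real | Done vec

locale accelerated_method =
  fixes d :: nat and \<sigma> \<eta> r \<delta> A\<^sub>0 b\<^sub>0 Amax :: real and K n m :: nat
begin

text \<open>Reads the seed as a three-dimensional array (group, sample, coordinate). The
  restrictions put the result into the extensional space of \<open>samples\<close>.\<close>

definition samples_of :: "seed \<Rightarrow> nat \<Rightarrow> nat \<Rightarrow> vec" where
  "samples_of \<omega> = (\<lambda>j\<in>{..<m}. \<lambda>i\<in>{..<n}. \<lambda>k\<in>{..<d}. \<omega> (prod_encode (j, prod_encode (i, k))))"

text \<open>The positive root of \<open>b a\<^sup>2 = A + a\<close>.\<close>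

definition increment :: "real \<Rightarrow> real \<Rightarrow> real" where
  "increment A b = (1 + sqrt (1 + 4 * b * A)) / (2 * b)"

definition query_centre :: "vec \<Rightarrow> vec \<Rightarrow> real \<Rightarrow> real \<Rightarrow> vec" where
  "query_centre x v A b = (\<lambda>i. (A * x i + increment A b * v i) / (A + increment A b))"

text \<open>A multiplier above the guess is handled by damping the step with \<gamma> = b/s, not by
  searching for a better guess. There are two reasons to stop: a small
  \<open>s * norm_d d (w - y)\<close> means that the smoothed gradient at \<open>w\<close> is small,
  and a large weight turns the energy bound into a bound on the gap.\<close>

definition next_state :: "vec \<Rightarrow> vec \<Rightarrow> real \<Rightarrow> real \<Rightarrow> vec \<Rightarrow> real \<Rightarrow> state" where
  "next_state x v A b w s = (let a = increment A b; y = query_centre x v A b;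
       \<gamma> = (if s \<le> b then 1 else b / s); A' = A + \<gamma> * a;
       x' = (\<lambda>i. ((1 - \<gamma>) * A * x i + \<gamma> * (A + a) * w i) / A');
       v' = (\<lambda>i. v i - \<gamma> * a * (s * (y i - w i)))
     in if s * norm_d d (\<lambda>i. w i - y i) < 4 * \<delta> then Done w
        else if Amax < A' then Done x'
        else Active x' v' A' (if s \<le> b then b / exp 1 else b * exp 1))"

fun step :: "(nat \<Rightarrow> nat \<Rightarrow> vec) \<Rightarrow> (vec \<Rightarrow> vec) \<Rightarrow> state \<Rightarrow> state" where
  "step z gr (Done p) = Done p"
| "step z gr (Active x v A b) =
    (case (SOME p. selection_ok d \<sigma> \<eta> K r \<delta> n m gr z (query_centre x v A b) p) of
       (w, s) \<Rightarrow> next_state x v A b w s)"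

fun queries :: "(nat \<Rightarrow> nat \<Rightarrow> vec) \<Rightarrow> state \<Rightarrow> vec list" where
  "queries z (Done p) = []"
| "queries z (Active x v A b) = concat (map (\<lambda>j. map (\<lambda>i l. round_d d \<eta> (query_centre x v A b) l + \<sigma> * z j i l) [0..<n]) [0..<m])"

definition init :: state where
  "init = Active (\<lambda>i. 0) (\<lambda>i. 0) A\<^sub>0 b\<^sub>0"

text \<open>A query rule sees only the seed and the history, so the state is recomputed by replaying
  all rounds, with each round's answers used as a lookup table for the oracle.\<close>

definition state_of :: "seed \<Rightarrow> history \<Rightarrow> state" where
  "state_of \<omega> h = foldl (\<lambda>s ans. step (samples_of \<omega>) (\<lambda>q. the (map_of ans q)) s) init h"

definition query :: "seed \<Rightarrow> history \<Rightarrow> vec list" where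
  "query \<omega> h = queries (samples_of \<omega>) (state_of \<omega> h)"

text \<open>The \<open>Active\<close> branch is a default; on good samples the final state is
  \<open>Done\<close>.\<close>

definition result :: "seed \<Rightarrow> history \<Rightarrow> vec" where
  "result \<omega> h = (case state_of \<omega> h of Done p \<Rightarrow> p | Active x v A b \<Rightarrow> x)"

definition iterate :: "(nat \<Rightarrow> nat \<Rightarrow> vec) \<Rightarrow> (vec \<Rightarrow> vec) \<Rightarrow> nat \<Rightarrow> state" where
  "iterate z gr k = (step z gr ^^ k) init"

lemma length_queries: "length (queries z s) \<le> m * n"
  by (cases s) (simp_all add: length_concat comp_def sum_list_triv)

lemma work_le: "work query grad d \<omega> D \<le> D * (m * n)"
proof -
  have "work query grad d \<omega> D \<le> (\<Sum>k<D. m * n)"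
    unfolding work_def query_def by (intro sum_mono length_queries)
  then show ?thesis by simp
qed

text \<open>The selection test evaluates the oracle only at the points queried in this round. Even
  the arbitrary choice made by \<open>SOME\<close> is therefore the same for two oracles that agree
  there.\<close>

lemma step_cong:
  assumes "\<And>q. q \<in> set (queries z s) \<Longrightarrow> gr q = gr' q"
  shows "step z gr s = step z gr' s"
proof (cases s)
  case (Active x v A b)
  let ?y = "query_centre x v A b"
  have "gmean d \<sigma> n gr (z j) (round_d d \<eta> ?y) w = gmean d \<sigma> n gr' (z j) (round_d d \<eta> ?y) w" if "j < m" for j w
  proof -
    have "gr (\<lambda>l. round_d d \<eta> ?y l + \<sigma> * z j i l) = gr' (\<lambda>l. round_d d \<eta> ?y l + \<sigma> * z j i l)" if "i < n" for i
      using \<open>j < m\<close> that by (intro assms) (force simp: Active)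
    then show ?thesis by (simp add: gmean_def)
  qed
  then have "selection_ok d \<sigma> \<eta> K r \<delta> n m gr z ?y = selection_ok d \<sigma> \<eta> K r \<delta> n m gr' z ?y"
    unfolding selection_ok_def by (simp cong: conj_cong)
  then show ?thesis by (simp add: Active)
qed simp

lemma state_of_transcript:
  "state_of \<omega> (transcript query grad d \<omega> k) = iterate (samples_of \<omega>) (\<lambda>q. grad (trunc_d d q)) k"
proof (induction k)
  case 0
  then show ?case by (simp add: state_of_def iterate_def)
next
  case (Suc k)
  let ?z = "samples_of \<omega>" and ?h = "transcript query grad d \<omega> k" and ?g = "\<lambda>q. grad (trunc_d d q)"
  let ?ans = "map (\<lambda>q. (q, ?g q)) (query \<omega> ?h)"
  have "state_of \<omega> (transcript query grad d \<omega> (Suc k)) = step ?z (\<lambda>q. the (map_of ?ans q)) (state_of \<omega> ?h)"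
    by (simp add: state_of_def Let_def)
  also have "\<dots> = step ?z ?g (state_of \<omega> ?h)"
    by (rule step_cong) (simp add: query_def map_of_map_pair)
  also have "\<dots> = iterate ?z ?g (Suc k)" by (simp add: Suc iterate_def)
  finally show ?case .
qed

lemma increment:
  assumes "0 < A" "0 < b"
  shows "0 < increment A b" "b * (increment A b)\<^sup>2 = A + increment A b"
proof -
  define q where "q = sqrt (1 + 4 * b * A)"
  have q: "0 \<le> q" "q\<^sup>2 = 1 + 4 * b * A" using assms by (simp_all add: q_def add_nonneg_nonneg)
  have a: "increment A b = (1 + q) / (2 * b)" by (simp add: increment_def q_def)
  show "0 < increment A b" unfolding a using assms q by (intro divide_pos_pos) auto
  have "b * (increment A b)\<^sup>2 = (1 + q)\<^sup>2 / (4 * b)"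
    unfolding a power_divide using assms by (simp add: power2_eq_square)
  also have "(1 + q)\<^sup>2 = 4 * b * A + 2 * (1 + q)" using q by (simp add: power2_eq_square algebra_simps)
  also have "\<dots> / (4 * b) = A + (1 + q) / (2 * b)" using assms by (simp add: field_simps)
  finally show "b * (increment A b)\<^sup>2 = A + increment A b" by (simp add: a)
qed

end

section \<open>Correctness and round count for a fixed good sample\<close>

text \<open>\<open>A\<^sub>0 = R / L\<close> makes the initial energy at most R^2 + R^2/2, and
  \<open>b\<^sub>0\<close> makes the initial penalty zero. The constant 864 is 144 * (3/2 + 9/2),
  where 3/2 and -9/2 bound the energy in units of R^2 from above at the start and from below at the
  end.\<close>

locale accelerated_analysis = smoothed_problem d L f grad \<sigma>
    + accelerated_method d \<sigma> \<eta> r \<delta> A\<^sub>0 b\<^sub>0 Amax K n m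
  for d L f grad \<sigma> \<eta> r \<delta> A\<^sub>0 b\<^sub>0 Amax K n m +
  fixes R \<epsilon> \<theta> :: real and u :: vec and T :: nat and z :: "nat \<Rightarrow> nat \<Rightarrow> vec"
  assumes R_pos: "0 < R" and \<epsilon>_pos: "0 < \<epsilon>" and r_pos: "0 < r" and \<eta>_pos: "0 < \<eta>" and \<delta>_pos: "0 < \<delta>"
    and u_Rd: "u \<in> Rd d" and u_min: "\<And>y. y \<in> Rd d \<Longrightarrow> f u \<le> f y" and u_norm: "norm_d d u \<le> R"
    and \<sigma>_small: "L * \<sigma> * sqrt (real d) \<le> \<epsilon> / 4"
    and r_\<sigma>: "4 * r \<le> \<sigma>"
    and \<theta>: "0 < \<theta>" "\<theta> \<le> 1" "\<theta> ^ 3 = (r / R)\<^sup>2"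
    and Amax: "Amax = 6 * R\<^sup>2 / \<epsilon>" and A0: "A\<^sub>0 = R / L" "A\<^sub>0 \<le> Amax" and b0: "b\<^sub>0 = 1 / (\<theta>\<^sup>2 * A\<^sub>0)"
    and \<delta>_small: "16 * R * \<delta> \<le> \<epsilon>" "10 * \<delta> * (4 * R + 2 * r * real T) \<le> \<epsilon>"
    and \<eta>_small: "sqrt (real d) * \<eta> \<le> r / 2" "(2 * L / \<sigma> + L / r) * (sqrt (real d) * \<eta>) \<le> \<delta> / 4"
    and K_large: "5 * R + 2 * r * real T + r \<le> \<eta> * (real K - 1)"
    and z_good: "z \<in> good_samples n m (\<delta> / 4) (lattice d \<eta> K)"
    and T_large: "14 * (ln Amax - ln A\<^sub>0) + 864 < real T * \<theta>"
begin

text \<open>The usual Lyapunov function of acceleration with the oracle error prepaid: a step loses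
  at most \<gamma> a \<delta> |v - u| \<le> 4 R \<delta> \<gamma> a, while \<open>A\<close>
  increases by \<gamma> a.\<close>

definition energy :: "vec \<Rightarrow> vec \<Rightarrow> real \<Rightarrow> real" where
  "energy x v A = A * (F x - F u) + (norm_d d (\<lambda>i. v i - u i))\<^sup>2 / 2 - 4 * R * \<delta> * A"

text \<open>The energy controls \<open>v\<close> but not \<open>x\<close>; the latter is only known
  to drift by at most \<open>2 * r\<close> per round, and the parameters allow for that. The last
  clause says that the potential gains \<theta> per round.\<close>

fun invariant :: "nat \<Rightarrow> state \<Rightarrow> bool" where
  "invariant t (Done p) \<longleftrightarrow> p \<in> Rd d \<and> f p - f u \<le> \<epsilon>"
| "invariant t (Active x v A b) \<longleftrightarrow> x \<in> Rd d \<and> v \<in> Rd d \<and> 0 < b \<and> 0 < A \<and> A \<le> Amax \<and>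
     norm_d d (\<lambda>i. x i - u i) \<le> 4 * R + 2 * r * real t \<and>
     energy x v A \<le> 3 / 2 * R\<^sup>2 \<and>
     14 * ln A\<^sub>0 - 216 + real t * \<theta> \<le> potential \<theta> A (energy x v A / R\<^sup>2) b"

lemma F_gap_lower: "x \<in> Rd d \<Longrightarrow> - \<epsilon> / 2 \<le> F x - F u"
  using F_close[of x] F_close[OF u_Rd] u_min[of x] \<sigma>_small by linarith

lemma f_gap_upper: "x \<in> Rd d \<Longrightarrow> F x - F u \<le> \<epsilon> / 2 \<Longrightarrow> f x - f u \<le> \<epsilon>"
  using F_close[of x] F_close[OF u_Rd] \<sigma>_small by linarith

text \<open>Since \<open>u\<close> minimizes \<open>f\<close> and not \<open>F\<close>, the gap
  \<open>F x - F u\<close> may be as low as -\<epsilon>/2. With A \<epsilon> \<le> 6 R^2 this and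
  the prepaid error cost at most 3 R^2 and (3/2) R^2, so |v - u|^2 \<le> 12 R^2.\<close>

lemma v_distance:
  assumes "x \<in> Rd d" "0 < A" "A \<le> Amax" "energy x v A \<le> 3 / 2 * R\<^sup>2"
  shows "norm_d d (\<lambda>i. v i - u i) \<le> 4 * R"
proof -
  have A\<epsilon>: "A * \<epsilon> \<le> 6 * R\<^sup>2" using assms(3) \<epsilon>_pos by (simp add: Amax field_simps)
  have "A * (- \<epsilon> / 2) \<le> A * (F x - F u)" using assms F_gap_lower by (intro mult_left_mono) auto
  moreover have "8 * R * \<delta> * A \<le> 3 * R\<^sup>2"
  proof -
    have "8 * R * \<delta> * A \<le> \<epsilon> / 2 * A" using \<delta>_small(1) assms by (intro mult_right_mono) auto
    also have "\<dots> \<le> 3 * R\<^sup>2" using A\<epsilon> by (simp add: mult.commute)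
    finally show ?thesis .
  qed
  ultimately have "(norm_d d (\<lambda>i. v i - u i))\<^sup>2 \<le> 12 * R\<^sup>2"
    using assms(4) A\<epsilon> unfolding energy_def by (simp only: mult.commute[of A])
  also have "\<dots> \<le> (4 * R)\<^sup>2" by (simp add: power_mult_distrib)
  finally show ?thesis by (rule power2_le_imp_le) (use R_pos in simp)
qed

lemma invariant_init: "invariant 0 init"
proof -
  have A0': "0 < A\<^sub>0" using A0 R_pos L_pos by simp
  have b0': "0 < b\<^sub>0" using A0' \<theta> by (simp add: b0)
  have nu: "norm_d d (\<lambda>i. 0 - u i) \<le> R" using u_norm by (simp add: norm_d_minus)
  have "F (\<lambda>i. 0) - F u \<le> L * R"
    using F_lipschitz[OF Rd_zero u_Rd] mult_left_mono[OF nu, of L] L_pos by linarith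
  then have "A\<^sub>0 * (F (\<lambda>i. 0) - F u) \<le> A\<^sub>0 * (L * R)" using A0' by (intro mult_left_mono) auto
  also have "\<dots> = R\<^sup>2" using L_pos by (simp add: A0 power2_eq_square)
  finally have "A\<^sub>0 * (F (\<lambda>i. 0) - F u) \<le> R\<^sup>2" .
  moreover have "(norm_d d (\<lambda>i. 0 - u i))\<^sup>2 \<le> R\<^sup>2" using nu by (intro power_mono) auto
  moreover have "0 \<le> 4 * R * \<delta> * A\<^sub>0" using R_pos \<delta>_pos A0' by simp
  ultimately have e: "energy (\<lambda>i. 0) (\<lambda>i. 0) A\<^sub>0 \<le> 3 / 2 * R\<^sup>2" unfolding energy_def by argo
  then have "energy (\<lambda>i. 0) (\<lambda>i. 0) A\<^sub>0 / R\<^sup>2 \<le> 3 / 2" using R_pos by (simp add: divide_le_eq)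
  moreover have "ln b\<^sub>0 + ln A\<^sub>0 + 2 * ln \<theta> = 0"
    using A0' \<theta> by (simp add: b0 ln_div ln_mult ln_realpow)
  ultimately have "14 * ln A\<^sub>0 - 216 \<le> potential \<theta> A\<^sub>0 (energy (\<lambda>i. 0) (\<lambda>i. 0) A\<^sub>0 / R\<^sup>2) b\<^sub>0"
    unfolding potential_def by simp
  then show ?thesis
    using A0' b0' A0(2) e nu R_pos by (simp add: init_def)
qed

lemma invariant_next_state:
  assumes inv: "invariant t (Active x v A b)" and t: "t < T"
    and sel: "selection_ok d \<sigma> \<eta> K r \<delta> n m qgrad z (query_centre x v A b) (w, s)"
    and acc: "norm_d d (\<lambda>k. G w k - s * (query_centre x v A b k - w k)) \<le> \<delta>"
  shows "invariant (Suc t) (next_state x v A b w s)"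
proof -
  define a where "a = increment A b"
  define y where "y = query_centre x v A b"
  define \<gamma> where "\<gamma> = (if s \<le> b then 1 else b / s)"
  define A' where "A' = A + \<gamma> * a"
  define x' where "x' = (\<lambda>i. ((1 - \<gamma>) * A * x i + \<gamma> * (A + a) * w i) / A')"
  define v' where "v' = (\<lambda>i. v i - \<gamma> * a * (s * (y i - w i)))"
  define b' where "b' = (if s \<le> b then b / exp 1 else b * exp 1)"
  define M where "M = norm_d d (\<lambda>i. w i - y i)"
  define Bt where "Bt = 4 * R + 2 * r * real t"
  have nxt: "next_state x v A b w s = (if s * M < 4 * \<delta> then Done w else if Amax < A' then Done x' else Active x' v' A' b')"
    unfolding next_state_def Let_def a_def[symmetric] y_def[symmetric] \<gamma>_def[symmetric]
      A'_def[symmetric] x'_def[symmetric] v'_def[symmetric] b'_def[symmetric] M_def[symmetric] ..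
  have x: "x \<in> Rd d" and v: "v \<in> Rd d" and b: "0 < b" and A: "0 < A" "A \<le> Amax"
    and xd: "norm_d d (\<lambda>i. x i - u i) \<le> Bt" and en: "energy x v A \<le> 3 / 2 * R\<^sup>2"
    and pot: "14 * ln A\<^sub>0 - 216 + real t * \<theta> \<le> potential \<theta> A (energy x v A / R\<^sup>2) b"
    using inv by (auto simp: Bt_def)
  have a: "0 < a" "b * a\<^sup>2 = A + a" unfolding a_def using increment[OF A(1) b] by auto
  have w: "w \<in> Rd d" and s: "0 \<le> s" and wy: "M \<le> 2 * r" and move: "s = 0 \<or> r / 2 \<le> M"
    using sel lattice_Rd by (auto simp: selection_ok_def y_def M_def)
  have yeq: "y = (\<lambda>i. (A * x i + a * v i) / (A + a))" by (simp add: y_def query_centre_def a_def)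
  have vd: "norm_d d (\<lambda>i. v i - u i) \<le> 4 * R" by (rule v_distance[OF x A en])
  have rt: "0 \<le> 2 * r * real t" using r_pos by simp
  have yd: "norm_d d (\<lambda>i. y i - u i) \<le> Bt"
    unfolding yeq using A a xd vd rt by (intro norm_d_convex_combination) (auto simp: Bt_def)
  have wd: "norm_d d (\<lambda>i. w i - u i) \<le> Bt + 2 * r"
    using norm_d_triangle_via[of d w u y] wy yd by (simp add: M_def)
  have acc': "norm_d d (\<lambda>k. G w k - s * (y k - w k)) \<le> \<delta>" using acc by (simp add: y_def)
  have \<gamma>: "0 < \<gamma>" "\<gamma> \<le> 1" "\<gamma> * s \<le> b" using b s by (auto simp: \<gamma>_def)
  have A': "0 < A'" "A \<le> A'" using A \<gamma> a by (auto simp: A'_def intro: add_pos_pos)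
  have x'R: "x' \<in> Rd d" using x w by (simp add: x'_def Rd_def)
  have v'R: "v' \<in> Rd d" using v w x by (simp add: v'_def yeq Rd_def)
  show ?thesis
  proof (cases "s * M < 4 * \<delta>")
    case True
    \<comment> \<open>The multiplier term is below 4\<delta> and the oracle error at most \<delta>,
      so |G w| \<le> 5\<delta>; the subgradient inequality and the drift bound then give a gap of at
      most \<epsilon>/2.\<close>
    have "norm_d d (G w) \<le> norm_d d (\<lambda>k. G w k - s * (y k - w k)) + norm_d d (\<lambda>k. s * (y k - w k))"
      using norm_d_triangle[of d "\<lambda>k. G w k - s * (y k - w k)" "\<lambda>k. s * (y k - w k)"] by simp
    also have "norm_d d (\<lambda>k. s * (y k - w k)) = s * M"
      unfolding norm_d_scale M_def using s norm_d_diff_commute[of d y w] by simp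
    finally have Gw: "norm_d d (G w) \<le> 5 * \<delta>" using acc' True by linarith
    have "F w - F u \<le> inner_d d (G w) (\<lambda>i. w i - u i)"
      using smoothed_first_order[OF w u_Rd] by (simp add: inner_d_diff_right)
    also have "\<dots> \<le> norm_d d (G w) * norm_d d (\<lambda>i. w i - u i)" by (rule inner_d_le)
    also have "\<dots> \<le> 5 * \<delta> * (4 * R + 2 * r * real T)"
    proof (rule mult_mono[OF Gw])
      have "2 * r * (real t + 1) \<le> 2 * r * real T" using t r_pos by (intro mult_left_mono) auto
      then show "norm_d d (\<lambda>i. w i - u i) \<le> 4 * R + 2 * r * real T"
        using wd by (simp add: Bt_def algebra_simps)
    qed (use \<delta>_pos in auto)
    also have "\<dots> \<le> \<epsilon> / 2" using \<delta>_small(2) by simp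
    finally have "f w - f u \<le> \<epsilon>" by (rule f_gap_upper[OF w])
    then show ?thesis using w True by (simp add: nxt)
  next
    case False
    then have big: "4 * \<delta> \<le> s * norm_d d (\<lambda>i. w i - y i)" by (simp add: M_def)
    have spos: "0 < s" using False s \<delta>_pos by (cases "s = 0") auto
    then have Mr: "r / 2 \<le> M" using move by auto
    have drop: "energy x' v' A' \<le> energy x v A - \<gamma> * (A + a) * s * M\<^sup>2 / 4"
    proof -
      have "A' * (F x' - F u) + (norm_d d (\<lambda>i. v' i - u i))\<^sup>2 / 2
         \<le> A * (F x - F u) + (norm_d d (\<lambda>i. v i - u i))\<^sup>2 / 2 + \<gamma> * a * \<delta> * norm_d d (\<lambda>i. v i - u i)
           - \<gamma> * (A + a) * s * M\<^sup>2 / 4"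
        unfolding A'_def M_def
        by (rule accelerated_step[OF x v w u_Rd A(1) b a s \<gamma> yeq acc' big x'_def[unfolded A'_def] v'_def])
      moreover have "\<gamma> * a * \<delta> * norm_d d (\<lambda>i. v i - u i) \<le> \<gamma> * a * \<delta> * (4 * R)"
        using vd \<gamma> a \<delta>_pos by (intro mult_left_mono) auto
      moreover have "4 * R * \<delta> * A' = 4 * R * \<delta> * A + \<gamma> * a * \<delta> * (4 * R)"
        by (simp add: A'_def algebra_simps)
      ultimately show ?thesis unfolding energy_def by linarith
    qed
    have drop0: "0 \<le> \<gamma> * (A + a) * s * M\<^sup>2 / 4" using \<gamma> A a s by simp
    have en': "energy x' v' A' \<le> 3 / 2 * R\<^sup>2" using drop drop0 en by linarith
    show ?thesis
    proof (cases "Amax < A'")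
      case True
      have "A' * (F x' - F u) \<le> 3 / 2 * R\<^sup>2 + 4 * R * \<delta> * A'"
        using en' zero_le_power2[of "norm_d d (\<lambda>i. v' i - u i)"] unfolding energy_def by linarith
      also have "\<dots> \<le> \<epsilon> / 4 * A' + \<epsilon> / 4 * A'"
      proof (rule add_mono)
        \<comment> \<open>\<open>Amax\<close> is 6 R^2/\<epsilon> precisely so that the energy bound
          costs a quarter of \<epsilon>; the prepaid error costs another quarter.\<close>
        show "3 / 2 * R\<^sup>2 \<le> \<epsilon> / 4 * A'" using True \<epsilon>_pos by (simp add: Amax field_simps)
        show "4 * R * \<delta> * A' \<le> \<epsilon> / 4 * A'" using \<delta>_small(1) A' by (intro mult_right_mono) auto
      qed
      also have "\<dots> = A' * (\<epsilon> / 2)" by simp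
      finally have "F x' - F u \<le> \<epsilon> / 2" using A' by (simp only: mult_le_cancel_left_pos)
      then have "f x' - f u \<le> \<epsilon>" by (rule f_gap_upper[OF x'R])
      then show ?thesis using x'R True False by (simp add: nxt)
    next
      case ntop: False
      have b'0: "0 < b'" using b by (simp add: b'_def)
      have x'd: "norm_d d (\<lambda>i. x' i - u i) \<le> 4 * R + 2 * r * real (Suc t)"
      proof -
        have "norm_d d (\<lambda>i. ((1 - \<gamma>) * A * x i + \<gamma> * (A + a) * w i) / ((1 - \<gamma>) * A + \<gamma> * (A + a)) - u i) \<le> Bt + 2 * r"
          using \<gamma> A a xd wd r_pos
          by (intro norm_d_convex_combination) (auto intro: add_nonneg_pos)
        moreover have "(1 - \<gamma>) * A + \<gamma> * (A + a) = A'" by (simp add: A'_def algebra_simps)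
        ultimately show ?thesis by (simp add: x'_def Bt_def algebra_simps)
      qed
      have "potential \<theta> A (energy x v A / R\<^sup>2) b + \<theta> \<le> potential \<theta> A' (energy x' v' A' / R\<^sup>2) b'"
      proof (cases "s \<le> b")
        case True
        then have "A' = A + a" "b' = b / exp 1" by (simp_all add: A'_def \<gamma>_def b'_def)
        moreover have "energy x' v' A' / R\<^sup>2 \<le> energy x v A / R\<^sup>2"
          using drop drop0 by (intro divide_right_mono) auto
        ultimately show ?thesis using potential_down[OF \<theta>(1,2) A(1) b a] by simp
      next
        case False
        then have \<gamma>s: "\<gamma> * s = b" and b': "b' = b * exp 1" using spos by (simp_all add: \<gamma>_def b'_def)
        \<comment> \<open>Here the damping makes \<open>\<gamma> * s = b\<close>, and a positive
          multiplier means that \<open>w\<close> has moved by at least \<open>r / 2\<close>. With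
          \<theta>^3 = (r/R)^2 this is the energy drop that \<open>potential_up\<close> asks
          for.\<close>
        have "b * A * r\<^sup>2 / 16 \<le> \<gamma> * (A + a) * s * M\<^sup>2 / 4"
        proof -
          have "(r / 2)\<^sup>2 \<le> M\<^sup>2" using Mr r_pos by (intro power_mono) auto
          then have "(b * A) * (r / 2)\<^sup>2 \<le> (b * (A + a)) * M\<^sup>2"
            using A a b by (intro mult_mono) auto
          also have "(b * (A + a)) * M\<^sup>2 = \<gamma> * (A + a) * s * M\<^sup>2" unfolding \<gamma>s[symmetric] by simp
          finally show ?thesis by (simp add: power_divide mult.commute mult.left_commute)
        qed
        then have "energy x' v' A' \<le> energy x v A - b * A * r\<^sup>2 / 16" using drop by linarith
        then have "energy x' v' A' / R\<^sup>2 \<le> (energy x v A - b * A * r\<^sup>2 / 16) / R\<^sup>2"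
          by (rule divide_right_mono) simp
        also have "\<dots> = energy x v A / R\<^sup>2 - b * A * \<theta> ^ 3 / 16"
          unfolding \<theta>(3) by (simp add: diff_divide_distrib power_divide)
        finally show ?thesis unfolding b' by (rule potential_up[OF \<theta>(1,2) A(1) b A'(2)])
      qed
      then have "14 * ln A\<^sub>0 - 216 + real (Suc t) * \<theta> \<le> potential \<theta> A' (energy x' v' A' / R\<^sup>2) b'"
        using pot by (simp add: algebra_simps)
      then show ?thesis
        using x'R v'R b'0 A' ntop x'd en' False by (simp add: nxt)
    qed
  qed
qed

lemma invariant_step:
  assumes inv: "invariant t s" and t: "t < T"
  shows "invariant (Suc t) (step z qgrad s)"
proof (cases s)
  case (Done p)
  then show ?thesis using inv by simp
next
  case (Active x v A b)
  let ?y = "query_centre x v A b"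
  have x: "x \<in> Rd d" and v: "v \<in> Rd d" and b: "0 < b" and A: "0 < A" "A \<le> Amax"
    and xd: "norm_d d (\<lambda>i. x i - u i) \<le> 4 * R + 2 * r * real t" and en: "energy x v A \<le> 3 / 2 * R\<^sup>2"
    using inv Active by auto
  have a: "0 < increment A b" using increment[OF A(1) b] by auto
  have yR: "?y \<in> Rd d" using x v by (simp add: query_centre_def Rd_def)
  have vd: "norm_d d (\<lambda>i. v i - u i) \<le> 4 * R" by (rule v_distance[OF x A en])
  have rt: "0 \<le> 2 * r * real t" "2 * r * real t \<le> 2 * r * real T"
    using r_pos t by (auto intro!: mult_left_mono)
  have "norm_d d (\<lambda>i. ?y i - u i) \<le> 4 * R + 2 * r * real t"
    unfolding query_centre_def using A a xd vd rt by (intro norm_d_convex_combination) auto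
  then have "norm_d d ?y \<le> 5 * R + 2 * r * real T"
    using norm_d_triangle[of d "\<lambda>i. ?y i - u i" u] u_norm rt by simp
  then have yb: "\<bar>?y i\<bar> + r \<le> \<eta> * (real K - 1)" if "i < d" for i
    using component_le_norm_d[OF that, of ?y] K_large by linarith
  obtain w s' where ws: "(SOME p. selection_ok d \<sigma> \<eta> K r \<delta> n m qgrad z ?y p) = (w, s')" by fastforce
  have sel: "selection_ok d \<sigma> \<eta> K r \<delta> n m qgrad z ?y (w, s')"
    unfolding ws[symmetric]
    by (rule someI_ex[OF selection_exists[OF z_good yR yb \<eta>_pos \<eta>_small(1) r_pos r_\<sigma> \<eta>_small(2)]])
  have "invariant (Suc t) (next_state x v A b w s')"
    by (rule invariant_next_state[OF inv[unfolded Active] t sel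
          selection_sound[OF z_good yR yb \<eta>_pos \<eta>_small(1) r_pos r_\<sigma> \<delta>_pos sel]])
  then show ?thesis by (simp add: Active ws)
qed

lemma invariant_iterate: "t \<le> T \<Longrightarrow> invariant t (iterate z qgrad t)"
proof (induction t)
  case 0
  then show ?case using invariant_init by (simp add: iterate_def)
next
  case (Suc t)
  then show ?case using invariant_step[of t "iterate z qgrad t"] by (simp add: iterate_def)
qed

text \<open>An active state after \<open>T\<close> rounds would have a potential above its maximum:
  the weight is at most \<open>Amax\<close> and the energy at least -(9/2) R^2.\<close>

lemma final_state: "\<exists>p\<in>Rd d. iterate z qgrad T = Done p \<and> f p - f u \<le> \<epsilon>"
proof (cases "iterate z qgrad T")
  case (Done p)
  then show ?thesis using invariant_iterate[of T] by simp
next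
  case (Active x v A b)
  have inv: "x \<in> Rd d" "0 < A" "A \<le> Amax"
    "14 * ln A\<^sub>0 - 216 + real T * \<theta> \<le> potential \<theta> A (energy x v A / R\<^sup>2) b"
    using invariant_iterate[of T] Active by auto
  have "A * \<epsilon> \<le> 6 * R\<^sup>2" using inv(3) \<epsilon>_pos by (simp add: Amax field_simps)
  moreover have "A * (- \<epsilon> / 2) \<le> A * (F x - F u)" using inv F_gap_lower by (intro mult_left_mono) auto
  moreover have "4 * R * \<delta> * A \<le> \<epsilon> / 4 * A" using \<delta>_small(1) inv by (intro mult_right_mono) auto
  ultimately have "- (9 / 2) * R\<^sup>2 \<le> energy x v A"
    using zero_le_power2[of "norm_d d (\<lambda>i. v i - u i)"] unfolding energy_def by (simp only: mult.commute[of A])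
  then have "- (9 / 2) \<le> energy x v A / R\<^sup>2" using R_pos by (simp add: le_divide_eq)
  moreover have "potential \<theta> A (energy x v A / R\<^sup>2) b \<le> 14 * ln A - 144 * (energy x v A / R\<^sup>2)"
    unfolding potential_def using \<theta> by simp
  moreover have "ln A \<le> ln Amax" using inv by simp
  ultimately have False using inv(4) T_large by argo
  then show ?thesis ..
qed

end

section \<open>Seeds and parameters\<close>

context accelerated_method
begin

text \<open>A right inverse of \<open>samples_of\<close> on the sample space; it transports the law
  of the samples to a law on plain sequences.\<close>

definition seed_of :: "(nat \<Rightarrow> nat \<Rightarrow> vec) \<Rightarrow> seed" where
  "seed_of z = (\<lambda>q. case prod_decode q of (j, p) \<Rightarrow> (case prod_decode p of (i, k) \<Rightarrow>
     if j < m \<and> i < n \<and> k < d then z j i k else 0))"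

definition seeds :: "seed measure" where
  "seeds = distr (samples d n m) borel seed_of"

lemma seed_of_measurable: "seed_of \<in> samples d n m \<rightarrow>\<^sub>M borel"
proof (rule measurable_coordinatewise_then_product)
  fix q
  obtain j i k where q: "q = prod_encode (j, prod_encode (i, k))"
    by (metis prod_decode_inverse surj_pair)
  show "(\<lambda>z. seed_of z q) \<in> borel_measurable (samples d n m)"
  proof (cases "j < m \<and> i < n \<and> k < d")
    case True
    have "(\<lambda>z. z j) \<in> samples d n m \<rightarrow>\<^sub>M PiM {..<n} (\<lambda>_. gauss d)"
      unfolding samples_def using True by (intro measurable_component_singleton) simp
    moreover have "(\<lambda>z. z i) \<in> PiM {..<n} (\<lambda>_. gauss d) \<rightarrow>\<^sub>M gauss d"
      using True by (intro measurable_component_singleton) simp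
    moreover have "(\<lambda>z. z k) \<in> borel_measurable (gauss d)"
      using True by (intro component_measurable_gauss) simp
    ultimately have "(\<lambda>z. z j i k) \<in> borel_measurable (samples d n m)"
      by (intro measurable_compose[of "\<lambda>z. z j i" _ "gauss d" "\<lambda>z. z k"]
          measurable_compose[of "\<lambda>z. z j" _ "PiM {..<n} (\<lambda>_. gauss d)" "\<lambda>z. z i"])
    then show ?thesis using True by (simp add: seed_of_def q)
  next
    case False
    then have "(\<lambda>z. seed_of z q) = (\<lambda>z. 0)" by (auto simp: seed_of_def q)
    then show ?thesis by simp
  qed
qed

lemma samples_of_measurable: "samples_of \<in> borel \<rightarrow>\<^sub>M samples d n m"
  unfolding samples_of_def samples_def gauss_def
proof (intro measurable_restrict)
  fix j i k
  have "(\<lambda>\<omega>::seed. \<omega> (prod_encode (j, prod_encode (i, k)))) \<in> borel_measurable borel"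
    by (intro borel_measurable_continuous_onI continuous_on_product_coordinates)
  then show "(\<lambda>\<omega>::seed. \<omega> (prod_encode (j, prod_encode (i, k)))) \<in> borel \<rightarrow>\<^sub>M std_normal"
    unfolding measurable_cong_sets[OF refl sets_std_normal] .
qed

lemma samples_of_seed_of:
  assumes "z \<in> space (samples d n m)"
  shows "samples_of (seed_of z) = z"
proof -
  have z: "z \<in> PiE {..<m} (\<lambda>_. PiE {..<n} (\<lambda>_. PiE {..<d} (\<lambda>_. UNIV)))"
    using assms by (simp add: samples_def gauss_def space_PiM)
  have "samples_of (seed_of z) j i k = z j i k" for j i k
  proof (cases "j < m")
    case jm: True
    then have zj: "z j \<in> PiE {..<n} (\<lambda>_. PiE {..<d} (\<lambda>_. UNIV))" by (intro PiE_mem[OF z]) simp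
    show ?thesis
    proof (cases "i < n")
      case True
      then have zji: "z j i \<in> PiE {..<d} (\<lambda>_. UNIV)" by (intro PiE_mem[OF zj]) simp
      show ?thesis using jm True PiE_arb[OF zji, of k]
        by (cases "k < d") (simp_all add: samples_of_def seed_of_def)
    next
      case False
      then show ?thesis using jm PiE_arb[OF zj, of i] by (simp add: samples_of_def)
    qed
  next
    case False
    then show ?thesis using PiE_arb[OF z, of j] by (simp add: samples_of_def)
  qed
  then show ?thesis by (intro ext)
qed

lemma prob_space_seeds: "prob_space seeds"
  unfolding seeds_def by (rule prob_space.prob_space_distr[OF prob_space_samples seed_of_measurable])

text \<open>Reading the samples back from the seed is the identity on the sample space, so events
  keep their probability.\<close>

lemma seeds_event:
  assumes "B \<in> sets (samples d n m)"
  shows "samples_of -` B \<in> sets seeds" "measure seeds (samples_of -` B) = measure (samples d n m) B"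
proof -
  have S: "samples_of -` B \<in> sets borel"
    using measurable_sets[OF samples_of_measurable assms] by simp
  then show "samples_of -` B \<in> sets seeds" by (simp add: seeds_def)
  have "seed_of -` (samples_of -` B) \<inter> space (samples d n m) = B"
    using samples_of_seed_of sets.sets_into_space[OF assms] by auto
  then show "measure seeds (samples_of -` B) = measure (samples d n m) B"
    unfolding seeds_def using measure_distr[OF seed_of_measurable S] by simp
qed

end

section \<open>Choice of the parameters\<close>

text \<open>2 * 935 * 16: a factor 2 from rounding \<open>T\<close> up, 935 from
  \<open>P \<le> 935 * \<Lambda>\<close>, and 16 as a bound for 16^(2/3).\<close>

definition depth_const :: real where "depth_const = 29920"

text \<open>The constants of \<open>T\<close>, of the group size \<open>n\<close> (769 and 74800
  squared, with 74800 = 80 * 935) and of the number \<open>m\<close> of groups (191).\<close>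

definition work_const :: real where "work_const = 29920 * 769 * 74800\<^sup>2 * 191"

lemma exists_parameters:
  fixes d :: nat and L R \<epsilon> \<nu> :: real
  assumes d: "0 < d" and L: "0 < L" and R: "0 < R" and \<epsilon>: "0 < \<epsilon>" and \<nu>: "0 < \<nu>" and \<kappa>1: "1 < L * R / \<epsilon>"
  obtains \<sigma> \<eta> r \<delta> \<theta> A\<^sub>0 b\<^sub>0 Amax :: real and K n m T :: nat where
    "0 < \<sigma>" "0 < r" "0 < \<eta>" "0 < \<delta>" "L * \<sigma> * sqrt (real d) \<le> \<epsilon> / 4" "4 * r \<le> \<sigma>"
    "0 < \<theta>" "\<theta> \<le> 1" "\<theta> ^ 3 = (r / R)\<^sup>2" "Amax = 6 * R\<^sup>2 / \<epsilon>" "A\<^sub>0 = R / L" "A\<^sub>0 \<le> Amax"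
    "b\<^sub>0 = 1 / (\<theta>\<^sup>2 * A\<^sub>0)" "16 * R * \<delta> \<le> \<epsilon>" "10 * \<delta> * (4 * R + 2 * r * real T) \<le> \<epsilon>"
    "sqrt (real d) * \<eta> \<le> r / 2" "(2 * L / \<sigma> + L / r) * (sqrt (real d) * \<eta>) \<le> \<delta> / 4"
    "5 * R + 2 * r * real T + r \<le> \<eta> * (real K - 1)"
    "14 * (ln Amax - ln A\<^sub>0) + 864 < real T * \<theta>"
    "48 * L\<^sup>2 / (\<delta> / 4)\<^sup>2 \<le> real n"
    "(real (2 * K + 1) ^ d)\<^sup>2 * (1 / 2) ^ m \<le> \<nu>"
    "real T \<le> depth_const * real d powr (1/3) * (L * R / \<epsilon>) powr (2/3) * polylog 4 d L R \<epsilon> \<nu>"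
    "real (T * (m * n)) \<le> work_const * real d powr (4/3) * (L * R / \<epsilon>) powr (8/3) * polylog 4 d L R \<epsilon> \<nu>"
proof -
  define \<kappa> where "\<kappa> = L * R / \<epsilon>"
  define X where "X = 2 + real d + L + R + 1 / L + 1 / R + \<epsilon> + 1 / \<epsilon> + 1 / \<nu>"
  define \<Lambda> where "\<Lambda> = 1 + ln X"
  define D where "D = sqrt (real d)"
  have \<kappa>: "1 < \<kappa>" using \<kappa>1 by (simp add: \<kappa>_def)
  have D1: "1 \<le> D" using d by (simp add: D_def)
  have DD: "D * D = real d" by (simp add: D_def)
  have d1: "1 \<le> real d" using d by simp
  have inv: "0 < 1 / L" "0 < 1 / R" "0 < 1 / \<epsilon>" "0 < 1 / \<nu>" using L R \<epsilon> \<nu> by auto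
  have \<nu>1: "0 < 1 + 1 / \<nu>" using inv by linarith
  have X: "2 \<le> X" "real d \<le> X" "L \<le> X" "R \<le> X" "1 / \<epsilon> \<le> X" "1 + 1 / \<nu> \<le> X"
    using L R \<epsilon> inv unfolding X_def by linarith+
  have \<Lambda>1: "1 \<le> \<Lambda>" using X by (simp add: \<Lambda>_def)
  have \<Lambda>X: "\<Lambda> \<le> X" using X ln_le_minus_one[of X] by (simp add: \<Lambda>_def)
  have \<kappa>X: "\<kappa> \<le> X ^ 3"
  proof -
    have "\<kappa> = L * R * (1 / \<epsilon>)" by (simp add: \<kappa>_def)
    also have "\<dots> \<le> X * X * X" using X L R inv by (intro mult_mono) auto
    finally show ?thesis by (simp add: power3_eq_cube)
  qed
  define \<sigma> where "\<sigma> = \<epsilon> / (4 * L * D)"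
  define r where "r = \<sigma> / 4"
  define \<theta> where "\<theta> = (r / R) powr (2/3)"
  \<comment> \<open>The number of rounds in units of 1/\<theta>; 865 in place of 864 provides the
    strict inequality.\<close>
  define P where "P = 14 * ln (6 * \<kappa>) + 865"
  define T where "T = nat \<lceil>P / \<theta>\<rceil>"
  \<comment> \<open>Chosen so that 10 \<delta> (4 R + 4 P R) = \<epsilon>, where 4 P R bounds the
    total drift \<open>2 * r * real T\<close>.\<close>
  define \<delta> where "\<delta> = \<epsilon> / (R * (40 + 40 * P))"
  \<comment> \<open>Since \<open>2 * L / \<sigma> + L / r = 3 * L / (2 * r)\<close>, this makes the
    rounding error in the KKT condition exactly \<delta>/4.\<close>
  define \<eta> where "\<eta> = \<delta> * r / (6 * L * D)"
  define K where "K = nat \<lceil>(6 + 4 * P) * R / \<eta>\<rceil> + 1"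
  define n where "n = nat \<lceil>48 * L\<^sup>2 / (\<delta> / 4)\<^sup>2\<rceil>"
  \<comment> \<open>Twice the logarithm of the number of lattice pairs times 1 + 1/\<nu>; the factor
    2 suffices because ln 2 \<ge> 1/2. The added 1 keeps the last logarithm nonnegative for every
    \<nu>.\<close>
  define m where "m = nat \<lceil>2 * (2 * real d * ln (real (2 * K + 1)) + ln (1 + 1 / \<nu>))\<rceil>"
  have D0: "0 < D" using D1 by simp
  have \<sigma>: "0 < \<sigma>" using \<epsilon> L D0 by (simp add: \<sigma>_def)
  then have r: "0 < r" by (simp add: r_def)
  have rR: "r / R = 1 / (16 * \<kappa> * D)" using L R \<epsilon> D0 by (simp add: r_def \<sigma>_def \<kappa>_def field_simps)
  have \<kappa>D: "1 \<le> 16 * \<kappa> * D" using \<kappa> D1 mult_mono[of 1 "16 * \<kappa>" 1 D] by simp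
  have "1 / q \<le> 1" if "1 \<le> q" for q :: real using that by simp
  from this[OF \<kappa>D] have rR1: "0 < r / R" "r / R \<le> 1" using r R unfolding rR[symmetric] by simp_all
  have "0 < \<theta>" unfolding \<theta>_def using r R by simp
  moreover have "\<theta> \<le> 1" unfolding \<theta>_def using rR1 by (intro powr_le1) auto
  ultimately have \<theta>: "0 < \<theta>" "\<theta> \<le> 1" by auto
  have \<theta>3: "\<theta> ^ 3 = (r / R)\<^sup>2"
  proof -
    have "(q powr (2/3)) ^ 3 = q\<^sup>2" if "0 < q" for q :: real
      using that by (simp add: powr_power powr_numeral)
    from this[OF rR1(1)] show ?thesis by (simp add: \<theta>_def)
  qed
  have r\<theta>: "r / R \<le> \<theta>"
  proof -
    have "(r / R) powr 1 \<le> (r / R) powr (2/3)" using rR1 by (intro powr_mono') auto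
    then show ?thesis using r R by (simp add: \<theta>_def)
  qed
  have ln6: "0 \<le> ln (6 * \<kappa>)" using \<kappa> by (intro ln_ge_zero) simp
  have P1: "865 \<le> P" using ln6 by (simp add: P_def)
  have P\<Lambda>: "P \<le> 935 * \<Lambda>"
  proof -
    have "ln (6 * \<kappa>) = ln 6 + ln \<kappa>" using \<kappa> by (simp add: ln_mult)
    moreover have "ln (6 :: real) \<le> 5" using ln_le_minus_one[of "6::real"] by simp
    moreover have "ln \<kappa> \<le> ln (X ^ 3)" using \<kappa>X \<kappa> X by (intro ln_mono) auto
    moreover have "ln (X ^ 3) = 3 * (\<Lambda> - 1)" using X by (simp add: ln_realpow \<Lambda>_def)
    ultimately show ?thesis using \<Lambda>1 unfolding P_def by argo
  qed
  have T\<theta>: "P \<le> real T * \<theta>"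
  proof -
    have "P / \<theta> \<le> real T" unfolding T_def by (rule real_nat_ceiling_ge)
    then show ?thesis using \<theta> by (simp add: field_simps)
  qed
  have TP: "real T \<le> 2 * P / \<theta>"
  proof -
    have "0 \<le> P / \<theta>" using P1 \<theta> by simp
    then have "real T \<le> P / \<theta> + 1" unfolding T_def by linarith
    also have "1 \<le> P / \<theta>" using P1 \<theta> by (simp add: field_simps)
    finally show ?thesis by simp
  qed
  have rT: "2 * r * real T \<le> 4 * P * R"
  proof -
    have "r * real T \<le> (\<theta> * R) * real T" using r\<theta> R by (intro mult_right_mono) (auto simp: field_simps)
    also have "\<dots> = (\<theta> * real T) * R" by simp
    also have "\<dots> \<le> (2 * P) * R" using TP \<theta> R by (intro mult_right_mono) (auto simp: field_simps)
    finally show ?thesis by simp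
  qed
  have \<delta>: "0 < \<delta>" using \<epsilon> R P1 by (simp add: \<delta>_def)
  have \<delta>R: "\<delta> * (R * (40 + 40 * P)) = \<epsilon>" using R P1 by (simp add: \<delta>_def)
  have L\<delta>: "L / \<delta> = \<kappa> * (40 + 40 * P)" using \<epsilon> R P1 by (simp add: \<delta>_def \<kappa>_def field_simps)
  have \<delta>L: "\<delta> \<le> L"
  proof -
    have "1 * 1 \<le> \<kappa> * (40 + 40 * P)" using \<kappa> P1 by (intro mult_mono) auto
    then have "1 \<le> L / \<delta>" by (simp add: L\<delta>)
    then show ?thesis using \<delta> by (simp add: field_simps)
  qed
  have \<eta>: "0 < \<eta>" using \<delta> r L D0 by (simp add: \<eta>_def)
  have D\<eta>: "D * \<eta> = \<delta> * r / (6 * L)" using D0 by (simp add: \<eta>_def)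
  have K: "(6 + 4 * P) * R \<le> \<eta> * (real K - 1)"
  proof -
    have "(6 + 4 * P) * R / \<eta> \<le> real K - 1"
      unfolding K_def using real_nat_ceiling_ge[of "(6 + 4 * P) * R / \<eta>"] by simp
    then show ?thesis using \<eta> by (simp add: field_simps)
  qed
  \<comment> \<open>Only polynomial growth in \<open>X\<close> matters, as ln K must be of order
    \<Lambda>. Numerical factors are absorbed into powers of \<open>X\<close> by X \<ge> 2: 153605
    \<le> 2^18, and 2^38 X^9 \<le> X^47.\<close>
  have KX: "real (2 * K + 1) \<le> X ^ 47"
  proof -
    have "R / \<eta> = 6 * D * (L / \<delta>) / (r / R)" using D0 R \<delta> r by (simp add: \<eta>_def)
    also have "\<dots> = 96 * (D * D) * \<kappa>\<^sup>2 * (40 + 40 * P)" unfolding L\<delta> rR by (simp add: power2_eq_square)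
    finally have R\<eta>: "R / \<eta> = 96 * real d * \<kappa>\<^sup>2 * (40 + 40 * P)" unfolding DD .
    have y0: "0 \<le> (6 + 4 * P) * (R / \<eta>)" using P1 R \<eta> by simp
    have dk1: "1 \<le> real d * \<kappa>\<^sup>2" using d1 \<kappa> mult_mono[of 1 "real d" 1 "\<kappa>\<^sup>2"] by (simp add: one_le_power)
    have PP1: "1 \<le> P\<^sup>2" using P1 by (simp add: one_le_power)
    have "real (2 * K + 1) \<le> 2 * ((6 + 4 * P) * (R / \<eta>)) + 5"
      using y0 unfolding K_def by (simp add: mult.commute) linarith
    also have "(6 + 4 * P) * (R / \<eta>) \<le> (10 * P) * (96 * real d * \<kappa>\<^sup>2 * (80 * P))"
      unfolding R\<eta> using P1 by (intro mult_mono) auto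
    also have "2 * ((10 * P) * (96 * real d * \<kappa>\<^sup>2 * (80 * P))) + 5 \<le> 153605 * (P\<^sup>2 * (real d * \<kappa>\<^sup>2))"
    proof -
      have "1 \<le> P\<^sup>2 * (real d * \<kappa>\<^sup>2)" using mult_mono[OF PP1 dk1] by simp
      then show ?thesis by (simp add: power2_eq_square algebra_simps)
    qed
    also have "\<dots> \<le> 2 ^ 18 * ((2 ^ 10 * X)\<^sup>2 * (X * (X ^ 3)\<^sup>2))"
    proof (intro mult_mono power_mono)
      show "P \<le> 2 ^ 10 * X" using P\<Lambda> \<Lambda>X \<Lambda>1 by simp
    qed (use \<kappa>X X \<kappa> P1 in auto)
    also have "\<dots> = 2 ^ 38 * X ^ 9" by (simp add: power_mult_distrib power_mult[symmetric] power_add[symmetric] flip: power_Suc power_Suc2)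
    also have "\<dots> \<le> X ^ 38 * X ^ 9" using X by (intro mult_right_mono power_mono) auto
    also have "\<dots> = X ^ 47" by (simp flip: power_add)
    finally show ?thesis by simp
  qed
  have lnK: "0 \<le> ln (real (2 * K + 1))" "ln (real (2 * K + 1)) \<le> 47 * \<Lambda>"
  proof -
    show "0 \<le> ln (real (2 * K + 1))" by (intro ln_ge_zero) simp
    have "ln (real (2 * K + 1)) \<le> ln (X ^ 47)" using KX X by (intro ln_mono) auto
    also have "\<dots> = 47 * (\<Lambda> - 1)" using X by (simp add: ln_realpow \<Lambda>_def)
    finally show "ln (real (2 * K + 1)) \<le> 47 * \<Lambda>" by simp
  qed
  have ln\<nu>: "0 \<le> ln (1 + 1 / \<nu>)" "ln (1 + 1 / \<nu>) \<le> \<Lambda>"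
  proof -
    show "0 \<le> ln (1 + 1 / \<nu>)" using inv by (intro ln_ge_zero) simp
    have "ln (1 + 1 / \<nu>) \<le> ln X" by (rule ln_mono[OF X(6) \<nu>1])
    then show "ln (1 + 1 / \<nu>) \<le> \<Lambda>" by (simp add: \<Lambda>_def)
  qed
  have mle: "real m \<le> 191 * (real d * \<Lambda>)"
  proof -
    have "0 \<le> 2 * (2 * real d * ln (real (2 * K + 1)) + ln (1 + 1 / \<nu>))" using lnK ln\<nu> by simp
    then have "real m \<le> 2 * (2 * real d * ln (real (2 * K + 1)) + ln (1 + 1 / \<nu>)) + 1"
      unfolding m_def by linarith
    also have "\<dots> \<le> 2 * (2 * real d * (47 * \<Lambda>) + \<Lambda>) + 1"
      using lnK ln\<nu> by (intro add_mono mult_left_mono) auto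
    also have "\<dots> \<le> 191 * (real d * \<Lambda>)"
    proof -
      have "\<Lambda> \<le> real d * \<Lambda>" using d1 \<Lambda>1 mult_right_mono[of 1 "real d" \<Lambda>] by simp
      moreover have "2 * (2 * real d * (47 * \<Lambda>) + \<Lambda>) + 1 = 188 * (real d * \<Lambda>) + 2 * \<Lambda> + 1" by simp
      ultimately show ?thesis using \<Lambda>1 by argo
    qed
    finally show ?thesis .
  qed
  have m: "(real (2 * K + 1) ^ d)\<^sup>2 * (1 / 2) ^ m \<le> \<nu>"
  proof -
    let ?k = "real (2 * K + 1)"
    have "2 * (2 * real d * ln ?k + ln (1 + 1 / \<nu>)) \<le> real m"
      unfolding m_def by (rule real_nat_ceiling_ge)
    then have "2 * real d * ln ?k + ln (1 + 1 / \<nu>) \<le> real m * (1 / 2)" by argo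
    also have "\<dots> \<le> real m * ln 2"
      using ln2_ge_two_thirds by (intro mult_left_mono) auto
    finally have "exp (real (2 * d) * ln ?k + ln (1 + 1 / \<nu>)) \<le> exp (real m * ln 2)" by simp
    then have "?k ^ (2 * d) * (1 + 1 / \<nu>) \<le> 2 ^ m"
      unfolding exp_add exp_of_nat_mult using \<nu>1 by simp
    then have "?k ^ (2 * d) * (1 / \<nu>) \<le> 2 ^ m" by (smt (verit) mult_left_mono zero_le_power of_nat_0_le_iff)
    then have "?k ^ (2 * d) \<le> \<nu> * 2 ^ m" using \<nu> by (simp add: field_simps)
    then have "?k ^ (2 * d) * (1 / 2) ^ m \<le> \<nu> * 2 ^ m * (1 / 2) ^ m" by (intro mult_right_mono) auto
    also have "\<dots> = \<nu>" by (simp add: power_one_over)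
    finally show ?thesis by (simp add: power_mult[symmetric] mult.commute)
  qed
  have nle: "real n \<le> 769 * 74800\<^sup>2 * (\<kappa>\<^sup>2 * \<Lambda>\<^sup>2)"
  proof -
    have e: "48 * L\<^sup>2 / (\<delta> / 4)\<^sup>2 = 768 * (\<kappa> * (40 + 40 * P))\<^sup>2"
      unfolding L\<delta>[symmetric] using \<delta> by (simp add: power_divide)
    have "0 \<le> 768 * (\<kappa> * (40 + 40 * P))\<^sup>2" by simp
    then have "real n \<le> 768 * (\<kappa> * (40 + 40 * P))\<^sup>2 + 1" unfolding n_def e by linarith
    also have "\<dots> \<le> 769 * (\<kappa> * (40 + 40 * P))\<^sup>2"
    proof -
      have "1 * 1 \<le> \<kappa> * (40 + 40 * P)" using \<kappa> P1 by (intro mult_mono) auto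
      then have "1 \<le> (\<kappa> * (40 + 40 * P))\<^sup>2" by (simp add: one_le_power)
      then show ?thesis by linarith
    qed
    also have "\<dots> \<le> 769 * (\<kappa> * (74800 * \<Lambda>))\<^sup>2"
      using \<kappa> P1 P\<Lambda> by (intro mult_left_mono power_mono) auto
    finally show ?thesis by (simp add: power_mult_distrib algebra_simps)
  qed
  have Tle: "real T \<le> 29920 * (real d powr (1/3) * \<kappa> powr (2/3) * \<Lambda>)"
  proof -
    have "1 / \<theta> = (16 * \<kappa> * D) powr (2/3)"
      unfolding \<theta>_def rR using \<kappa>D by (simp add: powr_divide)
    also have "\<dots> = 16 powr (2/3) * \<kappa> powr (2/3) * D powr (2/3)"
      using \<kappa> D0 by (simp add: powr_mult)
    also have "D powr (2/3) = real d powr (1/3)"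
      using d1 by (simp add: D_def powr_half_sqrt[symmetric] powr_powr)
    also have "16 powr (2/3) * \<kappa> powr (2/3) * real d powr (1/3) \<le> 16 * \<kappa> powr (2/3) * real d powr (1/3)"
      using powr_mono[of "2/3" 1 "16::real"] by (intro mult_right_mono) auto
    finally have th: "1 / \<theta> \<le> 16 * \<kappa> powr (2/3) * real d powr (1/3)" .
    have "real T \<le> 2 * P * (1 / \<theta>)" using TP by simp
    also have "\<dots> \<le> 2 * (935 * \<Lambda>) * (16 * \<kappa> powr (2/3) * real d powr (1/3))"
      using th P\<Lambda> P1 \<theta> \<Lambda>1 by (intro mult_mono) auto
    finally show ?thesis by (simp add: algebra_simps)
  qed
  \<comment> \<open>The exponent 4 collects one logarithm each from \<open>T\<close> and
    \<open>m\<close> and two from \<open>n\<close>.\<close>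
  have pl: "polylog 4 d L R \<epsilon> \<nu> = \<Lambda> ^ 4" by (simp add: polylog_def \<Lambda>_def X_def)
  have depth: "real T \<le> depth_const * real d powr (1/3) * (L * R / \<epsilon>) powr (2/3) * polylog 4 d L R \<epsilon> \<nu>"
  proof -
    have "\<Lambda> \<le> \<Lambda> ^ 4" using \<Lambda>1 self_le_power[of \<Lambda> 4] by simp
    then have "29920 * (real d powr (1/3) * \<kappa> powr (2/3) * \<Lambda>) \<le> 29920 * (real d powr (1/3) * \<kappa> powr (2/3) * \<Lambda> ^ 4)"
      by (intro mult_left_mono) auto
    then show ?thesis using Tle unfolding pl \<kappa>_def[symmetric] depth_const_def by (simp add: mult.assoc)
  qed
  have work: "real (T * (m * n)) \<le> work_const * real d powr (4/3) * (L * R / \<epsilon>) powr (8/3) * polylog 4 d L R \<epsilon> \<nu>"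
  proof -
    have "real (T * (m * n)) = real T * (real m * real n)" by simp
    also have "\<dots> \<le> 29920 * (real d powr (1/3) * \<kappa> powr (2/3) * \<Lambda>) *
        ((191 * (real d * \<Lambda>)) * (769 * 74800\<^sup>2 * (\<kappa>\<^sup>2 * \<Lambda>\<^sup>2)))"
      using Tle mle nle \<Lambda>1 by (intro mult_mono) auto
    also have "\<dots> = work_const * (real d powr (1/3) * real d) * (\<kappa> powr (2/3) * \<kappa>\<^sup>2) * \<Lambda> ^ 4"
      unfolding work_const_def by (simp add: power2_eq_square power4_eq_xxxx)
    also have "real d powr (1/3) * real d = real d powr (4/3)"
      using d1 powr_add[of "real d" "1/3" 1] by simp
    also have "\<kappa> powr (2/3) * \<kappa>\<^sup>2 = \<kappa> powr (8/3)"
      using \<kappa> powr_add[of \<kappa> "2/3" 2] by (simp add: powr_numeral)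
    finally show ?thesis unfolding pl \<kappa>_def[symmetric] .
  qed
  have lnA: "ln (6 * R\<^sup>2 / \<epsilon>) - ln (R / L) = ln (6 * \<kappa>)"
  proof -
    have "6 * \<kappa> = (6 * R\<^sup>2 / \<epsilon>) / (R / L)" using R L by (simp add: \<kappa>_def power2_eq_square field_simps)
    moreover have "ln ((6 * R\<^sup>2 / \<epsilon>) / (R / L)) = ln (6 * R\<^sup>2 / \<epsilon>) - ln (R / L)"
      by (subst ln_div) (use R L \<epsilon> in auto)
    ultimately show ?thesis by simp
  qed
  show ?thesis
  proof (rule that[of \<sigma> r \<eta> \<delta> \<theta> "6 * R\<^sup>2 / \<epsilon>" "R / L" "1 / (\<theta>\<^sup>2 * (R / L))" T K n m])
    show "L * \<sigma> * sqrt (real d) \<le> \<epsilon> / 4" unfolding D_def[symmetric] using L D0 by (simp add: \<sigma>_def)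
    show "R / L \<le> 6 * R\<^sup>2 / \<epsilon>"
    proof -
      have "R / L * 1 \<le> R / L * (6 * \<kappa>)" using \<kappa> R L by (intro mult_left_mono) auto
      also have "\<dots> = 6 * R\<^sup>2 / \<epsilon>" using L by (simp add: \<kappa>_def power2_eq_square)
      finally show ?thesis by simp
    qed
    show "16 * R * \<delta> \<le> \<epsilon>"
    proof -
      have "(\<delta> * R) * 16 \<le> (\<delta> * R) * (40 + 40 * P)" using \<delta> R P1 by (intro mult_left_mono) auto
      then show ?thesis using \<delta>R by (simp add: algebra_simps)
    qed
    show "10 * \<delta> * (4 * R + 2 * r * real T) \<le> \<epsilon>"
    proof -
      have "10 * \<delta> * (4 * R + 2 * r * real T) \<le> 10 * \<delta> * (4 * R + 4 * P * R)"
        using rT \<delta> by (intro mult_left_mono add_left_mono) auto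
      also have "\<dots> = \<delta> * (R * (40 + 40 * P))" by (simp add: algebra_simps)
      finally show ?thesis unfolding \<delta>R .
    qed
    show "sqrt (real d) * \<eta> \<le> r / 2"
    proof -
      have "\<delta> * r \<le> L * r" using \<delta>L r by (intro mult_right_mono) auto
      also have "\<dots> \<le> r / 2 * (6 * L)" using L r by simp
      finally show ?thesis unfolding D_def[symmetric] D\<eta> using L by (simp add: pos_divide_le_eq mult.commute mult.left_commute)
    qed
    show "(2 * L / \<sigma> + L / r) * (sqrt (real d) * \<eta>) \<le> \<delta> / 4"
    proof -
      have "2 * L / \<sigma> + L / r = 3 * L / (2 * r)" using \<sigma> by (simp add: r_def field_simps)
      then show ?thesis unfolding D_def[symmetric] D\<eta> using L r by simp
    qed
    show "5 * R + 2 * r * real T + r \<le> \<eta> * (real K - 1)"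
    proof -
      have "r \<le> R" using rR1 R by (simp add: field_simps)
      then show ?thesis using K rT by (simp add: algebra_simps)
    qed
    show "14 * (ln (6 * R\<^sup>2 / \<epsilon>) - ln (R / L)) + 864 < real T * \<theta>"
      using T\<theta> unfolding lnA P_def by linarith
    show "48 * L\<^sup>2 / (\<delta> / 4)\<^sup>2 \<le> real n" unfolding n_def by (rule real_nat_ceiling_ge)
  qed (use \<sigma> r \<eta> \<delta> \<theta> \<theta>3 m depth work in \<open>simp_all add: r_def\<close>)
qed

section \<open>Degenerate parameters and assembly\<close>

definition solves :: "real \<Rightarrow> nat \<Rightarrow> nat \<Rightarrow> real \<Rightarrow> real \<Rightarrow> real \<Rightarrow> real \<Rightarrow>
    seed measure \<times> nat \<times> (seed \<Rightarrow> history \<Rightarrow> vec list) \<times> (seed \<Rightarrow> history \<Rightarrow> vec) \<Rightarrow> bool" where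
  "solves C k d L R \<epsilon> \<nu> p = (case p of (M, D, Q, out) \<Rightarrow>
          prob_space M \<and>
          real D \<le> C * real d powr (1/3) * (L * R / \<epsilon>) powr (2/3) * polylog k d L R \<epsilon> \<nu> \<and>
          (\<forall>f xstar grad.
             differentiable_d d f \<and> lipschitz_d d L f \<and> convex_d d f \<and>
             xstar \<in> Rd d \<and> (\<forall>y\<in>Rd d. f xstar \<le> f y) \<and> norm_d d xstar \<le> R \<and>
             (\<forall>x\<in>Rd d. has_gradient_d d f (grad x) x) \<longrightarrow>
               (\<forall>\<omega>\<in>space M. real (work Q grad d \<omega> D)
                  \<le> C * real d powr (4/3) * (L * R / \<epsilon>) powr (8/3) * polylog k d L R \<epsilon> \<nu>) \<and>
               (\<exists>S\<in>sets M. measure M S \<ge> 1 - \<nu> \<and>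
                  (\<forall>\<omega>\<in>S. f (trunc_d d (out \<omega> (transcript Q grad d \<omega> D))) - f xstar \<le> \<epsilon>))))"

text \<open>The even exponent keeps this true for negative \<open>L\<close> or \<open>R\<close>, where the argument of the logarithm is
  meaningless.\<close>

lemma polylog_even_nonneg: "0 \<le> polylog 4 d L R \<epsilon> \<nu>"
  by (simp add: polylog_def)

text \<open>For small L R / \<epsilon> the depth bound may not allow even one round. The origin is
  then already accurate enough, because |x*| \<le> R bounds its gap by L R \<le> \<epsilon>; for d =
  0 or nonpositive \<open>L\<close> or \<open>R\<close> the Lipschitz bound leaves no positive
  gap.\<close>

lemma solves_trivial:
  assumes \<epsilon>: "0 < \<epsilon>" and \<nu>: "0 < \<nu>" and triv: "\<not> (0 < d \<and> 0 < L \<and> 0 < R \<and> 1 < L * R / \<epsilon>)"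
  shows "solves work_const 4 d L R \<epsilon> \<nu> (return borel (\<lambda>_. 0), 0, \<lambda>_ _. [], \<lambda>_ _ _. 0)"
proof -
  let ?M = "return borel (\<lambda>_. 0) :: seed measure"
  interpret M: prob_space ?M by (rule prob_space_return) simp
  have C: "0 \<le> work_const" by (simp add: work_const_def)
  have gap: "f (\<lambda>_. 0) - f u \<le> \<epsilon>"
    if f: "lipschitz_d d L f" and u: "u \<in> Rd d" "norm_d d u \<le> R" for f and u :: vec
  proof -
    have "\<bar>f (\<lambda>_. 0) - f u\<bar> \<le> L * norm_d d (\<lambda>i. 0 - u i)"
      using f Rd_zero[of d] u(1) unfolding lipschitz_d_def by blast
    then have "f (\<lambda>_. 0) - f u \<le> L * norm_d d u"
      by (simp add: norm_d_minus)
    also have "\<dots> \<le> \<epsilon>"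
    proof (cases "0 < L \<and> 0 < d")
      case True
      then have "L * norm_d d u \<le> L * R" using u by (intro mult_left_mono) auto
      also have "\<dots> \<le> \<epsilon>"
      proof (cases "0 < R")
        case True
        then show ?thesis using triv \<open>0 < L \<and> 0 < d\<close> \<epsilon> by (simp add: field_simps)
      next
        case False
        then have "L * R \<le> 0" using True by (simp add: mult_le_0_iff)
        then show ?thesis using \<epsilon> by simp
      qed
      finally show ?thesis .
    next
      case False
      then have "L * norm_d d u \<le> 0"
      proof (cases "d = 0")
        case True
        then show ?thesis by (simp add: norm_d_def inner_d_def)
      qed (simp add: mult_le_0_iff)
      then show ?thesis using \<epsilon> by simp
    qed
    finally show ?thesis .
  qed
  have "measure ?M (space ?M) = 1" by (rule M.prob_space)
  then have S: "\<exists>S\<in>sets ?M. 1 - \<nu> \<le> measure ?M S \<and> (\<forall>\<omega>\<in>S. f (trunc_d d (\<lambda>_. 0)) - f u \<le> \<epsilon>)"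
    if "lipschitz_d d L f" "u \<in> Rd d" "norm_d d u \<le> R" for f u
    using gap[OF that] \<nu> by (intro bexI[of _ "space ?M"]) (auto simp: trunc_d_id)
  show ?thesis
    unfolding solves_def prod.case
  proof (intro conjI allI impI ballI)
    show "prob_space ?M" by (rule M.prob_space_axioms)
  next
    fix f xstar grad
    assume "differentiable_d d f \<and> lipschitz_d d L f \<and> convex_d d f \<and>
       xstar \<in> Rd d \<and> (\<forall>y\<in>Rd d. f xstar \<le> f y) \<and> norm_d d xstar \<le> R \<and>
       (\<forall>x\<in>Rd d. has_gradient_d d f (grad x) x)"
    then show "\<exists>S\<in>sets ?M. 1 - \<nu> \<le> measure ?M S \<and> (\<forall>\<omega>\<in>S. f (trunc_d d (\<lambda>_. 0)) - f xstar \<le> \<epsilon>)"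
      by (intro S) auto
  qed (use C polylog_even_nonneg in \<open>simp_all add: work_def\<close>)
qed

lemma solves_nontrivial:
  assumes \<epsilon>: "0 < \<epsilon>" and \<nu>: "0 < \<nu>" and d: "0 < d" and L: "0 < L" and R: "0 < R" and \<kappa>: "1 < L * R / \<epsilon>"
  shows "\<exists>p. solves work_const 4 d L R \<epsilon> \<nu> p"
proof -
  obtain \<sigma> \<eta> r \<delta> \<theta> A\<^sub>0 b\<^sub>0 Amax :: real and K n m T :: nat where par:
    "0 < \<sigma>" "0 < r" "0 < \<eta>" "0 < \<delta>" "L * \<sigma> * sqrt (real d) \<le> \<epsilon> / 4" "4 * r \<le> \<sigma>"
    "0 < \<theta>" "\<theta> \<le> 1" "\<theta> ^ 3 = (r / R)\<^sup>2" "Amax = 6 * R\<^sup>2 / \<epsilon>" "A\<^sub>0 = R / L" "A\<^sub>0 \<le> Amax"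
    "b\<^sub>0 = 1 / (\<theta>\<^sup>2 * A\<^sub>0)" "16 * R * \<delta> \<le> \<epsilon>" "10 * \<delta> * (4 * R + 2 * r * real T) \<le> \<epsilon>"
    "sqrt (real d) * \<eta> \<le> r / 2" "(2 * L / \<sigma> + L / r) * (sqrt (real d) * \<eta>) \<le> \<delta> / 4"
    "5 * R + 2 * r * real T + r \<le> \<eta> * (real K - 1)"
    "14 * (ln Amax - ln A\<^sub>0) + 864 < real T * \<theta>"
    and n: "48 * L\<^sup>2 / (\<delta> / 4)\<^sup>2 \<le> real n"
    and m: "(real (2 * K + 1) ^ d)\<^sup>2 * (1 / 2) ^ m \<le> \<nu>"
    and T: "real T \<le> depth_const * real d powr (1/3) * (L * R / \<epsilon>) powr (2/3) * polylog 4 d L R \<epsilon> \<nu>"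
    and W: "real (T * (m * n)) \<le> work_const * real d powr (4/3) * (L * R / \<epsilon>) powr (8/3) * polylog 4 d L R \<epsilon> \<nu>"
    using exists_parameters[OF d L R \<epsilon> \<nu> \<kappa>] by metis
  interpret alg: accelerated_method d \<sigma> \<eta> r \<delta> A\<^sub>0 b\<^sub>0 Amax K n m .
  \<comment> \<open>One constant has to serve depth and work, and \<open>work_const\<close> is the
    larger.\<close>
  have T': "real T \<le> work_const * real d powr (1/3) * (L * R / \<epsilon>) powr (2/3) * polylog 4 d L R \<epsilon> \<nu>"
  proof (rule order_trans[OF T])
    show "depth_const * real d powr (1/3) * (L * R / \<epsilon>) powr (2/3) * polylog 4 d L R \<epsilon> \<nu>
        \<le> work_const * real d powr (1/3) * (L * R / \<epsilon>) powr (2/3) * polylog 4 d L R \<epsilon> \<nu>"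
      using polylog_even_nonneg by (intro mult_right_mono) (auto simp: depth_const_def work_const_def)
  qed
  have work: "real (work alg.query grad d \<omega> T)
      \<le> work_const * real d powr (4/3) * (L * R / \<epsilon>) powr (8/3) * polylog 4 d L R \<epsilon> \<nu>" for grad \<omega>
  proof -
    have "real (work alg.query grad d \<omega> T) \<le> real (T * (m * n))" using alg.work_le of_nat_le_iff by blast
    then show ?thesis using W by linarith
  qed
  have acc: "\<exists>S\<in>sets alg.seeds. 1 - \<nu> \<le> measure alg.seeds S \<and>
      (\<forall>\<omega>\<in>S. f (trunc_d d (alg.result \<omega> (transcript alg.query grad d \<omega> T))) - f u \<le> \<epsilon>)"
    if f: "lipschitz_d d L f" "convex_d d f" and u: "u \<in> Rd d" "\<forall>y\<in>Rd d. f u \<le> f y" "norm_d d u \<le> R"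
      and grad: "\<forall>x\<in>Rd d. has_gradient_d d f (grad x) x" for f u grad
  proof -
    interpret smoothed_problem d L f grad \<sigma>
      using L f grad par(1) by unfold_locales auto
    let ?L = "lattice d \<eta> K"
    let ?B = "good_samples n m (\<delta> / 4) ?L"
    have \<delta>4: "0 < \<delta> / 4" using par(4) by simp
    have sub: "?L \<subseteq> Rd d" by (auto simp: lattice_Rd)
    note good = good_samples_prob[OF finite_lattice[of d \<eta> K] sub \<delta>4 n, where m = m]
    have "real ((card ?L)\<^sup>2) * (1 / 2) ^ m \<le> (real (2 * K + 1) ^ d)\<^sup>2 * (1 / 2) ^ m"
    proof (intro mult_right_mono)
      have "real (card ?L) \<le> real ((2 * K + 1) ^ d)" using card_lattice of_nat_le_iff by blast
      then show "real ((card ?L)\<^sup>2) \<le> (real (2 * K + 1) ^ d)\<^sup>2"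
        unfolding of_nat_power by (intro power_mono) auto
    qed auto
    then have "1 - \<nu> \<le> measure alg.seeds (alg.samples_of -` ?B)"
      unfolding alg.seeds_event(2)[OF good(1)] using good(2) m by linarith
    moreover have "f (trunc_d d (alg.result \<omega> (transcript alg.query grad d \<omega> T))) - f u \<le> \<epsilon>"
      if \<omega>: "\<omega> \<in> alg.samples_of -` ?B" for \<omega>
    proof -
      \<comment> \<open>With the seed fixed in the good event, the deterministic analysis applies to
        its samples.\<close>
      interpret accelerated_analysis d L f grad \<sigma> \<eta> r \<delta> A\<^sub>0 b\<^sub>0 Amax K n m R \<epsilon> \<theta> u T "alg.samples_of \<omega>"
        by unfold_locales (use par \<omega> u R \<epsilon> in auto)
      obtain p where p: "p \<in> Rd d" "alg.iterate (alg.samples_of \<omega>) qgrad T = Done p" "f p - f u \<le> \<epsilon>"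
        using final_state by blast
      have "qgrad = (\<lambda>q. grad (trunc_d d q))" by (simp add: qgrad_def fun_eq_iff)
      then have "alg.result \<omega> (transcript alg.query grad d \<omega> T) = p"
        using p by (simp add: alg.result_def alg.state_of_transcript)
      then show ?thesis using p by (simp add: trunc_d_id)
    qed
    ultimately show ?thesis using alg.seeds_event(1)[OF good(1)] by blast
  qed
  have "solves work_const 4 d L R \<epsilon> \<nu> (alg.seeds, T, alg.query, alg.result)"
    unfolding solves_def prod.case
    by (intro conjI allI impI ballI alg.prob_space_seeds T' work acc) blast+
  then show ?thesis by blast
qed

theorem mainTheorem4:
  "\<exists>(A :: nat \<Rightarrow> real \<Rightarrow> real \<Rightarrow> real \<Rightarrow> real \<Rightarrow>
         seed measure \<times> nat \<times> (seed \<Rightarrow> history \<Rightarrow> vec list) \<times> (seed \<Rightarrow> history \<Rightarrow> vec))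
      (C :: real) (k :: nat).
     \<forall>d L R \<epsilon> \<nu>. \<epsilon> > 0 \<longrightarrow> \<nu> > 0 \<longrightarrow>
       (case A d L R \<epsilon> \<nu> of (M, D, Q, out) \<Rightarrow>
          prob_space M \<and>
          real D \<le> C * real d powr (1/3) * (L * R / \<epsilon>) powr (2/3) * polylog k d L R \<epsilon> \<nu> \<and>
          (\<forall>f xstar grad.
             differentiable_d d f \<and> lipschitz_d d L f \<and> convex_d d f \<and>
             xstar \<in> Rd d \<and> (\<forall>y\<in>Rd d. f xstar \<le> f y) \<and> norm_d d xstar \<le> R \<and>
             (\<forall>x\<in>Rd d. has_gradient_d d f (grad x) x) \<longrightarrow>
               (\<forall>\<omega>\<in>space M. real (work Q grad d \<omega> D)
                  \<le> C * real d powr (4/3) * (L * R / \<epsilon>) powr (8/3) * polylog k d L R \<epsilon> \<nu>) \<and>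
               (\<exists>S\<in>sets M. measure M S \<ge> 1 - \<nu> \<and>
                  (\<forall>\<omega>\<in>S. f (trunc_d d (out \<omega> (transcript Q grad d \<omega> D))) - f xstar \<le> \<epsilon>))))"
proof -
  have "\<exists>p. solves work_const 4 d L R \<epsilon> \<nu> p" if "0 < \<epsilon>" "0 < \<nu>" for d L R \<epsilon> \<nu>
    using solves_trivial[OF that] solves_nontrivial[OF that] by blast
  then have "\<forall>d L R \<epsilon> \<nu>. \<epsilon> > 0 \<longrightarrow> \<nu> > 0 \<longrightarrow>
      solves work_const 4 d L R \<epsilon> \<nu> (SOME p. solves work_const 4 d L R \<epsilon> \<nu> p)"
    by (blast intro: someI_ex)
  then show ?thesis
    unfolding solves_def
    by (intro exI[of _ "\<lambda>d L R \<epsilon> \<nu>. SOME p. solves work_const 4 d L R \<epsilon> \<nu> p"]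
        exI[of _ work_const] exI[of _ 4]) (simp only: solves_def)
qed

end
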